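(* Let $E$ be a (real) Banach space. (1) If $\alpha$ is a countable ordinal and $m\in\mathbb{N}$, then the following assertions are equivalent: (i) $\mathcal{C}([1,\omega^\alpha m])$ is isomorphic (resp. isometrically isomorphic) to a complemented subspace of $E$; (ii) $E$ admits a projectional tree (resp. an isometric projectional tree) of rank $\alpha+1$ and order $m$. (2) The following assertions are equivalent: (i) $\mathcal{C}(2^\omega)$ is isomorphic (resp. isometrically isomorphic) to a complemented subspace of $E$; (ii) $E$ admits a projectional tree (resp. an isometric projectional tree) of rank $\infty$ and order $1$. Moreover, in both cases, in the implication (ii)$\Rightarrow$(i): (a) if the tree in (ii) is isometric and has norm $1$, then the complemented subspace in (i) can be obtained together with a projection of $E$ onto it of norm $1$; (b) if $E$ is a Banach lattice and the tree in (ii) is positive, then the complemented subspace in (i) can be obtained together with a positive projection of $E$ onto it.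
   Context: Conventions: $\omega=\{0,1,2,\dots\}$, $\mathbb{N}=\{1,2,\dots\}$; Banach spaces are real, operators are linear; $\mathcal{C}(L)$ is the space of continuous real functions on a compact Hausdorff space $L$ with the sup norm; ordinal intervals carry the order topology; $2^\omega$ is the Cantor space. A closed subspace is complemented if it is the range of a bounded linear projection. An isometric (isomorphic) embedding is a linear isometry (isomorphism) onto its range. For a Banach lattice $E$, $E_+$ is its positive cone, $E^*_+=\{e^*\in E^*: e^*(e)\ge0\ \forall e\in E_+\}$; for a subspace $G$, $G_+=G\cap E_+$; an operator is positive if it maps positive elements to positive elements. Trees. $\mathbb{L}=\omega^{<\omega}$ is the set of finite sequences in $\omega$, $\epsilon$ the empty sequence, $l(s)$ the length of $s$, $s\preceq t$ means $s$ is an initial segment of $t$, $s\prec t$ means $s\preceq t$ and $s\ne t$, $s*n$ is $s$ with $n$ appended. $\Lambda\subseteq\mathbb{L}$ is hereditary if $s\preceq t\in\Lambda$ implies $s\in\Lambda$. A leaf of $\Lambda$ is an $s\in\Lambda$ with no $t\in\Lambda$, $s\prec t$; $NL(\Lambda)$ is the set of non-leaves. If $\Lambda$ is hereditary, $\epsilon\in\Lambda$, and $\Lambda$ has no infinite branch (no infinite $\prec$-increasing sequence), set $r(s)=0$ for leaves and $r(s)=\sup\{r(t)+1: t\in\Lambda, s\prec t\}$ otherwise. For a countable ordinal $\alpha$, a tree of rank $\alpha+1$ is a hereditary $\Lambda\subseteq\mathbb{L}$ with $\epsilon\in\Lambda$, without infinite branches, with $r(\epsilon)=\alpha$, such that each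 $s\in\Lambda$ is a leaf or satisfies $s*n\in\Lambda$ for all $n\in\omega$, and for each $s\in NL(\Lambda)$ the sequence $(r(s*n))_{n\in\omega}$ is constant or strictly increasing. The tree of rank $\infty$ is $\mathbb{L}$ itself. Spaces $\mathcal{A}_\Lambda$. For a tree $\Lambda$ and $a=(a_s)_{s\in\Lambda}\in\mathbb{R}^\Lambda$ let $\|a\|^\Lambda=\sup_{t\in\Lambda}|\sum_{s\preceq t}a_s|$. For $\Omega\subseteq\Lambda$, $a\restriction\Omega\in\mathbb{R}^\Lambda$ equals $a$ on $\Omega$ and $0$ off $\Omega$. Let $\Lambda_s=\{t\in\Lambda:s\preceq t\}$. $\mathcal{A}_\Lambda$ is the normed space (norm $\|\cdot\|^\Lambda$) of all $a\in\mathbb{R}^\Lambda$ with (A.1) $\|a\|^\Lambda<\infty$; (A.2) $\lim_{n}\|a\restriction\Lambda_{s*n}\|^\Lambda=0$ for each $s\in NL(\Lambda)$; (A.3) $\lim_n\|a\restriction\{t\in\Lambda:l(t)\ge n\}\|^\Lambda=0$. Order: $a\le b$ iff $\sum_{s\preceq t}a_s\le\sum_{s\preceq t}b_s$ for all $t\in\Lambda$. $\mathcal{A}_\Lambda^m$ is its $m$-th power with the maximum norm and coordinatewise order. $\Sigma_m(\Lambda)=\Lambda\times\{1,\dots,m\}$. For $(s,i)\in\Sigma_m(\Lambda)$, $\tilde\delta_{s,i}\in(\mathcal{A}_\Lambda^m)^*$ is $\tilde\delta_{s,i}\big((a_{t,j})_{(t,j)}\big)=\sum_{t\preceq s}a_{t,i}$.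 Metric on trees. For $s=\langle s_1,\dots,s_n\rangle\in\mathbb{L}$ let $R(s)\in 2^\omega$ be the sequence consisting of $s_1$ ones, a zero, $s_2$ ones, a zero, …, $s_n$ ones, a zero, followed by infinitely many ones ($R(\epsilon)$ is constantly $1$). $R$ is injective; trees are metrized by $d(s,t)=d_{2^\omega}(R(s),R(t))$, where $d_{2^\omega}(x,y)=2^{-k}$ with $k$ the first index at which $x\ne y$ differ, and $d_{2^\omega}(x,x)=0$. $\Sigma_m(\Lambda)$ is the disjoint union of $m$ copies of this metric space (points in different copies at distance $1$). A map $\rho:X\to E^*$ on a metric space $(X,d)$ is uniformly weak$^*$ continuous if for all $e\in E$ and sequences $(x_n),(y_n)$ in $X$, $d(x_n,y_n)\to0$ implies $\langle\rho(x_n)-\rho(y_n),e\rangle\to0$. Projectional tree. Let $\beta$ be a countable successor ordinal or $\infty$ and $m\in\mathbb{N}$. A projectional tree of rank $\beta$ and order $m$ in $E$ is a triple $(\Sigma,T,\rho)$ where $\Sigma=\Sigma_m(\Lambda)$ for some tree $\Lambda$ of rank $\beta$, $T:\mathcal{A}_\Lambda^m\to E$ is an isomorphic embedding, and $\rho:\Sigma\to E^*$ is uniformly weak$^*$ continuous with bounded range and satisfies $T^*(\rho(s,i))=\tilde\delta_{s,i}$ for all $(s,i)\in\Sigma$. It is isometric if $T$ is an isometry. Its norm is the infimum of all $C>0$ with $\rho[\Sigma]\subseteq C\cdot B_{E^*}$. If $E$ is a Banach lattice, it is positive if $T$ is a positive operator and $\rho[\Sigma]\subseteq E^*_+$. 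*)

theory Defs
  imports "HOL-Analysis.Analysis" "HOL-Library.Countable_Set_Type" "HOL-Library.Sublist"
begin

section \<open>Countable ordinals\<close>

text \<open>The first uncountable cardinal \<open>cardSuc natLeq\<close> is a well-order whose elements, in
  increasing order, are the countable ordinals.\<close>

typedef cord = "Field (cardSuc natLeq)"
  using Field_cardSuc_not_empty[OF natLeq_Card_order] by blast

lemma Card_order_omega1: "Card_order (cardSuc natLeq)"
  by (simp add: cardSuc_Card_order natLeq_Card_order)

lemma Well_order_omega1: "Well_order (cardSuc natLeq)"
  using Card_order_omega1 card_order_on_def by blast

instantiation cord :: wellorder
begin

definition less_eq_cord :: "cord \<Rightarrow> cord \<Rightarrow> bool" where
  "x \<le> y \<longleftrightarrow> (Rep_cord x, Rep_cord y) \<in> cardSuc natLeq"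

definition less_cord :: "cord \<Rightarrow> cord \<Rightarrow> bool" where
  "(x :: cord) < y \<longleftrightarrow> x \<le> y \<and> x \<noteq> y"

instance
proof -
  let ?r = "cardSuc natLeq"
  have refl: "refl_on (Field ?r) ?r" and trans: "trans ?r" and anti: "antisym ?r"
    and total: "total_on (Field ?r) ?r" and wf: "wf (?r - Id)"
    using Well_order_omega1
    unfolding well_order_on_def linear_order_on_def partial_order_on_def preorder_on_def by auto
  have le_refl: "x \<le> x" for x :: cord
    using refl Rep_cord unfolding less_eq_cord_def refl_on_def by blast
  have le_trans: "x \<le> y \<Longrightarrow> y \<le> z \<Longrightarrow> x \<le> z" for x y z :: cord
    using trans unfolding less_eq_cord_def trans_def by blast
  have le_antisym: "x \<le> y \<Longrightarrow> y \<le> x \<Longrightarrow> x = y" for x y :: cord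
    using anti unfolding less_eq_cord_def antisym_def by (meson Rep_cord_inject)
  have le_total: "x \<le> y \<or> y \<le> x" for x y :: cord
    using total refl Rep_cord[of x] Rep_cord[of y]
    unfolding less_eq_cord_def total_on_def refl_on_def by metis
  have "wf (inv_image (?r - Id) Rep_cord)"
    using wf by (rule wf_inv_image)
  moreover have "{(x, y). x < y} = inv_image (?r - Id) Rep_cord"
    by (auto simp: less_cord_def less_eq_cord_def inv_image_def Rep_cord_inject)
  ultimately have wf_less: "wf {(x :: cord, y). x < y}"
    by simp
  show "OFCLASS(cord, wellorder_class)"
  proof
    fix x y z :: cord
    show "x < y \<longleftrightarrow> x \<le> y \<and> \<not> y \<le> x"
      using le_antisym le_refl unfolding less_cord_def by blast
    show "x \<le> x" by (rule le_refl)
    show "x \<le> y \<Longrightarrow> y \<le> z \<Longrightarrow> x \<le> z" by (rule le_trans)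
    show "x \<le> y \<Longrightarrow> y \<le> x \<Longrightarrow> x = y" by (rule le_antisym)
    show "x \<le> y \<or> y \<le> x" by (rule le_total)
  next
    fix P :: "cord \<Rightarrow> bool" and a :: cord
    assume "\<And>x. (\<And>y. y < x \<Longrightarrow> P y) \<Longrightarrow> P x"
    then show "P a"
      using wf_induct_rule[OF wf_less, of P a] by blast
  qed
qed

end

lemma countable_lessThan_cord:
  includes cardinal_syntax
  shows "countable {..<a :: cord}"
proof -
  let ?r = "cardSuc natLeq"
  have "|underS ?r (Rep_cord a)| <o ?r"
    using card_of_underS[OF Card_order_omega1] Rep_cord by blast
  then have "|underS ?r (Rep_cord a)| \<le>o natLeq"
    using cardSuc_ordLess_ordLeq[OF natLeq_Card_order card_of_Card_order]
      cardSuc_ordLeq_ordLess[OF natLeq_Card_order card_of_Card_order] by blast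
  then have "countable (underS ?r (Rep_cord a))"
    by (simp add: countable_card_le_natLeq)
  moreover have "Rep_cord ` {..<a} \<subseteq> underS ?r (Rep_cord a)"
    by (auto simp: underS_def less_cord_def less_eq_cord_def Rep_cord_inject)
  ultimately have "countable (Rep_cord ` {..<a})"
    by (rule countable_subset[rotated])
  then show ?thesis
    by (rule countable_image_inj_on) (simp add: inj_on_def Rep_cord_inject)
qed

lemma uncountable_UNIV_cord:
  includes cardinal_syntax
  shows "uncountable (UNIV :: cord set)"
proof
  let ?r = "cardSuc natLeq"
  assume "countable (UNIV :: cord set)"
  then have "countable (range Rep_cord)" by simp
  then have "countable (Field ?r)"
    using type_definition.Rep_range[OF type_definition_cord] by simp
  then have "|Field ?r| \<le>o natLeq"
    by (simp add: countable_card_le_natLeq)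
  moreover have "|Field ?r| =o ?r"
    using Card_order_omega1 by (rule card_of_Field_ordIso)
  ultimately have "?r \<le>o natLeq"
    using ordIso_ordLeq_trans ordIso_symmetric by blast
  then show False
    using cardSuc_greater[OF natLeq_Card_order] not_ordLess_ordLeq by blast
qed

lemma countable_bounded_cord:
  fixes A :: "cord set"
  assumes "countable A"
  obtains b where "\<And>a. a \<in> A \<Longrightarrow> a < b"
proof -
  have "countable (\<Union>a\<in>A. {..a})"
    using assms countable_lessThan_cord by (auto simp: ivl_disj_un(2)[symmetric])
  then obtain b where "b \<notin> (\<Union>a\<in>A. {..a})"
    using uncountable_UNIV_cord by (metis UNIV_eq_I)
  then show thesis
    by (intro that[of b]) auto
qed

instantiation cord :: conditionally_complete_linorder
begin

definition "inf (x :: cord) y = min x y"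
definition "sup (x :: cord) y = max x y"
definition "Inf (X :: cord set) = (LEAST x. x \<in> X)"
definition "Sup (X :: cord set) = (LEAST c. \<forall>x\<in>X. x \<le> c)"

instance
proof
  fix x z :: cord and X :: "cord set"
  show "Inf X \<le> x" if "x \<in> X"
    using that unfolding Inf_cord_def by (rule Least_le)
  show "z \<le> Inf X" if "X \<noteq> {}" "\<And>x. x \<in> X \<Longrightarrow> z \<le> x"
    using that unfolding Inf_cord_def by (metis LeastI ex_in_conv)
  show "x \<le> Sup X" if "x \<in> X" "bdd_above X"
  proof -
    obtain c where "\<forall>x\<in>X. x \<le> c"
      using \<open>bdd_above X\<close> by (auto simp: bdd_above_def)
    then have "\<forall>x\<in>X. x \<le> Sup X"
      unfolding Sup_cord_def by (rule LeastI)
    with \<open>x \<in> X\<close> show ?thesis by blast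
  qed
  show "Sup X \<le> z" if "X \<noteq> {}" "\<And>x. x \<in> X \<Longrightarrow> x \<le> z"
    using that unfolding Sup_cord_def by (blast intro: Least_le)
qed (auto simp: inf_cord_def sup_cord_def)

end

lemma countable_bdd_above_cord: "countable A \<Longrightarrow> bdd_above (A :: cord set)"
  by (metis bdd_above.I countable_bounded_cord less_imp_le)

instantiation cord :: linorder_topology
begin

definition open_cord :: "cord set \<Rightarrow> bool" where
  "open_cord = generate_topology (range (\<lambda>a. {..<a}) \<union> range (\<lambda>a. {a<..}))"

instance
  by standard (simp add: open_cord_def)

end

definition csucc :: "cord \<Rightarrow> cord" where
  "csucc a = (LEAST b. a < b)"

lemma less_csucc: "a < csucc a"
proof -
  obtain b where "a < b"
    using countable_bounded_cord[of "{a}"] by auto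
  then show ?thesis
    unfolding csucc_def by (rule LeastI)
qed

lemma csucc_le_iff: "csucc a \<le> b \<longleftrightarrow> a < b"
  using less_csucc[of a] unfolding csucc_def by (auto intro: Least_le)

lemma less_csucc_iff: "x < csucc a \<longleftrightarrow> x \<le> a"
  by (meson csucc_le_iff not_less)

instantiation cord :: "{zero, one}"
begin

definition zero_cord :: cord where "(0 :: cord) = (LEAST a. True)"
definition one_cord :: cord where "(1 :: cord) = csucc 0"

instance ..

end

lemma zero_le_cord [simp]: "(0 :: cord) \<le> a"
  unfolding zero_cord_def by (simp add: Least_le)

lemma not_less_zero_cord [simp]: "\<not> a < (0 :: cord)"
  by (simp add: not_less)

instantiation cord :: "{plus, times}"
begin

function plus_cord :: "cord \<Rightarrow> cord \<Rightarrow> cord" where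
  "plus_cord a b = (if b = 0 then a else SUP x\<in>{..<b}. csucc (plus_cord a x))"
  by auto
termination
  by (relation "inv_image {(x, y). x < y} snd") (auto intro: wf_inv_image wf)

function times_cord :: "cord \<Rightarrow> cord \<Rightarrow> cord" where
  "times_cord a b = (if b = 0 then 0 else SUP x\<in>{..<b}. times_cord a x + a)"
  by auto
termination
  by (relation "inv_image {(x, y). x < y} snd") (auto intro: wf_inv_image wf)

instance ..

end

text \<open>Ordinal exponentiation, as opposed to the overloaded \<open>(^)\<close> and \<open>(powr)\<close>.\<close>

function cpow :: "cord \<Rightarrow> cord \<Rightarrow> cord" where
  "cpow a b = (if b = 0 then 1 else SUP x\<in>{..<b}. cpow a x * a)"
  by auto
termination
  by (relation "inv_image {(x, y). x < y} snd") (auto intro: wf_inv_image wf)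

declare plus_cord.simps [simp del] times_cord.simps [simp del] cpow.simps [simp del]

definition cord_of_nat :: "nat \<Rightarrow> cord" where
  "cord_of_nat n = (csucc ^^ n) 0"

definition omega :: cord where
  "omega = (SUP n. cord_of_nat n)"


lemma SUP_lessThan_cord:
  fixes f :: "cord \<Rightarrow> cord"
  shows "x < b \<Longrightarrow> f x \<le> (SUP x\<in>{..<b}. f x)"
    and "b \<noteq> 0 \<Longrightarrow> (\<And>x. x < b \<Longrightarrow> f x \<le> c) \<Longrightarrow> (SUP x\<in>{..<b}. f x) \<le> c"
proof -
  show "x < b \<Longrightarrow> f x \<le> (SUP x\<in>{..<b}. f x)"
    by (rule cSUP_upper) (auto intro!: countable_bdd_above_cord countable_image countable_lessThan_cord)
  assume "b \<noteq> 0" and *: "\<And>x. x < b \<Longrightarrow> f x \<le> c"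
  then have "{..<b} \<noteq> {}"
    by (metis empty_iff lessThan_iff order_le_imp_less_or_eq zero_le_cord)
  then show "(SUP x\<in>{..<b}. f x) \<le> c"
    using * by (auto intro: cSUP_least)
qed

lemma csucc_neq_0 [simp]: "csucc a \<noteq> 0"
  using less_csucc[of a] zero_le_cord[of a] by (metis not_less)

lemma cord_add_0: "a + (0 :: cord) = a"
  by (simp add: plus_cord.simps)

lemma cord_add_less: "x < b \<Longrightarrow> a + x < a + (b :: cord)"
  using SUP_lessThan_cord(1)[of x b "\<lambda>x. csucc (a + x)"]
  by (subst (2) plus_cord.simps) (auto simp: csucc_le_iff)

lemma cord_add_le: "x \<le> b \<Longrightarrow> a + x \<le> a + (b :: cord)"
  by (metis cord_add_less order.order_iff_strict)

lemma cord_add_csucc: "a + csucc b = csucc (a + b)"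
proof (rule antisym)
  show "a + csucc b \<le> csucc (a + b)"
    by (subst plus_cord.simps)
      (auto intro!: SUP_lessThan_cord(2) cord_add_le simp: csucc_le_iff less_csucc_iff)
  show "csucc (a + b) \<le> a + csucc b"
    by (simp add: csucc_le_iff cord_add_less less_csucc)
qed

lemma cord_add_limit:
  assumes "b \<noteq> 0" "\<And>x. x < b \<Longrightarrow> csucc x < b"
  shows "a + b = (SUP x\<in>{..<b}. a + x)"
proof (rule antisym)
  show "a + b \<le> (SUP x\<in>{..<b}. a + x)"
    using assms SUP_lessThan_cord(1)[of "csucc _" b "\<lambda>x. a + x"]
    by (subst plus_cord.simps) (auto intro!: SUP_lessThan_cord(2) simp: cord_add_csucc)
  show "(SUP x\<in>{..<b}. a + x) \<le> a + b"
    using assms by (intro SUP_lessThan_cord(2)) (auto intro: cord_add_le)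
qed

lemma cord_add_1: "a + 1 = csucc a"
  by (simp add: one_cord_def cord_add_csucc cord_add_0)

lemma cord_le_add: "a \<le> a + (b :: cord)"
  by (metis cord_add_0 cord_add_le zero_le_cord)

lemma cord_add_mono_left: "a \<le> b \<Longrightarrow> a + c \<le> b + (c :: cord)"
proof (induction c rule: less_induct)
  case (less c)
  show ?case
  proof (cases "c = 0")
    case False
    have "csucc (a + x) \<le> b + c" if "x < c" for x
      using less.IH[OF that less.prems] cord_add_less[OF that, of b]
      by (simp add: csucc_le_iff le_less_trans)
    then show ?thesis
      using False by (subst plus_cord.simps) (auto intro!: SUP_lessThan_cord(2))
  qed (use less in \<open>simp add: cord_add_0\<close>)
qed

lemma cord_mult_0: "a * (0 :: cord) = 0"
  by (simp add: times_cord.simps)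

lemma cord_mult_add_le: "x < b \<Longrightarrow> a * x + a \<le> a * (b :: cord)"
  using SUP_lessThan_cord(1)[of x b "\<lambda>x. a * x + a"]
  by (subst (2) times_cord.simps) auto

lemma cord_mult_le: "x \<le> b \<Longrightarrow> a * x \<le> a * (b :: cord)"
  by (metis cord_le_add cord_mult_add_le order.order_iff_strict order_trans)

lemma cord_mult_csucc: "a * csucc b = a * b + a"
proof (rule antisym)
  show "a * csucc b \<le> a * b + a"
    by (subst times_cord.simps)
      (auto intro!: SUP_lessThan_cord(2) cord_add_mono_left cord_mult_le simp: less_csucc_iff)
  show "a * b + a \<le> a * csucc b"
    by (simp add: cord_mult_add_le less_csucc)
qed

lemma cord_mult_limit:
  assumes "b \<noteq> 0" "\<And>x. x < b \<Longrightarrow> csucc x < b"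
  shows "a * b = (SUP x\<in>{..<b}. a * x)"
proof (rule antisym)
  show "a * b \<le> (SUP x\<in>{..<b}. a * x)"
    using assms SUP_lessThan_cord(1)[of "csucc _" b "\<lambda>x. a * x"]
    by (subst times_cord.simps) (auto intro!: SUP_lessThan_cord(2) simp: cord_mult_csucc)
  show "(SUP x\<in>{..<b}. a * x) \<le> a * b"
    using assms by (intro SUP_lessThan_cord(2)) (auto intro: cord_mult_le)
qed

lemma cord_mult_mono_left: "a \<le> b \<Longrightarrow> a * c \<le> b * (c :: cord)"
proof (induction c rule: less_induct)
  case (less c)
  show ?case
  proof (cases "c = 0")
    case False
    have "a * x + a \<le> b * c" if "x < c" for x
      using less that cord_mult_add_le[OF that, of b]
      by (meson cord_add_le cord_add_mono_left order_trans)
    then show ?thesis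
      using False by (subst times_cord.simps) (auto intro!: SUP_lessThan_cord(2))
  qed (simp add: cord_mult_0)
qed

lemma cord_0_add: "(0 :: cord) + a = a"
proof (induction a rule: less_induct)
  case (less a)
  show ?case
  proof (cases "a = 0")
    case False
    have "0 + a \<le> a"
      using False less by (subst plus_cord.simps) (auto intro!: SUP_lessThan_cord(2) simp: csucc_le_iff)
    moreover have "\<not> 0 + a < a"
      using less cord_add_less[of "0 + a" a 0] by fastforce
    ultimately show ?thesis by simp
  qed (simp add: cord_add_0)
qed

lemma cord_mult_1: "a * (1 :: cord) = a"
  by (simp add: one_cord_def cord_mult_csucc cord_mult_0 cord_0_add)

lemma cpow_0: "cpow a 0 = 1"
  by (simp add: cpow.simps)

lemma cpow_mult_le: "x < b \<Longrightarrow> cpow a x * a \<le> cpow a b"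
  using SUP_lessThan_cord(1)[of x b "\<lambda>x. cpow a x * a"]
  by (subst (2) cpow.simps) auto

lemma cpow_le: "a \<noteq> 0 \<Longrightarrow> x \<le> b \<Longrightarrow> cpow a x \<le> cpow a b"
proof -
  assume "a \<noteq> 0" "x \<le> b"
  then have "1 \<le> a"
    by (simp add: one_cord_def csucc_le_iff order_less_le)
  then have "cpow a x \<le> cpow a x * a"
    by (metis cord_mult_1 cord_mult_le)
  with \<open>x \<le> b\<close> show ?thesis
    by (metis cpow_mult_le order.order_iff_strict order_trans)
qed

lemma cpow_csucc: "a \<noteq> 0 \<Longrightarrow> cpow a (csucc b) = cpow a b * a"
proof (rule antisym)
  show "a \<noteq> 0 \<Longrightarrow> cpow a (csucc b) \<le> cpow a b * a"
    by (subst cpow.simps)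
      (auto intro!: SUP_lessThan_cord(2) cord_mult_mono_left cpow_le simp: less_csucc_iff)
  show "cpow a b * a \<le> cpow a (csucc b)"
    by (simp add: cpow_mult_le less_csucc)
qed

lemma cpow_limit:
  assumes "a \<noteq> 0" "b \<noteq> 0" "\<And>x. x < b \<Longrightarrow> csucc x < b"
  shows "cpow a b = (SUP x\<in>{..<b}. cpow a x)"
proof (rule antisym)
  show "cpow a b \<le> (SUP x\<in>{..<b}. cpow a x)"
    using assms SUP_lessThan_cord(1)[of "csucc _" b "\<lambda>x. cpow a x"]
    by (subst cpow.simps) (auto intro!: SUP_lessThan_cord(2) simp: cpow_csucc)
  show "(SUP x\<in>{..<b}. cpow a x) \<le> cpow a b"
    using assms by (intro SUP_lessThan_cord(2)) (auto intro: cpow_le)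
qed


section \<open>Spaces of continuous functions and complemented subspaces\<close>

text \<open>For a compact subset \<open>K\<close> of a topological space, \<open>\<C>(K)\<close> consists of the real functions
  continuous on \<open>K\<close>; such a function is made unique as an HOL function by the value 0 off \<open>K\<close>.
  An order interval \<open>{1..\<gamma>}\<close> of \<open>cord\<close> is convex, hence its subspace topology is its own
  order topology.\<close>

definition cspace :: "'k::topological_space set \<Rightarrow> ('k \<Rightarrow> real) set" where
  "cspace K = {f. continuous_on K f \<and> (\<forall>x. x \<notin> K \<longrightarrow> f x = 0)}"

definition supnorm :: "'k set \<Rightarrow> ('k \<Rightarrow> real) \<Rightarrow> real" where
  "supnorm K f = (SUP x\<in>K. \<bar>f x\<bar>)"

text \<open>A normed space of real functions is given by its carrier \<open>V\<close>, with the pointwise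
  operations, and its norm \<open>N\<close>.\<close>

definition linear_map_on :: "('i \<Rightarrow> real) set \<Rightarrow> (('i \<Rightarrow> real) \<Rightarrow> 'e::real_vector) \<Rightarrow> bool" where
  "linear_map_on V J \<longleftrightarrow>
     (\<forall>f\<in>V. \<forall>g\<in>V. J (\<lambda>x. f x + g x) = J f + J g) \<and>
     (\<forall>c. \<forall>f\<in>V. J (\<lambda>x. c * f x) = c *\<^sub>R J f)"

definition isomorphic_embedding ::
  "('i \<Rightarrow> real) set \<Rightarrow> (('i \<Rightarrow> real) \<Rightarrow> real) \<Rightarrow> (('i \<Rightarrow> real) \<Rightarrow> 'e::real_normed_vector) \<Rightarrow> bool" where
  "isomorphic_embedding V N J \<longleftrightarrow> linear_map_on V J \<and>
     (\<exists>c>0. \<exists>C. \<forall>f\<in>V. c * N f \<le> norm (J f) \<and> norm (J f) \<le> C * N f)"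

definition isometric_embedding ::
  "('i \<Rightarrow> real) set \<Rightarrow> (('i \<Rightarrow> real) \<Rightarrow> real) \<Rightarrow> (('i \<Rightarrow> real) \<Rightarrow> 'e::real_normed_vector) \<Rightarrow> bool" where
  "isometric_embedding V N J \<longleftrightarrow> linear_map_on V J \<and> (\<forall>f\<in>V. norm (J f) = N f)"

definition C_isomorphic :: "'k::topological_space set \<Rightarrow> 'e::real_normed_vector set \<Rightarrow> bool" where
  "C_isomorphic K Y \<longleftrightarrow> (\<exists>J. isomorphic_embedding (cspace K) (supnorm K) J \<and> J ` cspace K = Y)"

definition C_isometric :: "'k::topological_space set \<Rightarrow> 'e::real_normed_vector set \<Rightarrow> bool" where
  "C_isometric K Y \<longleftrightarrow> (\<exists>J. isometric_embedding (cspace K) (supnorm K) J \<and> J ` cspace K = Y)"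

definition projection_onto :: "'e::real_normed_vector set \<Rightarrow> ('e \<Rightarrow>\<^sub>L 'e) \<Rightarrow> bool" where
  "projection_onto Y P \<longleftrightarrow> P o\<^sub>L P = P \<and> range (blinfun_apply P) = Y"

definition complemented :: "'e::real_normed_vector set \<Rightarrow> bool" where
  "complemented Y \<longleftrightarrow> subspace Y \<and> closed Y \<and> (\<exists>P. projection_onto Y P)"


section \<open>Banach lattices\<close>

locale banach_lattice = lattice inf less_eq less sup
  for inf :: "'e::banach \<Rightarrow> 'e \<Rightarrow> 'e" and less_eq less :: "'e \<Rightarrow> 'e \<Rightarrow> bool"
    and sup :: "'e \<Rightarrow> 'e \<Rightarrow> 'e" +
  assumes add_right_mono_order: "less_eq x y \<Longrightarrow> less_eq (x + z) (y + z)"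
    and scaleR_left_mono_order: "less_eq x y \<Longrightarrow> 0 \<le> c \<Longrightarrow> less_eq (c *\<^sub>R x) (c *\<^sub>R y)"
    and lattice_norm: "less_eq (sup x (- x)) (sup y (- y)) \<Longrightarrow> norm x \<le> norm y"

text \<open>The order \<open>le\<close> of the Banach lattice is an explicit argument.\<close>

definition positive_cone :: "('e \<Rightarrow> 'e \<Rightarrow> bool) \<Rightarrow> 'e::real_normed_vector set" where
  "positive_cone le = {x. le 0 x}"

definition dual_positive_cone :: "('e \<Rightarrow> 'e \<Rightarrow> bool) \<Rightarrow> ('e::real_normed_vector \<Rightarrow>\<^sub>L real) set" where
  "dual_positive_cone le = {\<phi>. \<forall>x\<in>positive_cone le. 0 \<le> blinfun_apply \<phi> x}"

definition positive_operator :: "('e \<Rightarrow> 'e \<Rightarrow> bool) \<Rightarrow> ('e::real_normed_vector \<Rightarrow>\<^sub>L 'e) \<Rightarrow> bool" where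
  "positive_operator le P \<longleftrightarrow> (\<forall>x\<in>positive_cone le. blinfun_apply P x \<in> positive_cone le)"


section \<open>Trees\<close>

text \<open>\<open>\<L>\<close> is the type \<open>nat list\<close>, and \<open>s*n\<close> is \<open>s @ [n]\<close>.\<close>

type_synonym node = "nat list"

definition hereditary :: "node set \<Rightarrow> bool" where
  "hereditary \<Lambda> \<longleftrightarrow> (\<forall>s t. prefix s t \<and> t \<in> \<Lambda> \<longrightarrow> s \<in> \<Lambda>)"

definition leaf :: "node set \<Rightarrow> node \<Rightarrow> bool" where
  "leaf \<Lambda> s \<longleftrightarrow> s \<in> \<Lambda> \<and> \<not> (\<exists>t\<in>\<Lambda>. strict_prefix s t)"

definition nonleaves :: "node set \<Rightarrow> node set" where
  "nonleaves \<Lambda> = {s \<in> \<Lambda>. \<not> leaf \<Lambda> s}"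

definition no_infinite_branch :: "node set \<Rightarrow> bool" where
  "no_infinite_branch \<Lambda> \<longleftrightarrow>
     \<not> (\<exists>b :: nat \<Rightarrow> node. \<forall>n. b n \<in> \<Lambda> \<and> strict_prefix (b n) (b (Suc n)))"

text \<open>The rank function \<open>r\<close>, by well-founded recursion; it is meaningful only if \<open>\<Lambda>\<close> has no
  infinite branch.\<close>

definition node_rank :: "node set \<Rightarrow> node \<Rightarrow> cord" where
  "node_rank \<Lambda> = wfrec {(t, s). s \<in> \<Lambda> \<and> t \<in> \<Lambda> \<and> strict_prefix s t}
     (\<lambda>r s. if leaf \<Lambda> s then 0 else SUP t\<in>{t \<in> \<Lambda>. strict_prefix s t}. r t + 1)"

lemma node_rank:
  assumes "no_infinite_branch \<Lambda>" "s \<in> \<Lambda>"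
  shows "node_rank \<Lambda> s =
    (if leaf \<Lambda> s then 0 else SUP t\<in>{t \<in> \<Lambda>. strict_prefix s t}. node_rank \<Lambda> t + 1)"
proof -
  have "wf {(t, s). s \<in> \<Lambda> \<and> t \<in> \<Lambda> \<and> strict_prefix s t}"
    using assms(1) unfolding no_infinite_branch_def wf_iff_no_infinite_down_chain by auto
  from def_wfrec[OF eq_reflection[OF node_rank_def] this, of s] show ?thesis
    using assms(2) by (auto simp: cut_def intro!: SUP_cong)
qed

lemma bdd_above_node_rank: "bdd_above ((\<lambda>t. node_rank \<Lambda> t + 1) ` A)"
  by (rule countable_bdd_above_cord) simp

datatype tree_rank = Rank cord | Infinite_Rank

fun tree_of_rank :: "tree_rank \<Rightarrow> node set \<Rightarrow> bool" where
  "tree_of_rank (Rank \<beta>) \<Lambda> \<longleftrightarrow>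
     hereditary \<Lambda> \<and> [] \<in> \<Lambda> \<and> no_infinite_branch \<Lambda> \<and>
     node_rank \<Lambda> [] + 1 = \<beta> \<and>
     (\<forall>s\<in>\<Lambda>. leaf \<Lambda> s \<or> (\<forall>n. s @ [n] \<in> \<Lambda>)) \<and>
     (\<forall>s\<in>nonleaves \<Lambda>.
        (\<exists>c. \<forall>n. node_rank \<Lambda> (s @ [n]) = c) \<or> strict_mono (\<lambda>n. node_rank \<Lambda> (s @ [n])))"
| "tree_of_rank Infinite_Rank \<Lambda> \<longleftrightarrow> \<Lambda> = UNIV"


section \<open>The spaces \<open>\<A>\<^sub>\<Lambda>\<close> and their powers\<close>

definition branch_sum :: "(node \<Rightarrow> real) \<Rightarrow> node \<Rightarrow> real" where
  "branch_sum a t = (\<Sum>s | prefix s t. a s)"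

text \<open>On bounded families only. If the family \<open>a\<close> is bounded and \<open>\<Lambda>\<close> is hereditary,
  then so are the restrictions of \<open>a\<close> occurring in conditions (A.2) and (A.3) below.\<close>

definition tree_norm :: "node set \<Rightarrow> (node \<Rightarrow> real) \<Rightarrow> real" where
  "tree_norm \<Lambda> a = (SUP t\<in>\<Lambda>. \<bar>branch_sum a t\<bar>)"

definition restrict0 :: "(node \<Rightarrow> real) \<Rightarrow> node set \<Rightarrow> node \<Rightarrow> real" where
  "restrict0 a \<Omega> = (\<lambda>s. if s \<in> \<Omega> then a s else 0)"

text \<open>Elements of \<open>\<real>\<^sup>\<Lambda>\<close> are functions vanishing off \<open>\<Lambda>\<close>.\<close>

definition Aspace :: "node set \<Rightarrow> (node \<Rightarrow> real) set" where
  "Aspace \<Lambda> = {a. (\<forall>s. s \<notin> \<Lambda> \<longrightarrow> a s = 0) \<and>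
     bdd_above ((\<lambda>t. \<bar>branch_sum a t\<bar>) ` \<Lambda>) \<and>
     (\<forall>s\<in>nonleaves \<Lambda>.
        (\<lambda>n. tree_norm \<Lambda> (restrict0 a {t \<in> \<Lambda>. prefix (s @ [n]) t})) \<longlonglongrightarrow> 0) \<and>
     (\<lambda>n. tree_norm \<Lambda> (restrict0 a {t \<in> \<Lambda>. n \<le> length t})) \<longlonglongrightarrow> 0}"

definition Sigma_copies :: "nat \<Rightarrow> node set \<Rightarrow> (node \<times> nat) set" where
  "Sigma_copies m \<Lambda> = \<Lambda> \<times> {1..m}"

text \<open>An element of \<open>\<A>\<^sub>\<Lambda>\<^sup>m\<close> is a family over \<open>\<Sigma>\<^sub>m(\<Lambda>)\<close>, with \<open>m \<ge> 1\<close>.\<close>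

definition Aspace_pow :: "nat \<Rightarrow> node set \<Rightarrow> (node \<times> nat \<Rightarrow> real) set" where
  "Aspace_pow m \<Lambda> = {a. (\<forall>x. x \<notin> Sigma_copies m \<Lambda> \<longrightarrow> a x = 0) \<and>
     (\<forall>i\<in>{1..m}. (\<lambda>s. a (s, i)) \<in> Aspace \<Lambda>)}"

definition Anorm_pow :: "nat \<Rightarrow> node set \<Rightarrow> (node \<times> nat \<Rightarrow> real) \<Rightarrow> real" where
  "Anorm_pow m \<Lambda> a = Max ((\<lambda>i. tree_norm \<Lambda> (\<lambda>s. a (s, i))) ` {1..m})"

definition A_le :: "node set \<Rightarrow> (node \<Rightarrow> real) \<Rightarrow> (node \<Rightarrow> real) \<Rightarrow> bool" where
  "A_le \<Lambda> a b \<longleftrightarrow> (\<forall>t\<in>\<Lambda>. branch_sum a t \<le> branch_sum b t)"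

definition A_le_pow :: "nat \<Rightarrow> node set \<Rightarrow> (node \<times> nat \<Rightarrow> real) \<Rightarrow> (node \<times> nat \<Rightarrow> real) \<Rightarrow> bool" where
  "A_le_pow m \<Lambda> a b \<longleftrightarrow> (\<forall>i\<in>{1..m}. A_le \<Lambda> (\<lambda>s. a (s, i)) (\<lambda>s. b (s, i)))"

definition dtilde :: "node \<times> nat \<Rightarrow> (node \<times> nat \<Rightarrow> real) \<Rightarrow> real" where
  "dtilde = (\<lambda>(s, i) a. \<Sum>t | prefix t s. a (t, i))"


section \<open>The metric on trees\<close>

definition cantor_code :: "node \<Rightarrow> nat \<Rightarrow> bool" where
  "cantor_code s = (\<lambda>k.
     let w = concat (map (\<lambda>n. replicate n True @ [False]) s)
     in if k < length w then w ! k else True)"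

definition cantor_dist :: "(nat \<Rightarrow> bool) \<Rightarrow> (nat \<Rightarrow> bool) \<Rightarrow> real" where
  "cantor_dist x y = (if x = y then 0 else (1/2) ^ (LEAST k. x k \<noteq> y k))"

definition tree_dist :: "node \<Rightarrow> node \<Rightarrow> real" where
  "tree_dist s t = cantor_dist (cantor_code s) (cantor_code t)"

definition Sigma_dist :: "node \<times> nat \<Rightarrow> node \<times> nat \<Rightarrow> real" where
  "Sigma_dist = (\<lambda>(s, i) (t, j). if i = j then tree_dist s t else 1)"

definition unif_weak_star_continuous_on ::
  "'x set \<Rightarrow> ('x \<Rightarrow> 'x \<Rightarrow> real) \<Rightarrow> ('x \<Rightarrow> ('e::real_normed_vector \<Rightarrow>\<^sub>L real)) \<Rightarrow> bool" where
  "unif_weak_star_continuous_on X d \<rho> \<longleftrightarrow>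
     (\<forall>e x y. (\<forall>n. x n \<in> X) \<and> (\<forall>n. y n \<in> X) \<and> (\<lambda>n. d (x n) (y n)) \<longlonglongrightarrow> 0 \<longrightarrow>
        (\<lambda>n. blinfun_apply (\<rho> (x n) - \<rho> (y n)) e) \<longlonglongrightarrow> 0)"


section \<open>Projectional trees\<close>

text \<open>\<open>projectional_tree \<beta> m \<Lambda> T \<rho>\<close>: the triple \<open>(\<Sigma>\<^sub>m(\<Lambda>), T, \<rho>)\<close> is a projectional tree of
  rank \<open>\<beta>\<close> and order \<open>m\<close>. Only the values of \<open>T\<close> on \<open>\<A>\<^sub>\<Lambda>\<^sup>m\<close> and of \<open>\<rho>\<close> on \<open>\<Sigma>\<^sub>m(\<Lambda>)\<close> matter.
  The last clause is \<open>T\<^sup>*(\<rho>(s,i)) = \<delta>\<^sub>s\<^sub>,\<^sub>i\<close>, evaluated at each \<open>a\<close>.\<close>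

definition projectional_tree ::
  "tree_rank \<Rightarrow> nat \<Rightarrow> node set \<Rightarrow> ((node \<times> nat \<Rightarrow> real) \<Rightarrow> 'e::banach) \<Rightarrow>
    (node \<times> nat \<Rightarrow> ('e \<Rightarrow>\<^sub>L real)) \<Rightarrow> bool" where
  "projectional_tree \<beta> m \<Lambda> T \<rho> \<longleftrightarrow>
     1 \<le> m \<and> tree_of_rank \<beta> \<Lambda> \<and>
     isomorphic_embedding (Aspace_pow m \<Lambda>) (Anorm_pow m \<Lambda>) T \<and>
     unif_weak_star_continuous_on (Sigma_copies m \<Lambda>) Sigma_dist \<rho> \<and>
     bounded (\<rho> ` Sigma_copies m \<Lambda>) \<and>
     (\<forall>x\<in>Sigma_copies m \<Lambda>. \<forall>a\<in>Aspace_pow m \<Lambda>. blinfun_apply (\<rho> x) (T a) = dtilde x a)"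

definition isometric_projectional_tree ::
  "tree_rank \<Rightarrow> nat \<Rightarrow> node set \<Rightarrow> ((node \<times> nat \<Rightarrow> real) \<Rightarrow> 'e::banach) \<Rightarrow>
    (node \<times> nat \<Rightarrow> ('e \<Rightarrow>\<^sub>L real)) \<Rightarrow> bool" where
  "isometric_projectional_tree \<beta> m \<Lambda> T \<rho> \<longleftrightarrow> projectional_tree \<beta> m \<Lambda> T \<rho> \<and>
     isometric_embedding (Aspace_pow m \<Lambda>) (Anorm_pow m \<Lambda>) T"

definition projectional_tree_norm ::
  "nat \<Rightarrow> node set \<Rightarrow> (node \<times> nat \<Rightarrow> ('e::banach \<Rightarrow>\<^sub>L real)) \<Rightarrow> real" where
  "projectional_tree_norm m \<Lambda> \<rho> =
     Inf {C. 0 < C \<and> \<rho> ` Sigma_copies m \<Lambda> \<subseteq> (\<lambda>\<phi>. C *\<^sub>R \<phi>) ` cball 0 1}"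

definition positive_projectional_tree ::
  "('e \<Rightarrow> 'e \<Rightarrow> bool) \<Rightarrow> tree_rank \<Rightarrow> nat \<Rightarrow> node set \<Rightarrow> ((node \<times> nat \<Rightarrow> real) \<Rightarrow> 'e::banach) \<Rightarrow>
    (node \<times> nat \<Rightarrow> ('e \<Rightarrow>\<^sub>L real)) \<Rightarrow> bool" where
  "positive_projectional_tree le \<beta> m \<Lambda> T \<rho> \<longleftrightarrow> projectional_tree \<beta> m \<Lambda> T \<rho> \<and>
     (\<forall>a\<in>Aspace_pow m \<Lambda>. A_le_pow m \<Lambda> (\<lambda>x. 0) a \<longrightarrow> T a \<in> positive_cone le) \<and>
     \<rho> ` Sigma_copies m \<Lambda> \<subseteq> dual_positive_cone le"

end

theory Submission
  imports Defs
begin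

text \<open>
  The norm of a family \<open>a\<close> over a tree \<open>\<Lambda>\<close> is the supremum norm of the function sending a node to
  the branch sum of \<open>a\<close> at that node. The three conditions defining the space of families say
  exactly that this function is uniformly continuous for the metric of the tree, and every
  uniformly continuous function arises in this way, from its increments along the branches
  (\<open>code_uniform_branch_sum\<close>, \<open>increments_in_Aspace\<close>).
  So the \<open>m\<close>-th power of that space is, isometrically and with its order, the space \<open>\<C>(K)\<close>
  where \<open>K\<close> is the completion of \<open>\<Sigma>\<^sub>m(\<Lambda>)\<close>, and the functionals \<open>\<delta>\<^sub>s\<^sub>,\<^sub>i\<close> become point evaluations.
  Uniform weak-star continuity of \<open>\<rho>\<close> says in the same way that \<open>x \<mapsto> \<rho>(x)(e)\<close> extends to an
  element of \<open>\<C>(K)\<close> for every vector \<open>e\<close>.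

  With this dictionary a projectional tree is the same as an embedding \<open>J\<close> of \<open>\<C>(K)\<close> with a
  projection \<open>P\<close> onto its range. Given the tree, \<open>P e\<close> is the image under \<open>T\<close> of the family with branch
  sums \<open>\<rho>(x)(e)\<close> (\<open>projection_from_tree\<close>); its norm is at most that of \<open>T\<close> times the bound on
  \<open>\<rho>\<close>, and it is positive if \<open>T\<close> and \<open>\<rho>\<close> are. Given \<open>J\<close> and \<open>P\<close>, the functional \<open>\<rho>(x)\<close> is
  \<open>\<delta>\<^sub>x \<circ> J\<^sup>-\<^sup>1 \<circ> P\<close> (\<open>tree_from_projection\<close>).

  It remains to identify \<open>K\<close>. The codes of all finite sequences are dense in the Cantor space, which
  settles rank \<open>\<infinity>\<close> (\<open>tree_completion_cantor\<close>). A tree of rank \<open>\<alpha> + 1\<close> is complete: by recursion on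
  the rank, the subtree at a node \<open>s\<close> is laid out on an interval of ordinals of length \<open>\<omega>\<close> to the
  rank of \<open>s\<close>, first the subtrees at the children of \<open>s\<close> in their order, then \<open>s\<close> itself as their
  limit. This maps \<open>\<Sigma>\<^sub>m(\<Lambda>)\<close> onto \<open>[1, \<omega>\<^sup>\<alpha> m]\<close> and turns continuity at a node into continuity at an
  ordinal (\<open>tree_completion_ordinal\<close>). The ordinal arithmetic behind this is that \<open>\<omega>\<close> to the power
  \<open>\<alpha>\<close> is the limit of the partial sums of the powers of \<open>\<omega>\<close> with exponents the ranks of the children
  of the root. Trees of every countable rank exist because a countable limit ordinal is the limit of an
  increasing sequence (\<open>ex_tree_of_rank\<close>).
\<close>

section \<open>The coding of nodes\<close>

lemma cantor_code_Nil [simp]: "cantor_code [] i = True"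
  by (simp add: cantor_code_def)

lemma cantor_code_Cons:
  "cantor_code (n # t) i =
    (if i < n then True else if i = n then False else cantor_code t (i - Suc n))"
proof -
  consider "i < n" | "i = n" | j where "i = n + Suc j"
    by (metis less_imp_add_positive gr0_conv_Suc linorder_neqE_nat)
  then show ?thesis
    by cases (auto simp: cantor_code_def Let_def nth_append)
qed

definition agree :: "nat \<Rightarrow> node \<Rightarrow> node \<Rightarrow> bool" where
  "agree k s t \<longleftrightarrow> (\<forall>i<k. cantor_code s i = cantor_code t i)"

lemma agree_refl [simp]: "agree k s s"
  by (simp add: agree_def)

lemma agree_sym: "agree k s t \<Longrightarrow> agree k t s"
  by (simp add: agree_def)

lemma agree_trans: "agree k s t \<Longrightarrow> agree k t u \<Longrightarrow> agree k s u"
  by (simp add: agree_def)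

lemma agree_mono: "agree k s t \<Longrightarrow> j \<le> k \<Longrightarrow> agree j s t"
  by (auto simp: agree_def)

text \<open>The length of the part of the code of \<open>s\<close> that precedes its constant tail.\<close>

definition code_length :: "node \<Rightarrow> nat" where
  "code_length s = sum_list (map Suc s)"

lemma code_length_Nil [simp]: "code_length [] = 0"
  by (simp add: code_length_def)

lemma code_length_Cons [simp]: "code_length (n # s) = Suc n + code_length s"
  by (simp add: code_length_def)

lemma code_length_append [simp]: "code_length (s @ t) = code_length s + code_length t"
  by (simp add: code_length_def)

lemma length_le_code_length: "length s \<le> code_length s"
  by (induction s) auto

text \<open>The nodes whose code lies in a basic clopen neighbourhood of the code of \<open>s\<close> are \<open>s\<close> and
  all descendants of all but finitely many children of \<open>s\<close>. This is how the tree order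
  determines the topology.\<close>

lemma agree_code_length_iff:
  "agree (code_length s + k) s t \<longleftrightarrow> t = s \<or> (\<exists>n\<ge>k. prefix (s @ [n]) t)"
proof (induction s arbitrary: t)
  case Nil
  show ?case
  proof (cases t)
    case (Cons n t')
    show ?thesis
      unfolding agree_def Cons by (force simp: cantor_code_Cons)
  qed (simp add: agree_def)
next
  case (Cons n s)
  show ?case
  proof (cases t)
    case Nil
    have "n < code_length (n # s) + k" by simp
    then show ?thesis
      unfolding agree_def Nil by (force simp: cantor_code_Cons)
  next
    case t: (Cons j t')
    have "j = n" if "agree (code_length (n # s) + k) (n # s) t"
    proof (rule ccontr)
      assume "j \<noteq> n"
      then have "min j n < code_length (n # s) + k"
        "cantor_code (n # s) (min j n) \<noteq> cantor_code t (min j n)"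
        by (auto simp: t cantor_code_Cons min_def)
      with that show False
        unfolding agree_def by blast
    qed
    moreover have "agree (code_length (n # s) + k) (n # s) (n # t') \<longleftrightarrow>
        agree (code_length s + k) s t'"
    proof
      assume *: "agree (code_length (n # s) + k) (n # s) (n # t')"
      show "agree (code_length s + k) s t'"
        unfolding agree_def
      proof (intro allI impI)
        fix i assume "i < code_length s + k"
        then have "i + Suc n < code_length (n # s) + k" by simp
        with * have "cantor_code (n # s) (i + Suc n) = cantor_code (n # t') (i + Suc n)"
          unfolding agree_def by blast
        then show "cantor_code s i = cantor_code t' i"
          by (simp add: cantor_code_Cons)
      qed
    qed (auto simp: agree_def cantor_code_Cons)
    ultimately show ?thesis
      using Cons.IH[of t'] by (auto simp: t)
  qed
qed

lemma agree_code_length: "agree (code_length s) s t \<longleftrightarrow> prefix s t"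
proof -
  have "t = s \<or> (\<exists>n. prefix (s @ [n]) t)" if "prefix s t"
  proof -
    from that obtain r where "t = s @ r" by (rule prefixE)
    then show ?thesis by (cases r) auto
  qed
  then have "prefix s t \<longleftrightarrow> t = s \<or> (\<exists>n. prefix (s @ [n]) t)"
    by (auto dest: append_prefixD)
  then show ?thesis
    using agree_code_length_iff[of s 0 t] by simp
qed

lemma agree_child: "prefix (s @ [n]) t \<Longrightarrow> agree n s t"
  using agree_code_length_iff[of s n t] by (auto intro: agree_mono)

lemma agree_take: "agree n t (take n t)"
proof (cases "n \<le> length t")
  case True
  then have "n \<le> code_length (take n t)"
    using length_le_code_length[of "take n t"] by simp
  moreover have "agree (code_length (take n t)) (take n t) t"
    by (simp add: agree_code_length take_is_prefix)
  ultimately show ?thesis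
    by (blast intro: agree_mono agree_sym)
qed simp

text \<open>Density of the codes of nodes in the Cantor space: copy \<open>x\<close> up to its last \<open>False\<close> below
  \<open>n\<close>, and continue with the constant tail.\<close>

lemma code_approximation: "\<exists>s. \<forall>i<n. cantor_code s i = x i"
proof (induction n arbitrary: x rule: less_induct)
  case (less n)
  show ?case
  proof (cases "\<forall>i<n. x i")
    case True
    then show ?thesis by (intro exI[of _ "[]"]) simp
  next
    case False
    define j where "j = (LEAST i. \<not> x i)"
    have below: "x i" if "i < j" for i
      using not_less_Least[of i "\<lambda>i. \<not> x i"] that unfolding j_def by blast
    obtain i where i: "i < n" "\<not> x i" using False by blast
    have j: "\<not> x j" "j < n"
      using LeastI[of "\<lambda>i. \<not> x i", OF i(2)] Least_le[of "\<lambda>i. \<not> x i", OF i(2)] i(1)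
      unfolding j_def by auto
    have "n - Suc j < n" using j by simp
    from less[OF this, of "\<lambda>i. x (i + Suc j)"] obtain s
      where s: "\<forall>i<n - Suc j. cantor_code s i = x (i + Suc j)" by blast
    have "cantor_code (j # s) i = x i" if "i < n" for i
    proof -
      consider "i < j" | "i = j" | "j < i" by linarith
      then show ?thesis
      proof cases
        case 3
        then have "i - Suc j < n - Suc j" using \<open>i < n\<close> by simp
        with s 3 show ?thesis by (simp add: cantor_code_Cons)
      qed (use j below in \<open>auto simp: cantor_code_Cons\<close>)
    qed
    then show ?thesis by blast
  qed
qed

lemma agree_if_tree_dist_less:
  assumes "tree_dist s t < (1/2) ^ k"
  shows "agree k s t"
proof (cases "cantor_code s = cantor_code t")
  case False
  with assms have "k < (LEAST i. cantor_code s i \<noteq> cantor_code t i)"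
    by (simp add: tree_dist_def cantor_dist_def power_strict_decreasing_iff)
  then show ?thesis
    unfolding agree_def by (auto dest: not_less_Least[OF less_trans])
qed (simp add: agree_def)

lemma tree_dist_le_if_agree:
  assumes "agree k s t"
  shows "tree_dist s t \<le> (1/2) ^ k"
proof (cases "cantor_code s = cantor_code t")
  case False
  then have "\<exists>i. cantor_code s i \<noteq> cantor_code t i" by auto
  then have "cantor_code s (LEAST i. cantor_code s i \<noteq> cantor_code t i) \<noteq>
      cantor_code t (LEAST i. cantor_code s i \<noteq> cantor_code t i)"
    by (rule LeastI_ex)
  then have "k \<le> (LEAST i. cantor_code s i \<noteq> cantor_code t i)"
    using assms unfolding agree_def by (meson not_less)
  then show ?thesis
    using False by (simp add: tree_dist_def cantor_dist_def power_decreasing)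
qed (simp add: tree_dist_def cantor_dist_def)

lemma tree_dist_nonneg: "0 \<le> tree_dist s t"
  by (simp add: tree_dist_def cantor_dist_def)


section \<open>Uniformly continuous functions on a tree\<close>

text \<open>Uniform continuity with respect to \<^const>\<open>tree_dist\<close>, in terms of codes.\<close>

definition code_uniform :: "node set \<Rightarrow> (node \<Rightarrow> real) \<Rightarrow> bool" where
  "code_uniform \<Lambda> f \<longleftrightarrow>
     (\<forall>e>0. \<exists>k. \<forall>s\<in>\<Lambda>. \<forall>t\<in>\<Lambda>. agree k s t \<longrightarrow> \<bar>f s - f t\<bar> < e)"

lemma code_uniformD:
  assumes "code_uniform \<Lambda> f" "0 < e"
  obtains k where "\<And>s t. s \<in> \<Lambda> \<Longrightarrow> t \<in> \<Lambda> \<Longrightarrow> agree k s t \<Longrightarrow> \<bar>f s - f t\<bar> < e"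
  using assms unfolding code_uniform_def by meson

lemma code_uniform_cong:
  "(\<And>s. s \<in> \<Lambda> \<Longrightarrow> f s = g s) \<Longrightarrow> code_uniform \<Lambda> f \<longleftrightarrow> code_uniform \<Lambda> g"
  unfolding code_uniform_def by simp

text \<open>Only finitely many code prefixes of a given length exist, so a function that varies by less
  than 1 on each of the corresponding pieces is bounded.\<close>

lemma code_uniform_bounded:
  assumes "code_uniform \<Lambda> f"
  obtains B where "\<And>s. s \<in> \<Lambda> \<Longrightarrow> \<bar>f s\<bar> \<le> B"
proof -
  obtain k where k: "\<And>s t. s \<in> \<Lambda> \<Longrightarrow> t \<in> \<Lambda> \<Longrightarrow> agree k s t \<Longrightarrow> \<bar>f s - f t\<bar> < 1"
    using code_uniformD[OF assms zero_less_one] by blast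
  define w where "w s = map (cantor_code s) [0..<k]" for s
  have fin: "finite (w ` \<Lambda>)"
  proof (rule finite_subset)
    show "w ` \<Lambda> \<subseteq> {xs. set xs \<subseteq> UNIV \<and> length xs = k}" by (auto simp: w_def)
    show "finite {xs :: bool list. set xs \<subseteq> UNIV \<and> length xs = k}"
      by (rule finite_lists_length_eq) simp
  qed
  \<comment> \<open>\<open>w s\<close> is the code prefix of \<open>s\<close>, and \<open>rep\<close> chooses a node with a given code prefix\<close>
  define rep where "rep = inv_into \<Lambda> w"
  have "\<bar>f s\<bar> \<le> (\<Sum>v\<in>w ` \<Lambda>. \<bar>f (rep v)\<bar>) + 1" if "s \<in> \<Lambda>" for s
  proof -
    have rep: "rep (w s) \<in> \<Lambda>" "w (rep (w s)) = w s"
      using that unfolding rep_def by (auto intro: inv_into_into f_inv_into_f)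
    then have "agree k s (rep (w s))"
      unfolding agree_def w_def by simp
    then have "\<bar>f s\<bar> \<le> \<bar>f (rep (w s))\<bar> + 1"
      using k[OF that rep(1)] by linarith
    also have "\<bar>f (rep (w s))\<bar> \<le> (\<Sum>v\<in>w ` \<Lambda>. \<bar>f (rep v)\<bar>)"
      using fin that by (intro member_le_sum[of "w s" _ "\<lambda>v. \<bar>f (rep v)\<bar>"]) auto
    finally show ?thesis by simp
  qed
  then show thesis by (rule that)
qed

text \<open>The tree form of the fact that a continuous function on a compact space is uniformly
  continuous: continuity is required at every node and at every infinite branch. If uniform
  continuity up to \<open>e\<close> fails below a node, then it fails below one of its children, for all but
  finitely many children are controlled by continuity at the node; hence it fails along an
  infinite branch, where continuity forbids it.\<close>

lemma code_uniform_if_local: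
  assumes her: "hereditary \<Lambda>"
    and node: "\<And>s e. s \<in> \<Lambda> \<Longrightarrow> 0 < e \<Longrightarrow>
      \<exists>n. \<forall>k\<ge>n. \<forall>t\<in>\<Lambda>. prefix (s @ [k]) t \<longrightarrow> \<bar>f t - f s\<bar> < e"
    and branch: "\<And>b e. b 0 = [] \<Longrightarrow> (\<And>n. \<exists>j. b (Suc n) = b n @ [j]) \<Longrightarrow> 0 < e \<Longrightarrow>
      \<exists>n c. \<forall>t\<in>\<Lambda>. prefix (b n) t \<longrightarrow> \<bar>f t - c\<bar> < e"
  shows "code_uniform \<Lambda> f"
  unfolding code_uniform_def
proof (intro allI impI, rule ccontr)
  fix e :: real
  assume e: "0 < e" and no: "\<nexists>k. \<forall>s\<in>\<Lambda>. \<forall>t\<in>\<Lambda>. agree k s t \<longrightarrow> \<bar>f s - f t\<bar> < e"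
  define good where "good u \<longleftrightarrow> (\<exists>k. \<forall>s\<in>\<Lambda>. \<forall>t\<in>\<Lambda>. prefix u s \<longrightarrow> prefix u t \<longrightarrow>
    agree k s t \<longrightarrow> \<bar>f s - f t\<bar> < e)" for u
  have step: "good u" if all: "\<And>n. good (u @ [n])" for u
  proof (cases "u \<in> \<Lambda>")
    case False
    then show ?thesis
      using her unfolding good_def hereditary_def by blast
  next
    case True
    have "0 < e / 2" using e by simp
    from node[OF True this] obtain N where
      N: "\<And>k t. k \<ge> N \<Longrightarrow> t \<in> \<Lambda> \<Longrightarrow> prefix (u @ [k]) t \<Longrightarrow> \<bar>f t - f u\<bar> < e / 2"
      by blast
    obtain K where K: "\<And>n s t. s \<in> \<Lambda> \<Longrightarrow> t \<in> \<Lambda> \<Longrightarrow> prefix (u @ [n]) s \<Longrightarrow>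
        prefix (u @ [n]) t \<Longrightarrow> agree (K n) s t \<Longrightarrow> \<bar>f s - f t\<bar> < e"
      using all unfolding good_def by metis
    \<comment> \<open>large enough to determine the child of \<open>u\<close> below which a node lies if that child is one of the
      first \<open>N\<close>, and then to apply the bound known for that child\<close>
    define M where "M = code_length u + Suc N + (\<Sum>n<N. K n)"
    have "\<bar>f s - f t\<bar> < e"
      if st: "s \<in> \<Lambda>" "t \<in> \<Lambda>" "prefix u s" "prefix u t" "agree M s t" for s t
    proof (cases "agree (code_length u + N) u s")
      case near: True
      have "agree (code_length u + N) s t"
        using st(5) by (rule agree_mono) (simp add: M_def)
      with near have "agree (code_length u + N) u t" by (rule agree_trans)
      with near N st e have "\<bar>f s - f u\<bar> < e / 2" "\<bar>f t - f u\<bar> < e / 2"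
        unfolding agree_code_length_iff by auto
      then show ?thesis by linarith
    next
      case far: False
      have "agree (code_length u + 0) u s"
        using st by (simp add: agree_code_length)
      then obtain n where n: "prefix (u @ [n]) s" "n < N"
        using far unfolding agree_code_length_iff by (metis not_less zero_le)
      have "agree (code_length (u @ [n])) (u @ [n]) s"
        using n by (simp only: agree_code_length)
      moreover have "agree (code_length (u @ [n])) s t"
        using st(5) by (rule agree_mono) (use n in \<open>simp add: M_def\<close>)
      ultimately have "prefix (u @ [n]) t"
        unfolding agree_code_length[symmetric] by (rule agree_trans)
      moreover have "K n \<le> (\<Sum>n<N. K n)"
        using n by (intro member_le_sum) auto
      then have "agree (K n) s t"
        using st(5) by (auto intro: agree_mono simp: M_def)
      ultimately show ?thesis
        using K n st by blast
    qed
    then show ?thesis unfolding good_def by blast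
  qed
  have "\<not> good []" using no unfolding good_def by simp
  then have "\<exists>b. \<forall>n. (\<not> good (b n) \<and> (n = 0 \<longrightarrow> b n = [])) \<and> (\<exists>j. b (Suc n) = b n @ [j])"
    by (intro dependent_nat_choice) (use step in blast)+
  then obtain b where b: "b 0 = []" "\<And>n. \<not> good (b n)" "\<And>n. \<exists>j. b (Suc n) = b n @ [j]"
    by blast
  have "0 < e / 2" using e by simp
  from branch[OF b(1) b(3) this] obtain n c where
    n: "\<forall>t\<in>\<Lambda>. prefix (b n) t \<longrightarrow> \<bar>f t - c\<bar> < e / 2" by blast
  have "\<bar>f s - f t\<bar> < e" if "s \<in> \<Lambda>" "t \<in> \<Lambda>" "prefix (b n) s" "prefix (b n) t" for s t
  proof -
    have "\<bar>f s - c\<bar> < e / 2" "\<bar>f t - c\<bar> < e / 2" using n that by auto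
    then show ?thesis by linarith
  qed
  then have "good (b n)" unfolding good_def by blast
  with b show False by blast
qed

lemma branch_facts:
  fixes b :: "nat \<Rightarrow> node"
  assumes "b 0 = []" "\<And>n. \<exists>j. b (Suc n) = b n @ [j]"
  shows "length (b n) = n" "m \<le> n \<Longrightarrow> prefix (b m) (b n)"
proof -
  show "length (b n) = n"
    by (induction n) (use assms in \<open>auto, metis length_append_singleton\<close>)
  show "m \<le> n \<Longrightarrow> prefix (b m) (b n)"
  proof (induction n)
    case (Suc n)
    then show ?case
      using assms(2)[of n] by (metis le_Suc_eq prefix_order.refl prefix_prefix)
  qed simp
qed

lemma code_uniform_node:
  assumes "code_uniform \<Lambda> f" "s \<in> \<Lambda>" "0 < e"
  shows "\<exists>n. \<forall>k\<ge>n. \<forall>t\<in>\<Lambda>. prefix (s @ [k]) t \<longrightarrow> \<bar>f t - f s\<bar> < e"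
proof -
  obtain n where n: "\<And>s t. s \<in> \<Lambda> \<Longrightarrow> t \<in> \<Lambda> \<Longrightarrow> agree n s t \<Longrightarrow> \<bar>f s - f t\<bar> < e"
    using code_uniformD[OF assms(1,3)] by blast
  then show ?thesis
    using assms(2) by (meson agree_child agree_mono agree_sym)
qed


section \<open>The spaces of families as spaces of uniformly continuous functions\<close>

lemma finite_prefixes [simp]: "finite {s. prefix s t}"
  by (rule finite_subset[of _ "set (prefixes t)"]) auto

lemma branch_sum_Nil: "branch_sum a [] = a []"
  by (simp add: branch_sum_def)

lemma branch_sum_snoc: "branch_sum a (t @ [n]) = branch_sum a t + a (t @ [n])"
proof -
  have "{s. prefix s (t @ [n])} = insert (t @ [n]) {s. prefix s t}"
    by auto
  then show ?thesis
    by (simp add: branch_sum_def)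
qed

lemma branch_sum_restrict_child:
  assumes "hereditary \<Lambda>" "t \<in> \<Lambda>"
  shows "branch_sum (restrict0 a {u \<in> \<Lambda>. prefix (s @ [n]) u}) t =
    (if prefix (s @ [n]) t then branch_sum a t - branch_sum a s else 0)"
  using assms(2)
proof (induction t rule: rev_induct)
  case Nil
  then show ?case by (simp add: branch_sum_Nil restrict0_def)
next
  case (snoc x t)
  have "t \<in> \<Lambda>" using snoc.prems assms(1) unfolding hereditary_def by (metis prefixI)
  with snoc show ?case
    by (auto simp: branch_sum_snoc restrict0_def)
qed

lemma branch_sum_restrict_length:
  assumes "hereditary \<Lambda>" "t \<in> \<Lambda>"
  shows "branch_sum (restrict0 a {u \<in> \<Lambda>. Suc n \<le> length u}) t =
    branch_sum a t - branch_sum a (take n t)"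
  using assms(2)
proof (induction t rule: rev_induct)
  case Nil
  then show ?case by (simp add: branch_sum_Nil restrict0_def)
next
  case (snoc x t)
  have "t \<in> \<Lambda>" using snoc.prems assms(1) unfolding hereditary_def by (metis prefixI)
  with snoc show ?case
    by (cases "n \<le> length t") (auto simp: branch_sum_snoc restrict0_def)
qed

lemma tree_norm_le: "\<Lambda> \<noteq> {} \<Longrightarrow> (\<And>t. t \<in> \<Lambda> \<Longrightarrow> \<bar>branch_sum a t\<bar> \<le> C) \<Longrightarrow> tree_norm \<Lambda> a \<le> C"
  unfolding tree_norm_def by (rule cSUP_least)

text \<open>The supremum of an unbounded set of reals is an arbitrary number, hence the bound \<open>B\<close>.\<close>

lemma le_tree_norm:
  assumes "t \<in> \<Lambda>" "\<And>t. t \<in> \<Lambda> \<Longrightarrow> \<bar>branch_sum a t\<bar> \<le> B"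
  shows "\<bar>branch_sum a t\<bar> \<le> tree_norm \<Lambda> a"
  unfolding tree_norm_def using assms by (auto intro!: cSUP_upper bdd_aboveI)

lemma tree_norm_nonneg:
  assumes "[] \<in> \<Lambda>" "\<And>t. t \<in> \<Lambda> \<Longrightarrow> \<bar>branch_sum a t\<bar> \<le> B"
  shows "0 \<le> tree_norm \<Lambda> a"
  using le_tree_norm[OF assms] by linarith

text \<open>The branch sums of the restriction of \<open>a\<close> to the subtree at \<open>s * n\<close> are, within that subtree, the
  differences of the branch sums of \<open>a\<close> from the one at \<open>s\<close>; so the second condition on \<open>a\<close> is
  continuity of the branch sums at \<open>s\<close>. Likewise the third condition controls the differences from the
  branch sum at the initial segment of length \<open>n\<close>, which is continuity along infinite branches.\<close>

lemma code_uniform_branch_sum: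
  assumes her: "hereditary \<Lambda>" and a: "a \<in> Aspace \<Lambda>"
  shows "code_uniform \<Lambda> (branch_sum a)"
proof (rule code_uniform_if_local[OF her])
  obtain B where B: "\<And>t. t \<in> \<Lambda> \<Longrightarrow> \<bar>branch_sum a t\<bar> \<le> B"
    using a unfolding Aspace_def bdd_above_def by auto
  fix s and e :: real
  assume s: "s \<in> \<Lambda>" and e: "0 < e"
  show "\<exists>n. \<forall>k\<ge>n. \<forall>t\<in>\<Lambda>. prefix (s @ [k]) t \<longrightarrow> \<bar>branch_sum a t - branch_sum a s\<bar> < e"
  proof (cases "leaf \<Lambda> s")
    case True
    then have "\<not> prefix (s @ [k]) t" if "t \<in> \<Lambda>" for k t
      using that unfolding leaf_def by (auto simp: strict_prefix_def dest: append_prefixD)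
    then show ?thesis by blast
  next
    case False
    then have "(\<lambda>n. tree_norm \<Lambda> (restrict0 a {t \<in> \<Lambda>. prefix (s @ [n]) t})) \<longlonglongrightarrow> 0"
      using a s unfolding Aspace_def nonleaves_def by blast
    from order_tendstoD(2)[OF this e] obtain N where
      N: "\<And>n. n \<ge> N \<Longrightarrow> tree_norm \<Lambda> (restrict0 a {t \<in> \<Lambda>. prefix (s @ [n]) t}) < e"
      unfolding eventually_sequentially by blast
    have "\<bar>branch_sum a t - branch_sum a s\<bar> < e"
      if "k \<ge> N" "t \<in> \<Lambda>" "prefix (s @ [k]) t" for k t
    proof -
      have "\<bar>branch_sum (restrict0 a {t \<in> \<Lambda>. prefix (s @ [k]) t}) u\<bar> \<le> 2 * B"
        if "u \<in> \<Lambda>" for u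
      proof -
        have "0 \<le> B" using B[OF s] by linarith
        then show ?thesis
          using B[OF that] B[OF s] unfolding branch_sum_restrict_child[OF her that] by auto
      qed
      from le_tree_norm[OF \<open>t \<in> \<Lambda>\<close> this] N[OF \<open>k \<ge> N\<close>] show ?thesis
        using that unfolding branch_sum_restrict_child[OF her \<open>t \<in> \<Lambda>\<close>] by simp
    qed
    then show ?thesis by blast
  qed
next
  obtain B where B: "\<And>t. t \<in> \<Lambda> \<Longrightarrow> \<bar>branch_sum a t\<bar> \<le> B"
    using a unfolding Aspace_def bdd_above_def by auto
  fix b :: "nat \<Rightarrow> node" and e :: real
  assume b: "b 0 = []" "\<And>n. \<exists>j. b (Suc n) = b n @ [j]" and e: "0 < e"
  have "(\<lambda>n. tree_norm \<Lambda> (restrict0 a {t \<in> \<Lambda>. n \<le> length t})) \<longlonglongrightarrow> 0"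
    using a unfolding Aspace_def by blast
  from order_tendstoD(2)[OF LIMSEQ_Suc[OF this] e] obtain n where
    n: "tree_norm \<Lambda> (restrict0 a {t \<in> \<Lambda>. Suc n \<le> length t}) < e"
    unfolding eventually_sequentially by blast
  have "\<bar>branch_sum a t - branch_sum a (b n)\<bar> < e" if "t \<in> \<Lambda>" "prefix (b n) t" for t
  proof -
    have take: "take n u \<in> \<Lambda>" if "u \<in> \<Lambda>" for u
      using her that unfolding hereditary_def by (metis take_is_prefix)
    have "\<bar>branch_sum (restrict0 a {t \<in> \<Lambda>. Suc n \<le> length t}) u\<bar> \<le> 2 * B"
      if "u \<in> \<Lambda>" for u
      using B[OF that] B[OF take[OF that]]
      unfolding branch_sum_restrict_length[OF her that] by linarith
    from le_tree_norm[OF \<open>t \<in> \<Lambda>\<close> this] n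
    have "\<bar>branch_sum a t - branch_sum a (take n t)\<bar> < e"
      unfolding branch_sum_restrict_length[OF her \<open>t \<in> \<Lambda>\<close>] by simp
    moreover have "take n t = b n"
      using that(2) branch_facts(1)[OF b, of n] by (auto simp: prefix_def)
    ultimately show ?thesis by simp
  qed
  then show "\<exists>n c. \<forall>t\<in>\<Lambda>. prefix (b n) t \<longrightarrow> \<bar>branch_sum a t - c\<bar> < e"
    by blast
qed

definition increments :: "node set \<Rightarrow> (node \<Rightarrow> real) \<Rightarrow> node \<Rightarrow> real" where
  "increments \<Lambda> f = (\<lambda>s. if s \<in> \<Lambda> then f s - (if s = [] then 0 else f (butlast s)) else 0)"

lemma branch_sum_increments:
  assumes "hereditary \<Lambda>" "t \<in> \<Lambda>"
  shows "branch_sum (increments \<Lambda> f) t = f t"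
  using assms(2)
proof (induction t rule: rev_induct)
  case Nil
  then show ?case by (simp add: branch_sum_Nil increments_def)
next
  case (snoc x t)
  have "t \<in> \<Lambda>" using snoc.prems assms(1) unfolding hereditary_def by (metis prefixI)
  with snoc show ?case
    by (simp add: branch_sum_snoc increments_def)
qed

lemma increments_branch_sum:
  assumes "a \<in> Aspace \<Lambda>"
  shows "increments \<Lambda> (branch_sum a) = a"
proof
  fix s
  show "increments \<Lambda> (branch_sum a) s = a s"
    using assms by (cases s rule: rev_cases)
      (auto simp: increments_def branch_sum_Nil branch_sum_snoc Aspace_def)
qed

text \<open>The converse: a node and the descendants of its late children have close codes, and so do a long
  node and its long initial segments.\<close>

lemma increments_in_Aspace:
  assumes her: "hereditary \<Lambda>" and Nil: "[] \<in> \<Lambda>" and f: "code_uniform \<Lambda> f"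
  shows "increments \<Lambda> f \<in> Aspace \<Lambda>"
proof -
  let ?a = "increments \<Lambda> f"
  have bs: "branch_sum ?a t = f t" if "t \<in> \<Lambda>" for t
    using branch_sum_increments[OF her that] .
  obtain B where B: "\<And>s. s \<in> \<Lambda> \<Longrightarrow> \<bar>f s\<bar> \<le> B"
    using code_uniform_bounded[OF f] by blast
  have small: "(\<lambda>n. tree_norm \<Lambda> (c n)) \<longlonglongrightarrow> 0"
    if ev: "\<And>e. 0 < e \<Longrightarrow> \<exists>N. \<forall>n\<ge>N. \<forall>t\<in>\<Lambda>. \<bar>branch_sum (c n) t\<bar> \<le> e" for c :: "nat \<Rightarrow> node \<Rightarrow> real"
  proof (rule LIMSEQ_I)
    fix r :: real assume "0 < r"
    then have "0 < r / 2" by simp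
    from ev[OF this] obtain N where N: "\<And>n t. n \<ge> N \<Longrightarrow> t \<in> \<Lambda> \<Longrightarrow> \<bar>branch_sum (c n) t\<bar> \<le> r / 2"
      by blast
    have "norm (tree_norm \<Lambda> (c n) - 0) < r" if "n \<ge> N" for n
    proof -
      have "0 \<le> tree_norm \<Lambda> (c n)" "tree_norm \<Lambda> (c n) \<le> r / 2"
        using tree_norm_nonneg[OF Nil N[OF that]] tree_norm_le[OF _ N[OF that]] Nil by auto
      with \<open>0 < r\<close> show ?thesis by simp
    qed
    then show "\<exists>N. \<forall>n\<ge>N. norm (tree_norm \<Lambda> (c n) - 0) < r" by blast
  qed
  have "(\<lambda>n. tree_norm \<Lambda> (restrict0 ?a {t \<in> \<Lambda>. prefix (s @ [n]) t})) \<longlonglongrightarrow> 0"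
    if "s \<in> nonleaves \<Lambda>" for s
  proof (rule small)
    have s: "s \<in> \<Lambda>" using that by (simp add: nonleaves_def)
    fix e :: real assume e: "0 < e"
    from code_uniform_node[OF f s e] obtain N where
      "\<And>k t. k \<ge> N \<Longrightarrow> t \<in> \<Lambda> \<Longrightarrow> prefix (s @ [k]) t \<Longrightarrow> \<bar>f t - f s\<bar> < e" by blast
    then have "\<bar>branch_sum (restrict0 ?a {t \<in> \<Lambda>. prefix (s @ [n]) t}) t\<bar> \<le> e"
      if "n \<ge> N" "t \<in> \<Lambda>" for n t
      using that e s unfolding branch_sum_restrict_child[OF her that(2)] by (auto simp: bs less_imp_le)
    then show "\<exists>N. \<forall>n\<ge>N. \<forall>t\<in>\<Lambda>. \<bar>branch_sum (restrict0 ?a {t \<in> \<Lambda>. prefix (s @ [n]) t}) t\<bar> \<le> e"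
      by blast
  qed
  moreover have "(\<lambda>n. tree_norm \<Lambda> (restrict0 ?a {t \<in> \<Lambda>. Suc n \<le> length t})) \<longlonglongrightarrow> 0"
  proof (rule small)
    fix e :: real assume e: "0 < e"
    obtain k where k: "\<And>s t. s \<in> \<Lambda> \<Longrightarrow> t \<in> \<Lambda> \<Longrightarrow> agree k s t \<Longrightarrow> \<bar>f s - f t\<bar> < e"
      using code_uniformD[OF f e] by blast
    have "\<bar>branch_sum (restrict0 ?a {t \<in> \<Lambda>. Suc n \<le> length t}) t\<bar> \<le> e"
      if "n \<ge> k" "t \<in> \<Lambda>" for n t
    proof -
      have "take n t \<in> \<Lambda>"
        using her that(2) unfolding hereditary_def by (metis take_is_prefix)
      moreover have "agree k t (take n t)"
        using agree_take that(1) by (rule agree_mono)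
      ultimately show ?thesis
        using k[of t "take n t"] that(2)
        unfolding branch_sum_restrict_length[OF her that(2)] by (simp add: bs less_imp_le)
    qed
    then show "\<exists>N. \<forall>n\<ge>N. \<forall>t\<in>\<Lambda>. \<bar>branch_sum (restrict0 ?a {t \<in> \<Lambda>. Suc n \<le> length t}) t\<bar> \<le> e"
      by blast
  qed
  then have "(\<lambda>n. tree_norm \<Lambda> (restrict0 ?a {t \<in> \<Lambda>. n \<le> length t})) \<longlonglongrightarrow> 0"
    by (rule LIMSEQ_imp_Suc)
  moreover have "bdd_above ((\<lambda>t. \<bar>branch_sum ?a t\<bar>) ` \<Lambda>)"
    using B by (intro bdd_aboveI[of _ B]) (auto simp: bs)
  ultimately show ?thesis
    by (simp add: Aspace_def increments_def)
qed


section \<open>Powers of the spaces of families\<close>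

definition copies_uniform :: "nat \<Rightarrow> node set \<Rightarrow> (node \<times> nat \<Rightarrow> real) \<Rightarrow> bool" where
  "copies_uniform m \<Lambda> g \<longleftrightarrow> (\<forall>i\<in>{1..m}. code_uniform \<Lambda> (\<lambda>s. g (s, i)))"

definition family_of :: "nat \<Rightarrow> node set \<Rightarrow> (node \<times> nat \<Rightarrow> real) \<Rightarrow> node \<times> nat \<Rightarrow> real" where
  "family_of m \<Lambda> g = (\<lambda>(s, i). if i \<in> {1..m} then increments \<Lambda> (\<lambda>s. g (s, i)) s else 0)"

lemma dtilde_pair: "dtilde (s, i) a = branch_sum (\<lambda>s. a (s, i)) s"
  by (simp add: dtilde_def branch_sum_def)

lemma dtilde_add: "dtilde x (\<lambda>y. a y + b y) = dtilde x a + dtilde x b"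
  by (cases x) (simp add: dtilde_def sum.distrib)

lemma dtilde_scale: "dtilde x (\<lambda>y. c * a y) = c * dtilde x a"
  by (cases x) (simp add: dtilde_def sum_distrib_left)

lemma family_of_add:
  "family_of m \<Lambda> (\<lambda>x. g x + h x) = (\<lambda>x. family_of m \<Lambda> g x + family_of m \<Lambda> h x)"
  by (auto simp: family_of_def increments_def)

lemma family_of_scale: "family_of m \<Lambda> (\<lambda>x. c * g x) = (\<lambda>x. c * family_of m \<Lambda> g x)"
  by (auto simp: family_of_def increments_def algebra_simps)

lemma butlast_in_hereditary: "hereditary \<Lambda> \<Longrightarrow> s \<in> \<Lambda> \<Longrightarrow> butlast s \<in> \<Lambda>"
  unfolding hereditary_def by (metis butlast_conv_take take_is_prefix)

lemma family_of_cong: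
  assumes "hereditary \<Lambda>" "\<And>x. x \<in> Sigma_copies m \<Lambda> \<Longrightarrow> g x = h x"
  shows "family_of m \<Lambda> g = family_of m \<Lambda> h"
  using assms(2) butlast_in_hereditary[OF assms(1)]
  by (auto simp: family_of_def increments_def Sigma_copies_def fun_eq_iff)

lemma copies_uniform_cong:
  "(\<And>x. x \<in> Sigma_copies m \<Lambda> \<Longrightarrow> g x = h x) \<Longrightarrow> copies_uniform m \<Lambda> g \<longleftrightarrow> copies_uniform m \<Lambda> h"
  unfolding copies_uniform_def
  by (intro ball_cong refl code_uniform_cong) (simp add: Sigma_copies_def)

lemma copies_uniform_dtilde:
  assumes "hereditary \<Lambda>" "a \<in> Aspace_pow m \<Lambda>"
  shows "copies_uniform m \<Lambda> (\<lambda>x. dtilde x a)"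
  unfolding copies_uniform_def dtilde_pair
proof
  fix i assume "i \<in> {1..m}"
  then have "(\<lambda>s. a (s, i)) \<in> Aspace \<Lambda>"
    using assms(2) unfolding Aspace_pow_def by blast
  then show "code_uniform \<Lambda> (branch_sum (\<lambda>s. a (s, i)))"
    by (rule code_uniform_branch_sum[OF assms(1)])
qed

lemma family_of_in_Aspace_pow:
  assumes "hereditary \<Lambda>" "[] \<in> \<Lambda>" "copies_uniform m \<Lambda> g"
  shows "family_of m \<Lambda> g \<in> Aspace_pow m \<Lambda>"
proof -
  have "increments \<Lambda> (\<lambda>s. g (s, i)) \<in> Aspace \<Lambda>" if "i \<in> {1..m}" for i
    using assms that unfolding copies_uniform_def by (blast intro: increments_in_Aspace)
  then show ?thesis
    unfolding Aspace_pow_def family_of_def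
    by (auto simp: Sigma_copies_def increments_def)
qed

lemma dtilde_family_of:
  assumes "hereditary \<Lambda>" "x \<in> Sigma_copies m \<Lambda>"
  shows "dtilde x (family_of m \<Lambda> g) = g x"
  using assms by (auto simp: Sigma_copies_def family_of_def dtilde_pair branch_sum_increments)

lemma family_of_dtilde:
  assumes "a \<in> Aspace_pow m \<Lambda>"
  shows "family_of m \<Lambda> (\<lambda>x. dtilde x a) = a"
proof
  fix x :: "node \<times> nat"
  obtain s i where x: "x = (s, i)" by fastforce
  show "family_of m \<Lambda> (\<lambda>x. dtilde x a) x = a x"
  proof (cases "i \<in> {1..m}")
    case True
    then have "(\<lambda>s. a (s, i)) \<in> Aspace \<Lambda>"
      using assms unfolding Aspace_pow_def by blast
    from increments_branch_sum[OF this] True show ?thesis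
      by (simp add: x family_of_def dtilde_pair fun_eq_iff)
  next
    case False
    then show ?thesis
      using assms by (auto simp: x family_of_def Aspace_pow_def Sigma_copies_def)
  qed
qed

lemma Anorm_pow_le_iff:
  assumes "1 \<le> m" "[] \<in> \<Lambda>" "a \<in> Aspace_pow m \<Lambda>"
  shows "Anorm_pow m \<Lambda> a \<le> C \<longleftrightarrow> (\<forall>x\<in>Sigma_copies m \<Lambda>. \<bar>dtilde x a\<bar> \<le> C)"
proof -
  have "tree_norm \<Lambda> (\<lambda>s. a (s, i)) \<le> C \<longleftrightarrow> (\<forall>t\<in>\<Lambda>. \<bar>branch_sum (\<lambda>s. a (s, i)) t\<bar> \<le> C)"
    if "i \<in> {1..m}" for i
  proof -
    have "bdd_above ((\<lambda>t. \<bar>branch_sum (\<lambda>s. a (s, i)) t\<bar>) ` \<Lambda>)"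
      using assms(3) that by (auto simp: Aspace_pow_def Aspace_def)
    then show ?thesis
      unfolding tree_norm_def using assms(2) by (intro cSUP_le_iff) auto
  qed
  then show ?thesis
    unfolding Anorm_pow_def using assms(1)
    by (subst Max_le_iff) (auto simp: Sigma_copies_def dtilde_pair)
qed

lemma A_le_pow_zero_iff:
  "A_le_pow m \<Lambda> (\<lambda>x. 0) a \<longleftrightarrow> (\<forall>x\<in>Sigma_copies m \<Lambda>. 0 \<le> dtilde x a)"
  by (auto simp: A_le_pow_def A_le_def Sigma_copies_def dtilde_pair branch_sum_def)

lemma copies_uniform_if_weak_star:
  assumes "unif_weak_star_continuous_on (Sigma_copies m \<Lambda>) Sigma_dist \<rho>"
  shows "copies_uniform m \<Lambda> (\<lambda>x. blinfun_apply (\<rho> x) e)"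
  unfolding copies_uniform_def code_uniform_def
proof (intro ballI allI impI, rule ccontr)
  fix i and r :: real
  assume i: "i \<in> {1..m}" and r: "0 < r"
    and no: "\<nexists>k. \<forall>s\<in>\<Lambda>. \<forall>t\<in>\<Lambda>. agree k s t \<longrightarrow>
      \<bar>blinfun_apply (\<rho> (s, i)) e - blinfun_apply (\<rho> (t, i)) e\<bar> < r"
  then have "\<forall>k. \<exists>s t. s \<in> \<Lambda> \<and> t \<in> \<Lambda> \<and> agree k s t \<and>
      r \<le> \<bar>blinfun_apply (\<rho> (s, i)) e - blinfun_apply (\<rho> (t, i)) e\<bar>"
    by (meson not_less)
  then obtain s t where st: "\<And>k. s k \<in> \<Lambda>" "\<And>k. t k \<in> \<Lambda>" "\<And>k. agree k (s k) (t k)"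
      "\<And>k. r \<le> \<bar>blinfun_apply (\<rho> (s k, i)) e - blinfun_apply (\<rho> (t k, i)) e\<bar>"
    by metis
  have "(\<lambda>k. Sigma_dist (s k, i) (t k, i)) \<longlonglongrightarrow> 0"
  proof (rule tendsto_sandwich[OF _ _ tendsto_const])
    show "(\<lambda>k. (1 / 2 :: real) ^ k) \<longlonglongrightarrow> 0"
      by (rule LIMSEQ_realpow_zero) auto
  qed (use st in \<open>simp_all add: Sigma_dist_def tree_dist_nonneg tree_dist_le_if_agree\<close>)
  moreover have "\<forall>k. (s k, i) \<in> Sigma_copies m \<Lambda>" "\<forall>k. (t k, i) \<in> Sigma_copies m \<Lambda>"
    using st i by (auto simp: Sigma_copies_def)
  ultimately have "(\<lambda>k. blinfun_apply (\<rho> (s k, i) - \<rho> (t k, i)) e) \<longlonglongrightarrow> 0"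
    using assms[unfolded unif_weak_star_continuous_on_def, rule_format,
        of "\<lambda>k. (s k, i)" "\<lambda>k. (t k, i)" e] by blast
  then obtain k where "\<bar>blinfun_apply (\<rho> (s k, i) - \<rho> (t k, i)) e\<bar> < r"
    using r unfolding LIMSEQ_def by (metis dist_0_norm dist_commute order.refl real_norm_def)
  then show False
    using st(4)[of k] by (simp add: blinfun.diff_left)
qed

lemma weak_star_if_copies_uniform:
  assumes "\<And>e. copies_uniform m \<Lambda> (\<lambda>x. blinfun_apply (\<rho> x) e)"
  shows "unif_weak_star_continuous_on (Sigma_copies m \<Lambda>) Sigma_dist \<rho>"
  unfolding unif_weak_star_continuous_on_def
proof (intro allI impI, elim conjE)
  fix e and x y :: "nat \<Rightarrow> node \<times> nat"
  assume x: "\<forall>n. x n \<in> Sigma_copies m \<Lambda>" and y: "\<forall>n. y n \<in> Sigma_copies m \<Lambda>"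
    and lim: "(\<lambda>n. Sigma_dist (x n) (y n)) \<longlonglongrightarrow> 0"
  show "(\<lambda>n. blinfun_apply (\<rho> (x n) - \<rho> (y n)) e) \<longlonglongrightarrow> 0"
  proof (rule LIMSEQ_I)
    fix r :: real assume r: "0 < r"
    have "\<forall>i\<in>{1..m}. \<exists>k. \<forall>s\<in>\<Lambda>. \<forall>t\<in>\<Lambda>. agree k s t \<longrightarrow>
        \<bar>blinfun_apply (\<rho> (s, i)) e - blinfun_apply (\<rho> (t, i)) e\<bar> < r"
      using assms[of e] r unfolding copies_uniform_def code_uniform_def by blast
    then obtain K where K: "\<And>i s t. i \<in> {1..m} \<Longrightarrow> s \<in> \<Lambda> \<Longrightarrow> t \<in> \<Lambda> \<Longrightarrow> agree (K i) s t \<Longrightarrow>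
        \<bar>blinfun_apply (\<rho> (s, i)) e - blinfun_apply (\<rho> (t, i)) e\<bar> < r"
      by metis
    define M where "M = (\<Sum>i=1..m. K i)"
    \<comment> \<open>points in different copies have distance 1, so the next bound also forces equal copies\<close>
    obtain N where N: "\<And>n. n \<ge> N \<Longrightarrow> Sigma_dist (x n) (y n) < (1/2) ^ M"
      using order_tendstoD(2)[OF lim, of "(1/2) ^ M"] unfolding eventually_sequentially by auto
    have "norm (blinfun_apply (\<rho> (x n) - \<rho> (y n)) e - 0) < r" if "n \<ge> N" for n
    proof -
      obtain s i t j where eq: "x n = (s, i)" "y n = (t, j)" by fastforce
      have "(1/2 :: real) ^ M \<le> 1" by (rule power_le_one) auto
      with N[OF that] have "i = j" "tree_dist s t < (1/2) ^ M"
        by (auto simp: eq Sigma_dist_def split: if_splits)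
      moreover have i: "i \<in> {1..m}" and "s \<in> \<Lambda>" "t \<in> \<Lambda>"
        using x y eq by (auto simp: Sigma_copies_def dest: spec[of _ n])
      moreover have "K i \<le> M"
        unfolding M_def using i by (intro member_le_sum) auto
      ultimately show ?thesis
        using K[of i s t] agree_if_tree_dist_less[of s t M]
        by (auto simp: eq blinfun.diff_left intro: agree_mono)
    qed
    then show "\<exists>N. \<forall>n\<ge>N. norm (blinfun_apply (\<rho> (x n) - \<rho> (y n)) e - 0) < r" by blast
  qed
qed


section \<open>Projections and projectional trees\<close>

lemma cspace_add: "F \<in> cspace K \<Longrightarrow> G \<in> cspace K \<Longrightarrow> (\<lambda>x. F x + G x) \<in> cspace K"
  by (auto simp: cspace_def intro: continuous_on_add)

lemma cspace_scale: "F \<in> cspace K \<Longrightarrow> (\<lambda>x. c * F x) \<in> cspace K"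
  by (auto simp: cspace_def intro: continuous_on_mult_left)

lemma linear_map_onD:
  assumes "linear_map_on V J" "f \<in> V" "g \<in> V"
  shows "J (\<lambda>x. f x + g x) = J f + J g" "J (\<lambda>x. c * f x) = c *\<^sub>R J f"
  using assms unfolding linear_map_on_def by auto

lemma projection_onto_fixed:
  assumes "projection_onto Y P" "y \<in> Y"
  shows "blinfun_apply P y = y"
proof -
  obtain e where "y = blinfun_apply P e"
    using assms unfolding projection_onto_def by blast
  moreover have "blinfun_apply (P o\<^sub>L P) e = blinfun_apply P e"
    using assms unfolding projection_onto_def by simp
  ultimately show ?thesis by simp
qed

lemma complemented_if_projection_onto:
  assumes "projection_onto Y P"
  shows "complemented Y"
proof -
  have Y: "Y = {y. blinfun_apply P y = y}"
    using projection_onto_fixed[OF assms] assms unfolding projection_onto_def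
    by (auto intro: range_eqI sym)
  have "subspace Y"
    unfolding Y subspace_def by (auto simp: blinfun.add_right blinfun.scaleR_right)
  moreover have "closed Y"
    unfolding Y by (intro closed_Collect_eq continuous_intros)
  ultimately show ?thesis
    using assms unfolding complemented_def by blast
qed

lemma norm_projection_ge_1:
  assumes "projection_onto Y P" "y \<in> Y" "y \<noteq> 0"
  shows "1 \<le> norm P"
proof -
  have "norm y \<le> norm P * norm y"
    using norm_blinfun[of P y] projection_onto_fixed[OF assms(1,2)] by simp
  then show ?thesis using assms(3) by simp
qed

lemma projectional_tree_norm_bound:
  assumes "bounded (\<rho> ` Sigma_copies m \<Lambda>)" "x \<in> Sigma_copies m \<Lambda>"
  shows "norm (\<rho> x) \<le> projectional_tree_norm m \<Lambda> \<rho>"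
  unfolding projectional_tree_norm_def
proof (rule cInf_greatest)
  obtain B where B: "0 < B" "\<And>x. x \<in> Sigma_copies m \<Lambda> \<Longrightarrow> norm (\<rho> x) \<le> B"
    using assms(1) unfolding bounded_pos by auto
  have "\<rho> x \<in> (\<lambda>\<phi>. B *\<^sub>R \<phi>) ` cball 0 1" if "x \<in> Sigma_copies m \<Lambda>" for x
    using B(1) B(2)[OF that] by (intro image_eqI[of _ _ "(1 / B) *\<^sub>R \<rho> x"]) auto
  with B(1) show "{C. 0 < C \<and> \<rho> ` Sigma_copies m \<Lambda> \<subseteq> (\<lambda>\<phi>. C *\<^sub>R \<phi>) ` cball 0 1} \<noteq> {}"
    by blast
next
  fix C
  assume "C \<in> {C. 0 < C \<and> \<rho> ` Sigma_copies m \<Lambda> \<subseteq> (\<lambda>\<phi>. C *\<^sub>R \<phi>) ` cball 0 1}"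
  then obtain \<phi> where "0 < C" "\<rho> x = C *\<^sub>R \<phi>" "norm \<phi> \<le> 1"
    using assms(2) by (auto simp: image_subset_iff)
  then show "norm (\<rho> x) \<le> C"
    by simp
qed

text \<open>\<open>K\<close> is the completion of \<open>\<Sigma>\<^sub>m(\<Lambda>)\<close>, expressed through functions because only the space of
  continuous functions on \<open>K\<close> enters the passage between projections and projectional trees: by
  \<open>restriction\<close> and \<open>extension\<close> the functions on \<open>\<Sigma>\<^sub>m(\<Lambda>)\<close> induced by the continuous ones on \<open>K\<close> are the
  uniformly continuous ones, and \<open>dense\<close> is the density of \<open>\<Sigma>\<^sub>m(\<Lambda>)\<close> in \<open>K\<close> as seen by the supremum
  norm.\<close>

locale tree_completion =
  fixes K :: "'k::topological_space set" and m :: nat and \<Lambda> :: "node set"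
    and \<iota> :: "node \<times> nat \<Rightarrow> 'k"
  assumes m: "1 \<le> m"
    and hereditary: "hereditary \<Lambda>"
    and Nil: "[] \<in> \<Lambda>"
    and \<iota>_in: "x \<in> Sigma_copies m \<Lambda> \<Longrightarrow> \<iota> x \<in> K"
    and dense: "F \<in> cspace K \<Longrightarrow> (\<And>x. x \<in> Sigma_copies m \<Lambda> \<Longrightarrow> \<bar>F (\<iota> x)\<bar> \<le> C) \<Longrightarrow>
      y \<in> K \<Longrightarrow> \<bar>F y\<bar> \<le> C"
    and restriction: "F \<in> cspace K \<Longrightarrow> copies_uniform m \<Lambda> (\<lambda>x. F (\<iota> x))"
    and extension: "copies_uniform m \<Lambda> g \<Longrightarrow>
      \<exists>F\<in>cspace K. \<forall>x\<in>Sigma_copies m \<Lambda>. F (\<iota> x) = g x"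
begin

abbreviation "\<Sigma> \<equiv> Sigma_copies m \<Lambda>"
abbreviation "\<A> \<equiv> Aspace_pow m \<Lambda>"
abbreviation "family \<equiv> family_of m \<Lambda>"

lemma root_in: "([], 1) \<in> \<Sigma>"
  using m Nil by (simp add: Sigma_copies_def)

lemma supnorm_le_iff:
  assumes "F \<in> cspace K"
  shows "supnorm K F \<le> C \<longleftrightarrow> (\<forall>x\<in>\<Sigma>. \<bar>F (\<iota> x)\<bar> \<le> C)"
proof -
  have "\<forall>i\<in>{1..m}. \<exists>B. \<forall>s\<in>\<Lambda>. \<bar>F (\<iota> (s, i))\<bar> \<le> B"
  proof
    fix i assume "i \<in> {1..m}"
    then have "code_uniform \<Lambda> (\<lambda>s. F (\<iota> (s, i)))"
      using restriction[OF assms] unfolding copies_uniform_def by blast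
    from code_uniform_bounded[OF this] show "\<exists>B. \<forall>s\<in>\<Lambda>. \<bar>F (\<iota> (s, i))\<bar> \<le> B" by metis
  qed
  then obtain B where B: "\<And>i s. i \<in> {1..m} \<Longrightarrow> s \<in> \<Lambda> \<Longrightarrow> \<bar>F (\<iota> (s, i))\<bar> \<le> B i"
    by metis
  have "\<bar>F (\<iota> x)\<bar> \<le> (\<Sum>i=1..m. \<bar>B i\<bar>)" if "x \<in> \<Sigma>" for x
  proof -
    obtain s i where x: "x = (s, i)" "s \<in> \<Lambda>" "i \<in> {1..m}"
      using \<open>x \<in> \<Sigma>\<close> by (auto simp: Sigma_copies_def)
    have "\<bar>B i\<bar> \<le> (\<Sum>i=1..m. \<bar>B i\<bar>)"
      using x by (intro member_le_sum) auto
    then show ?thesis using B[OF x(3,2)] by (simp add: x)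
  qed
  from dense[OF assms this] have "bdd_above ((\<lambda>x. \<bar>F x\<bar>) ` K)"
    by (auto intro!: bdd_aboveI)
  moreover have "K \<noteq> {}" using \<iota>_in[OF root_in] by blast
  ultimately have "supnorm K F \<le> C \<longleftrightarrow> (\<forall>y\<in>K. \<bar>F y\<bar> \<le> C)"
    unfolding supnorm_def by (intro cSUP_le_iff)
  then show ?thesis
    using dense[OF assms] \<iota>_in by blast
qed

lemma abs_le_supnorm: "F \<in> cspace K \<Longrightarrow> x \<in> \<Sigma> \<Longrightarrow> \<bar>F (\<iota> x)\<bar> \<le> supnorm K F"
  using supnorm_le_iff by blast

lemma cspace_eqI:
  assumes F: "F \<in> cspace K" and G: "G \<in> cspace K" and eq: "\<And>x. x \<in> \<Sigma> \<Longrightarrow> F (\<iota> x) = G (\<iota> x)"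
  shows "F = G"
proof
  fix y
  show "F y = G y"
  proof (cases "y \<in> K")
    case True
    have "\<bar>F y + (- 1) * G y\<bar> \<le> 0"
      by (rule dense[OF cspace_add[OF F cspace_scale[OF G]] _ True]) (simp add: eq)
    then show ?thesis by simp
  qed (use F G in \<open>simp add: cspace_def\<close>)
qed

lemma Anorm_pow_eq_supnorm:
  assumes "a \<in> \<A>" "F \<in> cspace K" "\<And>x. x \<in> \<Sigma> \<Longrightarrow> dtilde x a = F (\<iota> x)"
  shows "Anorm_pow m \<Lambda> a = supnorm K F"
proof -
  have "Anorm_pow m \<Lambda> a \<le> C \<longleftrightarrow> supnorm K F \<le> C" for C
    using assms(3) by (simp add: Anorm_pow_le_iff[OF m Nil assms(1)] supnorm_le_iff[OF assms(2)])
  then show ?thesis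
    by (metis order.antisym order.refl)
qed

lemma family_in: "copies_uniform m \<Lambda> g \<Longrightarrow> family g \<in> \<A>"
  by (rule family_of_in_Aspace_pow[OF hereditary Nil])

lemma dtilde_family: "x \<in> \<Sigma> \<Longrightarrow> dtilde x (family g) = g x"
  by (rule dtilde_family_of[OF hereditary])

lemma Anorm_family: "F \<in> cspace K \<Longrightarrow> Anorm_pow m \<Lambda> (family (\<lambda>x. F (\<iota> x))) = supnorm K F"
  by (intro Anorm_pow_eq_supnorm family_in restriction) (auto simp: dtilde_family)

lemma family_image: "(\<lambda>F. family (\<lambda>x. F (\<iota> x))) ` cspace K = \<A>"
proof
  show "(\<lambda>F. family (\<lambda>x. F (\<iota> x))) ` cspace K \<subseteq> \<A>"
    by (auto intro: family_in restriction)
  show "\<A> \<subseteq> (\<lambda>F. family (\<lambda>x. F (\<iota> x))) ` cspace K"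
  proof
    fix a assume a: "a \<in> \<A>"
    then obtain F where F: "F \<in> cspace K" "\<And>x. x \<in> \<Sigma> \<Longrightarrow> F (\<iota> x) = dtilde x a"
      using extension copies_uniform_dtilde[OF hereditary] by blast
    have "family (\<lambda>x. F (\<iota> x)) = family (\<lambda>x. dtilde x a)"
      by (rule family_of_cong[OF hereditary F(2)])
    with F(1) show "a \<in> (\<lambda>F. family (\<lambda>x. F (\<iota> x))) ` cspace K"
      using family_of_dtilde[OF a] by (intro image_eqI[of _ _ F]) simp_all
  qed
qed

lemma linear_map_on_family:
  assumes "linear_map_on \<A> T"
  shows "linear_map_on (cspace K) (\<lambda>F. T (family (\<lambda>x. F (\<iota> x))))"
proof -
  have *: "family (\<lambda>x. F (\<iota> x)) \<in> \<A>" if "F \<in> cspace K" for F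
    by (rule family_in[OF restriction[OF that]])
  show ?thesis
    unfolding linear_map_on_def family_of_add family_of_scale
    by (intro conjI ballI allI linear_map_onD[OF assms * *])
qed

text \<open>For \<open>e\<close> in the space, \<open>x \<mapsto> \<rho>(x)(e)\<close> is uniformly continuous, hence consists of the branch
  sums of a family, and the projection sends \<open>e\<close> to the image of that family under \<open>T\<close>. The
  condition \<open>T\<^sup>*(\<rho>(x)) = \<delta>\<^sub>x\<close> says that this fixes the range of \<open>T\<close>.\<close>

lemma projection_from_tree:
  fixes T :: "(node \<times> nat \<Rightarrow> real) \<Rightarrow> 'e::banach"
  assumes tree: "projectional_tree \<beta> m \<Lambda> T \<rho>"
  shows "\<exists>P. projection_onto (T ` \<A>) P \<and> C_isomorphic K (T ` \<A>) \<and>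
    (isometric_embedding \<A> (Anorm_pow m \<Lambda>) T \<longrightarrow> C_isometric K (T ` \<A>) \<and>
      (projectional_tree_norm m \<Lambda> \<rho> = 1 \<longrightarrow> norm P = 1)) \<and>
    (\<forall>le. positive_projectional_tree le \<beta> m \<Lambda> T \<rho> \<longrightarrow> positive_operator le P)"
proof -
  have emb: "isomorphic_embedding \<A> (Anorm_pow m \<Lambda>) T"
    and ws: "unif_weak_star_continuous_on \<Sigma> Sigma_dist \<rho>" and bdd: "bounded (\<rho> ` \<Sigma>)"
    and dual: "\<And>x a. x \<in> \<Sigma> \<Longrightarrow> a \<in> \<A> \<Longrightarrow> blinfun_apply (\<rho> x) (T a) = dtilde x a"
    using tree unfolding projectional_tree_def by blast+
  obtain c C where lin: "linear_map_on \<A> T" and c: "0 < c"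
    and T: "\<And>a. a \<in> \<A> \<Longrightarrow> c * Anorm_pow m \<Lambda> a \<le> norm (T a)"
      "\<And>a. a \<in> \<A> \<Longrightarrow> norm (T a) \<le> C * Anorm_pow m \<Lambda> a"
    using emb unfolding isomorphic_embedding_def by blast
  define co where "co e = family (\<lambda>x. blinfun_apply (\<rho> x) e)" for e
  have co: "co e \<in> \<A>" for e
    unfolding co_def by (rule family_in[OF copies_uniform_if_weak_star[OF ws]])
  have dco: "dtilde x (co e) = blinfun_apply (\<rho> x) e" if "x \<in> \<Sigma>" for x e
    unfolding co_def by (rule dtilde_family[OF that])
  have co_bound: "Anorm_pow m \<Lambda> (co e) \<le> B * norm e"
    if "\<And>x. x \<in> \<Sigma> \<Longrightarrow> norm (\<rho> x) \<le> B" for B e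
    unfolding Anorm_pow_le_iff[OF m Nil co]
    using norm_blinfun[of "\<rho> _" e] mult_right_mono[OF that norm_ge_zero]
    by (fastforce simp: dco intro: order_trans)
  have norm_nonneg: "0 \<le> Anorm_pow m \<Lambda> a" if "a \<in> \<A>" for a
    using Anorm_pow_le_iff[OF m Nil that] root_in abs_ge_zero by (meson order.refl order_trans)
  obtain B where B: "\<And>x. x \<in> \<Sigma> \<Longrightarrow> norm (\<rho> x) \<le> B"
    using bdd unfolding bounded_iff by blast
  have add: "T (co (e + e')) = T (co e) + T (co e')" for e e'
    using linear_map_onD(1)[OF lin co co, of e e']
    by (simp add: co_def blinfun.add_right family_of_add)
  have scale: "T (co (r *\<^sub>R e)) = r *\<^sub>R T (co e)" for r e
    using linear_map_onD(2)[OF lin co co, of r e]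
    by (simp add: co_def blinfun.scaleR_right family_of_scale)
  have bound: "norm (T (co e)) \<le> norm e * (\<bar>C\<bar> * B)" for e
  proof -
    have "norm (T (co e)) \<le> \<bar>C\<bar> * Anorm_pow m \<Lambda> (co e)"
      using T(2)[OF co] mult_right_mono[OF abs_ge_self norm_nonneg[OF co]] by (rule order_trans)
    also have "\<dots> \<le> \<bar>C\<bar> * (B * norm e)"
      by (intro mult_left_mono co_bound B) auto
    finally show ?thesis by (simp add: mult_ac)
  qed
  have blin: "bounded_linear (\<lambda>e. T (co e))"
    using add scale bound by (rule bounded_linear_intro)
  define P where "P = Blinfun (\<lambda>e. T (co e))"
  have P: "blinfun_apply P e = T (co e)" for e
    unfolding P_def by (simp add: bounded_linear_Blinfun_apply[OF blin])
  have co_T: "co (T a) = a" if "a \<in> \<A>" for a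
  proof -
    have "co (T a) = family (\<lambda>x. dtilde x a)"
      unfolding co_def by (rule family_of_cong[OF hereditary]) (rule dual[OF _ that])
    then show ?thesis by (simp add: family_of_dtilde[OF that])
  qed
  have proj: "projection_onto (T ` \<A>) P"
    unfolding projection_onto_def
  proof
    show "P o\<^sub>L P = P" by (rule blinfun_eqI) (simp add: P co_T co)
    show "range (blinfun_apply P) = T ` \<A>"
      using co by (auto simp: P) (metis P co_T rangeI)
  qed
  let ?J = "\<lambda>F. T (family (\<lambda>x. F (\<iota> x)))"
  have J_image: "?J ` cspace K = T ` \<A>"
    by (subst family_image[symmetric]) auto
  have J_lin: "linear_map_on (cspace K) ?J" by (rule linear_map_on_family[OF lin])
  have "isomorphic_embedding (cspace K) (supnorm K) ?J"
    unfolding isomorphic_embedding_def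
  proof (rule conjI[OF J_lin], rule exI[of _ c], rule conjI[OF c], rule exI[of _ C],
      intro ballI conjI)
    fix F assume F: "F \<in> cspace K"
    show "c * supnorm K F \<le> norm (?J F)" "norm (?J F) \<le> C * supnorm K F"
      using T[OF family_in[OF restriction[OF F]]] by (auto simp: Anorm_family[OF F])
  qed
  then have iso: "C_isomorphic K (T ` \<A>)"
    unfolding C_isomorphic_def using J_image by blast
  have isom: "C_isometric K (T ` \<A>) \<and> (projectional_tree_norm m \<Lambda> \<rho> = 1 \<longrightarrow> norm P = 1)"
    if "isometric_embedding \<A> (Anorm_pow m \<Lambda>) T"
  proof
    have T_norm: "norm (T a) = Anorm_pow m \<Lambda> a" if "a \<in> \<A>" for a
      using \<open>isometric_embedding \<A> _ T\<close> that unfolding isometric_embedding_def by blast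
    have "isometric_embedding (cspace K) (supnorm K) ?J"
      unfolding isometric_embedding_def
      by (simp add: J_lin T_norm[OF family_in[OF restriction]] Anorm_family)
    then show "C_isometric K (T ` \<A>)"
      unfolding C_isometric_def using J_image by blast
    show "projectional_tree_norm m \<Lambda> \<rho> = 1 \<longrightarrow> norm P = 1"
    proof
      assume "projectional_tree_norm m \<Lambda> \<rho> = 1"
      then have \<rho>: "norm (\<rho> x) \<le> 1" if "x \<in> \<Sigma>" for x
        using projectional_tree_norm_bound[OF bdd that] by simp
      have "norm P \<le> 1"
        using co_bound[OF \<rho>] by (intro norm_blinfun_bound) (auto simp: P T_norm co)
      moreover have "1 \<le> norm P"
      proof (rule norm_projection_ge_1[OF proj])
        \<comment> \<open>the norm is not less than 1 because the range of \<open>T\<close> is not trivial\<close>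
        let ?a = "family (\<lambda>x. 1)"
        have a: "?a \<in> \<A>"
          by (rule family_in) (auto simp: copies_uniform_def code_uniform_def)
        then show "T ?a \<in> T ` \<A>" by blast
        show "T ?a \<noteq> 0"
          using dual[OF root_in a] dtilde_family[OF root_in, of "\<lambda>x. 1"] by (auto simp: blinfun.zero_right)
      qed
      ultimately show "norm P = 1" by simp
    qed
  qed
  have pos: "positive_operator le P" if "positive_projectional_tree le \<beta> m \<Lambda> T \<rho>" for le
    unfolding positive_operator_def P
  proof
    fix e assume e: "e \<in> positive_cone le"
    have "A_le_pow m \<Lambda> (\<lambda>x. 0) (co e)"
      using e that unfolding A_le_pow_zero_iff positive_projectional_tree_def dual_positive_cone_def
      by (auto simp: dco image_subset_iff)
    then show "T (co e) \<in> positive_cone le"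
      using that co unfolding positive_projectional_tree_def by blast
  qed
  from proj iso isom pos show ?thesis by blast
qed

text \<open>The extension to \<open>K\<close> of the branch sums of a family; it is unique by density.\<close>

definition completion_ext :: "(node \<times> nat \<Rightarrow> real) \<Rightarrow> 'k \<Rightarrow> real" where
  "completion_ext a = (SOME F. F \<in> cspace K \<and> (\<forall>x\<in>\<Sigma>. F (\<iota> x) = dtilde x a))"

lemma completion_ext:
  assumes "a \<in> \<A>"
  shows "completion_ext a \<in> cspace K" "x \<in> \<Sigma> \<Longrightarrow> completion_ext a (\<iota> x) = dtilde x a"
proof -
  have "\<exists>F. F \<in> cspace K \<and> (\<forall>x\<in>\<Sigma>. F (\<iota> x) = dtilde x a)"
    using extension[OF copies_uniform_dtilde[OF hereditary assms]] by blast
  then have "completion_ext a \<in> cspace K \<and> (\<forall>x\<in>\<Sigma>. completion_ext a (\<iota> x) = dtilde x a)"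
    unfolding completion_ext_def by (rule someI_ex)
  then show "completion_ext a \<in> cspace K" "x \<in> \<Sigma> \<Longrightarrow> completion_ext a (\<iota> x) = dtilde x a"
    by auto
qed

lemma Aspace_pow_add: "a \<in> \<A> \<Longrightarrow> b \<in> \<A> \<Longrightarrow> (\<lambda>x. a x + b x) \<in> \<A>"
  and Aspace_pow_scale: "a \<in> \<A> \<Longrightarrow> (\<lambda>x. c * a x) \<in> \<A>"
proof -
  have *: "\<exists>F\<in>cspace K. a = family (\<lambda>x. F (\<iota> x))" if "a \<in> \<A>" for a
    using that unfolding family_image[symmetric] by blast
  show "(\<lambda>x. a x + b x) \<in> \<A>" if "a \<in> \<A>" "b \<in> \<A>"
    using *[OF that(1)] *[OF that(2)]
    by (auto simp: family_of_add[symmetric] intro!: family_in restriction[OF cspace_add, of _ _])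
  show "(\<lambda>x. c * a x) \<in> \<A>" if "a \<in> \<A>"
    using *[OF that]
    by (auto simp: family_of_scale[symmetric] intro!: family_in restriction[OF cspace_scale, of _ _])
qed

text \<open>Conversely, an embedding \<open>J\<close> of the continuous functions and a projection \<open>P\<close> onto its range
  yield the functionals \<open>\<rho>(x) = \<delta>\<^sub>x \<circ> J\<^sup>-\<^sup>1 \<circ> P\<close>.\<close>

lemma tree_from_projection:
  fixes J :: "('k \<Rightarrow> real) \<Rightarrow> 'e::banach"
  assumes rank: "tree_of_rank \<beta> \<Lambda>"
    and J: "isomorphic_embedding (cspace K) (supnorm K) J"
    and proj: "projection_onto (J ` cspace K) P"
  shows "\<exists>T (\<rho> :: _ \<Rightarrow> 'e \<Rightarrow>\<^sub>L real). projectional_tree \<beta> m \<Lambda> T \<rho> \<and>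
    (isometric_embedding (cspace K) (supnorm K) J \<longrightarrow>
      isometric_embedding \<A> (Anorm_pow m \<Lambda>) T)"
proof -
  obtain c C where lin: "linear_map_on (cspace K) J" and c: "0 < c"
    and J_bounds: "\<And>F. F \<in> cspace K \<Longrightarrow> c * supnorm K F \<le> norm (J F)"
      "\<And>F. F \<in> cspace K \<Longrightarrow> norm (J F) \<le> C * supnorm K F"
    using J unfolding isomorphic_embedding_def by blast
  have inj: "inj_on J (cspace K)"
  proof (rule inj_onI)
    fix F G assume F: "F \<in> cspace K" and G: "G \<in> cspace K" and eq: "J F = J G"
    let ?D = "\<lambda>y. F y + (- 1) * G y"
    have D: "?D \<in> cspace K" by (rule cspace_add[OF F cspace_scale[OF G]])
    have "J ?D = 0"
      using linear_map_onD(1)[OF lin F cspace_scale[OF G], of "- 1"]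
        linear_map_onD(2)[OF lin G G, of "- 1"] eq by simp
    then have "supnorm K ?D \<le> 0"
      using J_bounds(1)[OF D] c by (simp add: mult_le_0_iff)
    then have "\<forall>x\<in>\<Sigma>. \<bar>F (\<iota> x) + (- 1) * G (\<iota> x)\<bar> \<le> 0"
      unfolding supnorm_le_iff[OF D] .
    then show "F = G" by (intro cspace_eqI F G) auto
  qed
  define pre where "pre e = inv_into (cspace K) J (blinfun_apply P e)" for e
  have range: "blinfun_apply P e \<in> J ` cspace K" for e
    using proj unfolding projection_onto_def by blast
  have pre: "pre e \<in> cspace K" "J (pre e) = blinfun_apply P e" for e
    unfolding pre_def using inv_into_into[OF range[of e]] f_inv_into_f[OF range[of e]] by auto
  have pre_eqI: "pre e = F" if "F \<in> cspace K" "J F = blinfun_apply P e" for F e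
    using inj_onD[OF inj, of "pre e" F] pre[of e] that by simp
  have pre_add: "pre (e + e') = (\<lambda>y. pre e y + pre e' y)" for e e'
    by (intro pre_eqI cspace_add pre)
      (simp add: linear_map_onD(1)[OF lin pre(1) pre(1)] pre(2) blinfun.add_right)
  have pre_scale: "pre (r *\<^sub>R e) = (\<lambda>y. r * pre e y)" for r e
    by (intro pre_eqI cspace_scale pre)
      (simp add: linear_map_onD(2)[OF lin pre(1) pre(1)] pre(2) blinfun.scaleR_right)
  have pre_bound: "\<bar>pre e (\<iota> x)\<bar> \<le> norm e * (norm P / c)" if "x \<in> \<Sigma>" for x e
  proof -
    have "c * supnorm K (pre e) \<le> norm P * norm e"
      using J_bounds(1)[OF pre(1)[of e]] norm_blinfun[of P e] by (simp add: pre(2))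
    then have "supnorm K (pre e) \<le> norm e * (norm P / c)"
      using c by (simp add: field_simps)
    then show ?thesis
      using abs_le_supnorm[OF pre(1) that, of e] by linarith
  qed
  define \<rho> :: "node \<times> nat \<Rightarrow> 'e \<Rightarrow>\<^sub>L real" where "\<rho> x = Blinfun (\<lambda>e. pre e (\<iota> x))" for x
  have \<rho>: "blinfun_apply (\<rho> x) e = pre e (\<iota> x)" if "x \<in> \<Sigma>" for x e
  proof -
    have "bounded_linear (\<lambda>e. pre e (\<iota> x))"
      by (rule bounded_linear_intro[where K = "norm P / c"])
        (use pre_bound[OF that] in \<open>simp_all add: pre_add pre_scale\<close>)
    then show ?thesis
      unfolding \<rho>_def by (simp add: bounded_linear_Blinfun_apply)
  qed
  define T where "T a = J (completion_ext a)" for a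
  have T_lin: "linear_map_on \<A> T"
    unfolding linear_map_on_def
  proof (intro conjI ballI allI)
    fix a b assume a: "a \<in> \<A>" and b: "b \<in> \<A>"
    have "completion_ext (\<lambda>x. a x + b x) = (\<lambda>y. completion_ext a y + completion_ext b y)"
      by (rule cspace_eqI)
        (use completion_ext[OF a] completion_ext[OF b] completion_ext[OF Aspace_pow_add[OF a b]]
          in \<open>auto simp: dtilde_add intro: cspace_add\<close>)
    then show "T (\<lambda>x. a x + b x) = T a + T b"
      unfolding T_def using linear_map_onD(1)[OF lin] completion_ext(1) a b by simp
  next
    fix r a assume a: "a \<in> \<A>"
    have "completion_ext (\<lambda>x. r * a x) = (\<lambda>y. r * completion_ext a y)"
      by (rule cspace_eqI)
        (use completion_ext[OF a] completion_ext[OF Aspace_pow_scale[OF a]]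
          in \<open>auto simp: dtilde_scale intro: cspace_scale\<close>)
    then show "T (\<lambda>x. r * a x) = r *\<^sub>R T a"
      unfolding T_def using linear_map_onD(2)[OF lin, of _ "completion_ext a"] completion_ext(1)[OF a] by simp
  qed
  have norm_eq: "Anorm_pow m \<Lambda> a = supnorm K (completion_ext a)" if "a \<in> \<A>" for a
    using completion_ext[OF that] by (intro Anorm_pow_eq_supnorm that) auto
  have "projectional_tree \<beta> m \<Lambda> T \<rho>"
    unfolding projectional_tree_def
  proof (intro conjI ballI m rank)
    show "isomorphic_embedding \<A> (Anorm_pow m \<Lambda>) T"
      unfolding isomorphic_embedding_def
      using T_lin c J_bounds[OF completion_ext(1)] by (auto simp: norm_eq T_def)
    show "unif_weak_star_continuous_on \<Sigma> Sigma_dist \<rho>"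
    proof (rule weak_star_if_copies_uniform)
      fix e
      show "copies_uniform m \<Lambda> (\<lambda>x. blinfun_apply (\<rho> x) e)"
        using restriction[OF pre(1)[of e]]
          copies_uniform_cong[of m \<Lambda> "\<lambda>x. blinfun_apply (\<rho> x) e" "\<lambda>x. pre e (\<iota> x)"] \<rho>
        by blast
    qed
    have "norm (\<rho> x) \<le> norm P / c" if "x \<in> \<Sigma>" for x
      using pre_bound[OF that] c by (intro norm_blinfun_bound) (auto simp: \<rho>[OF that] mult.commute)
    then show "bounded (\<rho> ` \<Sigma>)"
      unfolding bounded_iff by blast
    fix x a assume x: "x \<in> \<Sigma>" and a: "a \<in> \<A>"
    have "pre (T a) = completion_ext a"
      using projection_onto_fixed[OF proj, of "T a"] completion_ext(1)[OF a]
      by (intro pre_eqI) (auto simp: T_def)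
    then show "blinfun_apply (\<rho> x) (T a) = dtilde x a"
      using completion_ext(2)[OF a x] by (simp add: \<rho>[OF x])
  qed
  moreover have "isometric_embedding \<A> (Anorm_pow m \<Lambda>) T"
    if "isometric_embedding (cspace K) (supnorm K) J"
    using that T_lin completion_ext(1) unfolding isometric_embedding_def by (auto simp: norm_eq T_def)
  ultimately show ?thesis by blast
qed

end

lemma isomorphic_if_isometric_embedding:
  assumes "isometric_embedding V N J"
  shows "isomorphic_embedding V N J"
  unfolding isomorphic_embedding_def
  using assms by (auto simp: isometric_embedding_def intro!: exI[of _ 1])

text \<open>Both parts of the theorem are instances of this statement: it takes only that the compact
  space is the completion of \<open>\<Sigma>\<^sub>m(\<Lambda>)\<close> for every tree of the given rank, and that such trees
  exist.\<close>

lemma complemented_iff_projectional_tree: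
  fixes K :: "'k::topological_space set" and \<beta> :: tree_rank and m :: nat
  assumes tree: "tree_of_rank \<beta> \<Lambda>\<^sub>0"
    and completion: "\<And>\<Lambda>. tree_of_rank \<beta> \<Lambda> \<Longrightarrow> \<exists>\<iota>. tree_completion K m \<Lambda> \<iota>"
  shows
    "((\<exists>Y :: 'e::banach set. complemented Y \<and> C_isomorphic K Y) \<longleftrightarrow>
        (\<exists>\<Lambda> (T :: _ \<Rightarrow> 'e) \<rho>. projectional_tree \<beta> m \<Lambda> T \<rho>)) \<and>
      ((\<exists>Y :: 'e::banach set. complemented Y \<and> C_isometric K Y) \<longleftrightarrow>
        (\<exists>\<Lambda> (T :: _ \<Rightarrow> 'e) \<rho>. isometric_projectional_tree \<beta> m \<Lambda> T \<rho>)) \<and>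
      ((\<exists>\<Lambda> (T :: _ \<Rightarrow> 'e) \<rho>. isometric_projectional_tree \<beta> m \<Lambda> T \<rho> \<and>
           projectional_tree_norm m \<Lambda> \<rho> = 1) \<longrightarrow>
        (\<exists>(Y :: 'e set) P. complemented Y \<and> C_isometric K Y \<and> projection_onto Y P \<and> norm P = 1)) \<and>
      (\<forall>inf le less sup. banach_lattice inf le less (sup :: 'e \<Rightarrow> 'e \<Rightarrow> 'e) \<longrightarrow>
        ((\<exists>\<Lambda> (T :: _ \<Rightarrow> 'e) \<rho>. positive_projectional_tree le \<beta> m \<Lambda> T \<rho>) \<longrightarrow>
          (\<exists>(Y :: 'e set) P. complemented Y \<and> C_isomorphic K Y \<and> projection_onto Y P \<and>
             positive_operator le P)) \<and>
        ((\<exists>\<Lambda> (T :: _ \<Rightarrow> 'e) \<rho>. positive_projectional_tree le \<beta> m \<Lambda> T \<rho> \<and>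
             isometric_projectional_tree \<beta> m \<Lambda> T \<rho>) \<longrightarrow>
          (\<exists>(Y :: 'e set) P. complemented Y \<and> C_isometric K Y \<and> projection_onto Y P \<and>
             positive_operator le P)))"
proof -
  have forward: "\<exists>(Y :: 'e set) P. complemented Y \<and> projection_onto Y P \<and> C_isomorphic K Y \<and>
      (isometric_projectional_tree \<beta> m \<Lambda> T \<rho> \<longrightarrow> C_isometric K Y \<and>
        (projectional_tree_norm m \<Lambda> \<rho> = 1 \<longrightarrow> norm P = 1)) \<and>
      (\<forall>le. positive_projectional_tree le \<beta> m \<Lambda> T \<rho> \<longrightarrow> positive_operator le P)"
    if T: "projectional_tree \<beta> m \<Lambda> T \<rho>" for \<Lambda> and T :: "_ \<Rightarrow> 'e" and \<rho>
  proof -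
    have "tree_of_rank \<beta> \<Lambda>" using T unfolding projectional_tree_def by blast
    then obtain \<iota> where "tree_completion K m \<Lambda> \<iota>" using completion by blast
    from tree_completion.projection_from_tree[OF this T] show ?thesis
      unfolding isometric_projectional_tree_def using complemented_if_projection_onto by blast
  qed
  have backward: "\<exists>\<Lambda> (T :: _ \<Rightarrow> 'e) \<rho>. projectional_tree \<beta> m \<Lambda> T \<rho> \<and>
      (isometric_embedding (cspace K) (supnorm K) J \<longrightarrow> isometric_projectional_tree \<beta> m \<Lambda> T \<rho>)"
    if compl: "complemented (J ` cspace K)"
      and J: "isomorphic_embedding (cspace K) (supnorm K) J"
    for J :: "_ \<Rightarrow> 'e"
  proof -
    obtain P where P: "projection_onto (J ` cspace K) P"
      using compl unfolding complemented_def by blast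
    obtain \<iota> where "tree_completion K m \<Lambda>\<^sub>0 \<iota>" using completion[OF tree] by blast
    from tree_completion.tree_from_projection[OF this tree J P] show ?thesis
      unfolding isometric_projectional_tree_def by blast
  qed
  have iso: "(\<exists>Y :: 'e set. complemented Y \<and> C_isomorphic K Y) \<longleftrightarrow>
      (\<exists>\<Lambda> (T :: _ \<Rightarrow> 'e) \<rho>. projectional_tree \<beta> m \<Lambda> T \<rho>)"
    using forward backward unfolding C_isomorphic_def by meson
  have isom: "(\<exists>Y :: 'e set. complemented Y \<and> C_isometric K Y) \<longleftrightarrow>
      (\<exists>\<Lambda> (T :: _ \<Rightarrow> 'e) \<rho>. isometric_projectional_tree \<beta> m \<Lambda> T \<rho>)"
  proof
    assume "\<exists>Y :: 'e set. complemented Y \<and> C_isometric K Y"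
    then obtain J :: "_ \<Rightarrow> 'e" where "complemented (J ` cspace K)"
        "isometric_embedding (cspace K) (supnorm K) J"
      unfolding C_isometric_def by blast
    with backward[of J] isomorphic_if_isometric_embedding[of _ _ J]
    show "\<exists>\<Lambda> (T :: _ \<Rightarrow> 'e) \<rho>. isometric_projectional_tree \<beta> m \<Lambda> T \<rho>" by blast
  next
    assume "\<exists>\<Lambda> (T :: _ \<Rightarrow> 'e) \<rho>. isometric_projectional_tree \<beta> m \<Lambda> T \<rho>"
    then obtain \<Lambda> and T :: "_ \<Rightarrow> 'e" and \<rho> where *: "isometric_projectional_tree \<beta> m \<Lambda> T \<rho>"
      by blast
    then have "projectional_tree \<beta> m \<Lambda> T \<rho>"
      unfolding isometric_projectional_tree_def by blast
    from forward[OF this] * show "\<exists>Y :: 'e set. complemented Y \<and> C_isometric K Y" by blast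
  qed
  have norm1: "\<exists>(Y :: 'e set) P. complemented Y \<and> C_isometric K Y \<and> projection_onto Y P \<and> norm P = 1"
    if "isometric_projectional_tree \<beta> m \<Lambda> T \<rho>" "projectional_tree_norm m \<Lambda> \<rho> = 1"
    for \<Lambda> and T :: "_ \<Rightarrow> 'e" and \<rho>
  proof -
    have "projectional_tree \<beta> m \<Lambda> T \<rho>"
      using that unfolding isometric_projectional_tree_def by blast
    from forward[OF this] that show ?thesis by blast
  qed
  have pos: "\<exists>(Y :: 'e set) P. complemented Y \<and> C_isomorphic K Y \<and> projection_onto Y P \<and>
      positive_operator le P \<and> (isometric_projectional_tree \<beta> m \<Lambda> T \<rho> \<longrightarrow> C_isometric K Y)"
    if "positive_projectional_tree le \<beta> m \<Lambda> T \<rho>" for le \<Lambda> and T :: "_ \<Rightarrow> 'e" and \<rho>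
  proof -
    have "projectional_tree \<beta> m \<Lambda> T \<rho>"
      using that unfolding positive_projectional_tree_def by blast
    from forward[OF this] that show ?thesis by blast
  qed
  show ?thesis
  proof (intro conjI allI impI)
    show "(\<exists>Y :: 'e set. complemented Y \<and> C_isomorphic K Y) \<longleftrightarrow>
        (\<exists>\<Lambda> (T :: _ \<Rightarrow> 'e) \<rho>. projectional_tree \<beta> m \<Lambda> T \<rho>)" by (rule iso)
    show "(\<exists>Y :: 'e set. complemented Y \<and> C_isometric K Y) \<longleftrightarrow>
        (\<exists>\<Lambda> (T :: _ \<Rightarrow> 'e) \<rho>. isometric_projectional_tree \<beta> m \<Lambda> T \<rho>)" by (rule isom)
  next
    assume "\<exists>\<Lambda> (T :: _ \<Rightarrow> 'e) \<rho>. isometric_projectional_tree \<beta> m \<Lambda> T \<rho> \<and>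
      projectional_tree_norm m \<Lambda> \<rho> = 1"
    then show "\<exists>(Y :: 'e set) P. complemented Y \<and> C_isometric K Y \<and> projection_onto Y P \<and> norm P = 1"
      using norm1 by blast
  next
    fix le :: "'e \<Rightarrow> 'e \<Rightarrow> bool"
    assume "\<exists>\<Lambda> (T :: _ \<Rightarrow> 'e) \<rho>. positive_projectional_tree le \<beta> m \<Lambda> T \<rho>"
    then show "\<exists>(Y :: 'e set) P. complemented Y \<and> C_isomorphic K Y \<and> projection_onto Y P \<and>
        positive_operator le P"
      using pos by blast
  next
    fix le :: "'e \<Rightarrow> 'e \<Rightarrow> bool"
    assume "\<exists>\<Lambda> (T :: _ \<Rightarrow> 'e) \<rho>. positive_projectional_tree le \<beta> m \<Lambda> T \<rho> \<and>
      isometric_projectional_tree \<beta> m \<Lambda> T \<rho>"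
    then show "\<exists>(Y :: 'e set) P. complemented Y \<and> C_isometric K Y \<and> projection_onto Y P \<and>
        positive_operator le P"
      using pos by blast
  qed
qed


section \<open>The Cantor space as completion of the full tree\<close>

lemma open_contains_cylinder:
  fixes x :: "nat \<Rightarrow> bool"
  assumes "open S" "x \<in> S"
  shows "\<exists>k. \<forall>y. (\<forall>i<k. y i = x i) \<longrightarrow> y \<in> S"
proof -
  have "openin (product_topology (\<lambda>i. euclidean) UNIV) S"
    using assms(1) by (simp add: open_fun_def)
  from product_topology_open_contains_basis[OF this assms(2)]
  obtain X where X: "x \<in> (\<Pi>\<^sub>E i\<in>UNIV. X i)"
    "finite {i. X i \<noteq> topspace (euclidean :: bool topology)}" "(\<Pi>\<^sub>E i\<in>UNIV. X i) \<subseteq> S"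
    by blast
  obtain k where k: "\<And>i. X i \<noteq> UNIV \<Longrightarrow> i < k"
    using finite_nat_set_iff_bounded X(2) by auto
  have "y \<in> S" if "\<forall>i<k. y i = x i" for y
  proof -
    have "y i \<in> X i" for i
      using that X(1) k[of i] by (cases "i < k") (auto simp: PiE_def Pi_def)
    then show ?thesis using X(3) by (auto simp: PiE_def)
  qed
  then show ?thesis by blast
qed

lemma open_cylinder: "open {y :: nat \<Rightarrow> bool. \<forall>i<k. y i = x i}"
proof -
  have "{y :: nat \<Rightarrow> bool. \<forall>i<k. y i = x i} = (\<Inter>i\<in>{..<k}. (\<lambda>y. y i) -` {x i})"
    by auto
  moreover have "open ((\<lambda>y :: nat \<Rightarrow> bool. y i) -` {x i})" for i
    by (rule open_vimage) (simp_all add: continuous_on_product_coordinates open_discrete)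
  ultimately show ?thesis by (auto intro: open_INT)
qed

lemma continuous_on_cantor_iff:
  fixes F :: "(nat \<Rightarrow> bool) \<Rightarrow> real"
  shows "continuous_on UNIV F \<longleftrightarrow>
    (\<forall>x. \<forall>e>0. \<exists>k. \<forall>y. (\<forall>i<k. y i = x i) \<longrightarrow> \<bar>F y - F x\<bar> < e)"
proof (intro iffI allI impI)
  fix x and e :: real
  assume F: "continuous_on UNIV F" and e: "0 < e"
  have "open (F -` ball (F x) e)"
    using F by (intro open_vimage) simp_all
  moreover have "x \<in> F -` ball (F x) e" using e by simp
  ultimately obtain k where "\<forall>y. (\<forall>i<k. y i = x i) \<longrightarrow> y \<in> F -` ball (F x) e"
    using open_contains_cylinder by blast
  then show "\<exists>k. \<forall>y. (\<forall>i<k. y i = x i) \<longrightarrow> \<bar>F y - F x\<bar> < e"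
    by (auto simp: dist_real_def abs_minus_commute)
next
  assume F: "\<forall>x. \<forall>e>0. \<exists>k. \<forall>y. (\<forall>i<k. y i = x i) \<longrightarrow> \<bar>F y - F x\<bar> < e"
  show "continuous_on UNIV F"
    unfolding continuous_on_topological
  proof (intro ballI allI impI)
    fix x and B :: "real set" assume B: "open B" "F x \<in> B"
    then obtain e where e: "0 < e" "\<And>z. \<bar>z - F x\<bar> < e \<Longrightarrow> z \<in> B"
      unfolding open_dist dist_real_def by blast
    then obtain k where "\<forall>y. (\<forall>i<k. y i = x i) \<longrightarrow> \<bar>F y - F x\<bar> < e" using F by blast
    then show "\<exists>A. open A \<and> x \<in> A \<and> (\<forall>y\<in>UNIV. y \<in> A \<longrightarrow> F y \<in> B)"
      using e(2) by (intro exI[of _ "{y. \<forall>i<k. y i = x i}"]) (auto simp: open_cylinder)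
  qed
qed

text \<open>The codes of the nodes are the sequences that are eventually true; the other points of the
  Cantor space correspond to the infinite branches. So continuity at all points is continuity
  at all nodes and along all branches.\<close>

lemma code_uniform_cantor:
  fixes F :: "(nat \<Rightarrow> bool) \<Rightarrow> real"
  assumes "continuous_on UNIV F"
  shows "code_uniform UNIV (\<lambda>s. F (cantor_code s))"
proof (rule code_uniform_if_local)
  have F: "\<exists>k. \<forall>y. (\<forall>i<k. y i = x i) \<longrightarrow> \<bar>F y - F x\<bar> < e" if "0 < e" for x and e :: real
    using assms that unfolding continuous_on_cantor_iff by blast
  show "hereditary UNIV" by (simp add: hereditary_def)
  fix e :: real assume e: "0 < e"
  show "\<exists>n. \<forall>k\<ge>n. \<forall>t\<in>UNIV. prefix (s @ [k]) t \<longrightarrow> \<bar>F (cantor_code t) - F (cantor_code s)\<bar> < e"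
    for s
  proof -
    obtain n where n: "\<And>y. (\<forall>i<n. y i = cantor_code s i) \<Longrightarrow> \<bar>F y - F (cantor_code s)\<bar> < e"
      using F[OF e] by blast
    have "\<forall>i<n. cantor_code t i = cantor_code s i" if "n \<le> k" "prefix (s @ [k]) t" for k t
      using agree_mono[OF agree_child[OF that(2)] that(1)] by (simp add: agree_def)
    with n show ?thesis by blast
  qed
  fix b :: "nat \<Rightarrow> node"
  assume b: "b 0 = []" "\<And>n. \<exists>j. b (Suc n) = b n @ [j]"
  define x where "x i = cantor_code (b (Suc i)) i" for i
  have x: "cantor_code t i = x i" if "i < n" "prefix (b n) t" for i n t
  proof -
    have "prefix (b (Suc i)) t"
      using branch_facts(2)[OF b, of "Suc i" n] that by (auto intro: prefix_order.trans)
    moreover have "i < code_length (b (Suc i))"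
      using length_le_code_length[of "b (Suc i)"] branch_facts(1)[OF b, of "Suc i"] by simp
    ultimately show ?thesis
      unfolding agree_code_length[symmetric] agree_def x_def by simp
  qed
  obtain k where "\<And>y. (\<forall>i<k. y i = x i) \<Longrightarrow> \<bar>F y - F x\<bar> < e"
    using F[OF e] by blast
  with x have "\<forall>t\<in>UNIV. prefix (b k) t \<longrightarrow> \<bar>F (cantor_code t) - F x\<bar> < e" by blast
  then show "\<exists>n c. \<forall>t\<in>UNIV. prefix (b n) t \<longrightarrow> \<bar>F (cantor_code t) - c\<bar> < e" by blast
qed

text \<open>The codes of the nodes are dense, so a uniformly continuous function extends by limits.\<close>

lemma cantor_extension:
  assumes f: "code_uniform UNIV f"
  shows "\<exists>F. continuous_on UNIV F \<and> (\<forall>s. F (cantor_code s) = f s)"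
proof -
  have "\<forall>x n. \<exists>s. \<forall>i<n. cantor_code s i = x i"
    using code_approximation by blast
  then obtain near where near: "\<And>x n i. i < n \<Longrightarrow> cantor_code (near x n) i = x i"
    by metis
  have close: "\<exists>k. \<forall>x y. \<forall>m\<ge>k. \<forall>n\<ge>k. (\<forall>i<k. x i = y i) \<longrightarrow> \<bar>f (near x m) - f (near y n)\<bar> < e"
    if e: "0 < e" for e
  proof -
    obtain k where k: "\<And>s t. agree k s t \<Longrightarrow> \<bar>f s - f t\<bar> < e"
      using code_uniformD[OF f e] by (metis UNIV_I)
    have "\<bar>f (near x m) - f (near y n)\<bar> < e"
      if "k \<le> m" "k \<le> n" "\<forall>i<k. x i = y i" for x y m n
    proof (rule k)
      show "agree k (near x m) (near y n)"
        unfolding agree_def using that near[of _ m x] near[of _ n y] by simp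
    qed
    then show ?thesis by blast
  qed
  have conv: "convergent (\<lambda>n. f (near x n))" for x
  proof (rule Cauchy_convergent, rule metric_CauchyI)
    fix e :: real assume "0 < e"
    from close[OF this] show "\<exists>M. \<forall>m\<ge>M. \<forall>n\<ge>M. dist (f (near x m)) (f (near x n)) < e"
      unfolding dist_real_def by blast
  qed
  define F where "F x = lim (\<lambda>n. f (near x n))" for x
  have lim: "(\<lambda>n. f (near x n)) \<longlonglongrightarrow> F x" for x
    using conv[of x] unfolding F_def convergent_LIMSEQ_iff .
  have "continuous_on UNIV F"
    unfolding continuous_on_cantor_iff
  proof (intro allI impI)
    fix x and e :: real assume e: "0 < e"
    then have "0 < e / 2" by simp
    from close[OF this] obtain k where "\<forall>x y. \<forall>m\<ge>k. \<forall>n\<ge>k. (\<forall>i<k. x i = y i) \<longrightarrow>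
        \<bar>f (near x m) - f (near y n)\<bar> < e / 2" ..
    then have k: "\<bar>f (near x n) - f (near y n)\<bar> < e / 2" if "k \<le> n" "\<forall>i<k. x i = y i" for x y n
      using that by simp
    have "\<bar>F y - F x\<bar> < e" if "\<forall>i<k. y i = x i" for y
    proof -
      have "(\<lambda>n. \<bar>f (near y n) - f (near x n)\<bar>) \<longlonglongrightarrow> \<bar>F y - F x\<bar>"
        by (intro tendsto_intros lim)
      then have "\<bar>F y - F x\<bar> \<le> e / 2"
        by (rule LIMSEQ_le_const2)
          (use k[OF _ that] in \<open>intro exI[of _ k] allI impI less_imp_le; simp\<close>)
      with e show ?thesis by linarith
    qed
    then show "\<exists>k. \<forall>y. (\<forall>i<k. y i = x i) \<longrightarrow> \<bar>F y - F x\<bar> < e" by blast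
  qed
  moreover have "F (cantor_code s) = f s" for s
  proof (rule LIMSEQ_unique[OF lim], rule LIMSEQ_I)
    fix e :: real assume "0 < e"
    then obtain k where k: "\<And>s t. agree k s t \<Longrightarrow> \<bar>f s - f t\<bar> < e"
      using code_uniformD[OF f] by (metis UNIV_I)
    have "agree k (near (cantor_code s) n) s" if "k \<le> n" for n
      using near that by (simp add: agree_def)
    with k show "\<exists>N. \<forall>n\<ge>N. norm (f (near (cantor_code s) n) - f s) < e" by auto
  qed
  ultimately show ?thesis by blast
qed

lemma tree_completion_cantor:
  "tree_completion (UNIV :: (nat \<Rightarrow> bool) set) 1 UNIV (\<lambda>x. cantor_code (fst x))"
proof
  show "hereditary UNIV" by (simp add: hereditary_def)
  fix F :: "(nat \<Rightarrow> bool) \<Rightarrow> real" assume "F \<in> cspace UNIV"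
  then have F: "continuous_on UNIV F" by (simp add: cspace_def)
  show "copies_uniform 1 UNIV (\<lambda>x. F (cantor_code (fst x)))"
    using code_uniform_cantor[OF F] by (simp add: copies_uniform_def)
  fix C y assume C: "\<And>x. x \<in> Sigma_copies 1 UNIV \<Longrightarrow> \<bar>F (cantor_code (fst x))\<bar> \<le> C"
  show "\<bar>F y\<bar> \<le> C"
  proof (rule field_le_epsilon)
    fix e :: real assume "0 < e"
    with F have "\<exists>k. \<forall>z. (\<forall>i<k. z i = y i) \<longrightarrow> \<bar>F z - F y\<bar> < e"
      unfolding continuous_on_cantor_iff by simp
    then obtain k where k: "\<forall>z. (\<forall>i<k. z i = y i) \<longrightarrow> \<bar>F z - F y\<bar> < e" ..
    obtain s where s: "\<forall>i<k. cantor_code s i = y i" using code_approximation by blast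
    have "\<bar>F (cantor_code s)\<bar> \<le> C"
      using C[of "(s, 1)"] by (simp add: Sigma_copies_def)
    then show "\<bar>F y\<bar> \<le> C + e" using k[rule_format, of "cantor_code s"] s by simp
  qed
next
  fix g :: "node \<times> nat \<Rightarrow> real" assume "copies_uniform 1 UNIV g"
  then have "code_uniform UNIV (\<lambda>s. g (s, 1))" by (simp add: copies_uniform_def)
  from cantor_extension[OF this]
  show "\<exists>F\<in>cspace UNIV. \<forall>x\<in>Sigma_copies 1 UNIV. F (cantor_code (fst x)) = g x"
    by (auto simp: cspace_def Sigma_copies_def)
qed auto


section \<open>Countable ordinals\<close>

lemma less_SUP_lessThan_cord:
  fixes f :: "cord \<Rightarrow> cord"
  assumes "b \<noteq> 0" "y < (SUP x\<in>{..<b}. f x)"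
  shows "\<exists>x<b. y < f x"
proof (rule ccontr)
  assume "\<not> ?thesis"
  then have "f x \<le> y" if "x < b" for x
    using that by (meson not_le)
  then have "(SUP x\<in>{..<b}. f x) \<le> y"
    by (intro SUP_lessThan_cord(2) assms(1))
  with assms(2) show False by simp
qed

lemma cord_pos_iff: "0 < a \<longleftrightarrow> a \<noteq> (0 :: cord)"
  by (metis less_le zero_le_cord)

lemma one_le_cord_iff: "1 \<le> a \<longleftrightarrow> 0 < (a :: cord)"
  by (simp add: one_cord_def csucc_le_iff)

lemma csucc_inject: "csucc a = csucc b \<longleftrightarrow> a = b"
  by (metis less_csucc_iff order.antisym order.refl)

lemma less_add_cord:
  assumes "c \<noteq> 0" "y < b + (c :: cord)"
  shows "\<exists>x<c. y \<le> b + x"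
proof -
  have "y < (SUP x\<in>{..<c}. csucc (b + x))"
    using assms by (subst (asm) plus_cord.simps) simp
  from less_SUP_lessThan_cord[OF assms(1) this] show ?thesis
    by (auto simp: less_csucc_iff)
qed

lemma cord_add_assoc: "(a + b) + c = a + (b + (c :: cord))"
proof (induction c rule: less_induct)
  case (less c)
  show ?case
  proof (cases "c = 0")
    case False
    show ?thesis
    proof (rule antisym)
      show "(a + b) + c \<le> a + (b + c)"
        by (subst plus_cord.simps)
          (auto simp: False less csucc_le_iff intro!: SUP_lessThan_cord(2) cord_add_less)
      show "a + (b + c) \<le> (a + b) + c"
      proof (rule ccontr)
        assume "\<not> a + (b + c) \<le> (a + b) + c"
        then have *: "(a + b) + c < a + (b + c)" by simp
        have "b + c \<noteq> 0"
          using cord_add_less[of 0 c b] False by (metis cord_pos_iff not_less_zero_cord)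
        from less_add_cord[OF this *] obtain y where y: "y < b + c" "(a + b) + c \<le> a + y" by blast
        from less_add_cord[OF False y(1)] obtain x where x: "x < c" "y \<le> b + x" by blast
        have "a + y \<le> a + (b + x)" using x(2) by (rule cord_add_le)
        also have "\<dots> = (a + b) + x" using less[OF x(1)] by simp
        also have "\<dots> < (a + b) + c" using x(1) by (rule cord_add_less)
        finally show False using y(2) by simp
      qed
    qed
  qed (simp add: cord_add_0)
qed

lemma cord_mult_less: "a \<noteq> 0 \<Longrightarrow> x < y \<Longrightarrow> a * x < a * (y :: cord)"
  using cord_add_less[of 0 a "a * x"] cord_mult_add_le[of x y a]
  by (simp add: cord_add_0 cord_pos_iff)

lemma cord_of_nat_simps [simp]: "cord_of_nat 0 = 0" "cord_of_nat (Suc n) = csucc (cord_of_nat n)"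
  by (simp_all add: cord_of_nat_def)

lemma bdd_above_cord_of_nat: "bdd_above (range cord_of_nat)"
  by (rule countable_bdd_above_cord) simp

lemma cord_of_nat_less_omega: "cord_of_nat n < omega"
proof -
  have "cord_of_nat (Suc n) \<le> omega"
    unfolding omega_def by (rule cSUP_upper[OF _ bdd_above_cord_of_nat]) simp
  then show ?thesis by (simp add: csucc_le_iff)
qed

lemma less_cord_of_nat: "y < cord_of_nat n \<Longrightarrow> \<exists>j<n. y = cord_of_nat j"
proof (induction n)
  case (Suc n)
  then have "y < cord_of_nat n \<or> y = cord_of_nat n"
    by (auto simp: less_csucc_iff)
  with Suc.IH show ?case by (auto intro: less_SucI)
qed simp

lemma less_omega: "y < omega \<Longrightarrow> \<exists>n. y = cord_of_nat n"
  unfolding omega_def using less_cSUP_iff[OF _ bdd_above_cord_of_nat, of y] less_cord_of_nat by blast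

lemma omega_neq_0: "omega \<noteq> 0"
  using cord_of_nat_less_omega[of 0] by auto

lemma cpow_omega_pos: "0 < cpow omega a"
  using cpow_le[OF omega_neq_0 zero_le_cord, of a] by (simp add: cpow_0 one_le_cord_iff)

lemma less_cpow_omega:
  assumes "a \<noteq> 0" "y < cpow omega a"
  shows "\<exists>x<a. \<exists>n. y < cpow omega x * cord_of_nat n"
proof -
  have "y < (SUP x\<in>{..<a}. cpow omega x * omega)"
    using assms by (subst (asm) cpow.simps) simp
  from less_SUP_lessThan_cord[OF assms(1) this] obtain x where x: "x < a" "y < cpow omega x * omega"
    by blast
  have "y < (SUP z\<in>{..<omega}. cpow omega x * z + cpow omega x)"
    using x(2) omega_neq_0 by (subst (asm) times_cord.simps) simp
  from less_SUP_lessThan_cord[OF omega_neq_0 this] obtain z where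
    z: "z < omega" "y < cpow omega x * csucc z" by (auto simp: cord_mult_csucc)
  obtain n where "z = cord_of_nat n" using less_omega[OF z(1)] by blast
  with z(2) have "y < cpow omega x * cord_of_nat (Suc n)" by simp
  with x(1) show ?thesis by blast
qed

lemma cpow_omega_mult_less:
  assumes "x < a"
  shows "cpow omega x * cord_of_nat n < cpow omega a"
proof -
  have "cpow omega x * cord_of_nat n < cpow omega x * omega"
    using cpow_omega_pos[of x] by (intro cord_mult_less cord_of_nat_less_omega) (simp add: cord_pos_iff)
  also have "\<dots> \<le> cpow omega a" using assms by (rule cpow_mult_le)
  finally show ?thesis .
qed

text \<open>The two cases of the rank condition on the children of a node, bundled with the fact that
  the rank of the node is the supremum of the successors of the ranks of its children.\<close>

definition rank_sequence :: "(nat \<Rightarrow> cord) \<Rightarrow> cord \<Rightarrow> bool" where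
  "rank_sequence r a \<longleftrightarrow> ((\<exists>c. \<forall>n. r n = c) \<or> strict_mono r) \<and> (\<forall>n. r n < a) \<and>
    (\<forall>x<a. \<exists>n. x \<le> r n)"

primrec power_sum :: "(nat \<Rightarrow> cord) \<Rightarrow> nat \<Rightarrow> cord" where
  "power_sum r 0 = 0"
| "power_sum r (Suc n) = power_sum r n + cpow omega (r n)"

lemma power_sum_const: "(\<And>n. r n = c) \<Longrightarrow> power_sum r n = cpow omega c * cord_of_nat n"
  by (induction n) (simp_all add: cord_mult_0 cord_mult_csucc)

text \<open>For increasing exponents each term absorbs, up to a factor 2, all terms before it.\<close>

lemma power_sum_strict_mono:
  assumes "strict_mono r"
  shows "power_sum r (Suc n) \<le> cpow omega (r n) * cord_of_nat 2"
proof (induction n)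
  case 0
  have "cpow omega (r 0) \<le> cpow omega (r 0) * cord_of_nat 2"
    by (simp add: numeral_2_eq_2 cord_mult_csucc cord_mult_0 cord_0_add cord_le_add)
  then show ?case by (simp add: cord_0_add)
next
  case (Suc n)
  have "r n < r (Suc n)" using assms by (simp add: strict_mono_Suc_iff)
  from cpow_omega_mult_less[OF this, of 2] Suc
  have "power_sum r (Suc n) \<le> cpow omega (r (Suc n))" by simp
  then have "power_sum r (Suc (Suc n)) \<le> cpow omega (r (Suc n)) + cpow omega (r (Suc n))"
    using cord_add_mono_left by (subst power_sum.simps) blast
  then show ?case
    by (simp add: numeral_2_eq_2 cord_mult_csucc cord_mult_0 cord_0_add)
qed

text \<open>The next two lemmas say that \<open>\<omega>\<close> to the power \<open>a\<close> is the supremum of the partial sums. For a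
  constant sequence \<open>c\<close> this is \<open>\<omega>\<^sup>c\<^sup>+\<^sup>1 = \<omega>\<^sup>c \<omega>\<close>; for an increasing one, each partial sum lies
  between the last power of \<open>\<omega>\<close> in it and twice that power.\<close>

lemma power_sum_less:
  assumes "rank_sequence r a"
  shows "power_sum r n < cpow omega a"
proof (cases "\<exists>c. \<forall>n. r n = c")
  case True
  then obtain c where c: "\<And>n. r n = c" by blast
  moreover have "c < a" using assms c unfolding rank_sequence_def by metis
  ultimately show ?thesis using power_sum_const[of r c] cpow_omega_mult_less by simp
next
  case False
  then have mono: "strict_mono r" using assms unfolding rank_sequence_def by blast
  have "r n < a" using assms unfolding rank_sequence_def by blast
  from cpow_omega_mult_less[OF this, of 2]
  have "power_sum r (Suc n) < cpow omega a"
    using power_sum_strict_mono[OF mono, of n] by simp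
  then show ?thesis
    using cord_le_add[of "power_sum r n" "cpow omega (r n)"] by simp
qed

lemma power_sum_cofinal:
  assumes r: "rank_sequence r a" and y: "y < cpow omega a"
  shows "\<exists>n. y < power_sum r n"
proof -
  have "a \<noteq> 0" using r unfolding rank_sequence_def by (metis not_less_zero_cord)
  from less_cpow_omega[OF this y] obtain x k where x: "x < a" "y < cpow omega x * cord_of_nat k"
    by blast
  show ?thesis
  proof (cases "\<exists>c. \<forall>n. r n = c")
    case True
    then obtain c where c: "\<And>n. r n = c" by blast
    have "x \<le> c" using r x(1) c unfolding rank_sequence_def by metis
    then have "cpow omega x * cord_of_nat k \<le> power_sum r k"
      using c by (simp add: power_sum_const[of r c] cord_mult_mono_left cpow_le omega_neq_0)
    with x(2) show ?thesis by (metis less_le_trans)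
  next
    case False
    then have mono: "strict_mono r" using r unfolding rank_sequence_def by blast
    obtain n where "x \<le> r n" using r x(1) unfolding rank_sequence_def by blast
    then have "x < r (Suc n)" using mono by (meson le_less_trans lessI strict_monoD)
    from cpow_omega_mult_less[OF this] x(2) have "y < cpow omega (r (Suc n))" by (rule less_trans[rotated])
    also have "\<dots> \<le> power_sum r (Suc (Suc n))"
      using cord_add_mono_left[OF zero_le_cord[of "power_sum r (Suc n)"], of "cpow omega (r (Suc n))"]
      by (simp add: cord_0_add)
    finally show ?thesis by blast
  qed
qed

lemma ex_rank_sequence:
  assumes "a \<noteq> (0 :: cord)"
  shows "\<exists>r. rank_sequence r a"
proof (cases "\<forall>x<a. csucc x < a")
  case False
  then obtain c where "c < a" "a = csucc c"
    by (metis csucc_le_iff order.antisym not_less)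
  then have "rank_sequence (\<lambda>n. c) a"
    by (auto simp: rank_sequence_def less_csucc_iff)
  then show ?thesis by blast
next
  case lim: True
  have ne: "{..<a} \<noteq> {}" using assms by (auto simp: cord_pos_iff[symmetric])
  \<comment> \<open>The ordinals below \<open>a\<close> are countable; exceeding them one at a time gives a cofinal sequence.\<close>
  define e where "e = from_nat_into {..<a}"
  have e: "range e = {..<a}"
    unfolding e_def by (rule range_from_nat_into[OF ne countable_lessThan_cord])
  define r where "r = rec_nat (e 0) (\<lambda>n x. csucc (max x (e n)))"
  have r_Suc: "r (Suc n) = csucc (max (r n) (e n))" for n by (simp add: r_def)
  have "e n < a" for n using e by auto
  then have less: "r n < a" for n
    by (induction n) (use lim in \<open>auto simp: r_Suc, auto simp: r_def max_def\<close>)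
  moreover have "strict_mono r"
    unfolding strict_mono_Suc_iff by (simp add: r_Suc less_csucc_iff)
  moreover have "\<exists>n. x \<le> r n" if "x < a" for x
  proof -
    obtain n where n: "x = e n" using e \<open>x < a\<close> by (metis imageE lessThan_iff)
    have "x < r (Suc n)" by (simp add: r_Suc less_csucc_iff n)
    then show ?thesis by (blast intro: less_imp_le)
  qed
  ultimately show ?thesis unfolding rank_sequence_def by blast
qed


section \<open>Ranks in trees\<close>

lemma node_rank_less:
  assumes "no_infinite_branch \<Lambda>" "s \<in> \<Lambda>" "t \<in> \<Lambda>" "strict_prefix s t"
  shows "node_rank \<Lambda> t < node_rank \<Lambda> s"
proof -
  have "node_rank \<Lambda> t + 1 \<le> (SUP t\<in>{t \<in> \<Lambda>. strict_prefix s t}. node_rank \<Lambda> t + 1)"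
    by (rule cSUP_upper) (use assms in \<open>auto intro: bdd_above_node_rank\<close>)
  moreover have "\<not> leaf \<Lambda> s" using assms unfolding leaf_def by blast
  ultimately show ?thesis
    using node_rank[OF assms(1,2)] by (simp add: cord_add_1 csucc_le_iff)
qed

lemma less_node_rank:
  assumes "no_infinite_branch \<Lambda>" "s \<in> \<Lambda>" "x < node_rank \<Lambda> s"
  shows "\<exists>t\<in>\<Lambda>. strict_prefix s t \<and> x \<le> node_rank \<Lambda> t"
proof (rule ccontr)
  assume no: "\<not> ?thesis"
  have nl: "\<not> leaf \<Lambda> s"
    using assms(3) node_rank[OF assms(1,2)] by auto
  then have "{t \<in> \<Lambda>. strict_prefix s t} \<noteq> {}"
    using assms(2) unfolding leaf_def by blast
  then have "(SUP t\<in>{t \<in> \<Lambda>. strict_prefix s t}. node_rank \<Lambda> t + 1) \<le> x"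
    using no by (intro cSUP_least) (auto simp: cord_add_1 csucc_le_iff not_le)
  with assms(3) nl node_rank[OF assms(1,2)] show False by simp
qed

lemma strict_prefix_child: "strict_prefix s t \<longleftrightarrow> (\<exists>n. prefix (s @ [n]) t)"
proof
  assume "strict_prefix s t"
  then obtain r where "t = s @ r" "r \<noteq> []" by (auto simp: strict_prefix_def prefix_def)
  then show "\<exists>n. prefix (s @ [n]) t" by (cases r) auto
qed (auto simp: strict_prefix_def prefix_def)

lemma no_infinite_branch_wf:
  "no_infinite_branch \<Lambda> \<Longrightarrow> wf {(t, s). s \<in> \<Lambda> \<and> t \<in> \<Lambda> \<and> strict_prefix s t}"
  unfolding no_infinite_branch_def wf_iff_no_infinite_down_chain by auto

locale ranked_tree =
  fixes \<Lambda> :: "node set" and \<alpha> :: cord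
  assumes rank: "tree_of_rank (Rank (\<alpha> + 1)) \<Lambda>"
begin

abbreviation "r \<equiv> node_rank \<Lambda>"

lemma tree:
  shows hereditary: "hereditary \<Lambda>" and Nil: "[] \<in> \<Lambda>" and wf_tree: "no_infinite_branch \<Lambda>"
    and root_rank: "r [] = \<alpha>"
  using rank by (auto simp: cord_add_1 csucc_inject)

lemma prefix_in: "prefix s t \<Longrightarrow> t \<in> \<Lambda> \<Longrightarrow> s \<in> \<Lambda>"
  using hereditary unfolding hereditary_def by blast

lemma leaf_rank: "leaf \<Lambda> s \<Longrightarrow> r s = 0"
  using node_rank[OF wf_tree] by (simp add: leaf_def)

lemma child_in: "s \<in> \<Lambda> \<Longrightarrow> \<not> leaf \<Lambda> s \<Longrightarrow> s @ [n] \<in> \<Lambda>"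
  using rank by auto

lemma rank_le: "s \<in> \<Lambda> \<Longrightarrow> t \<in> \<Lambda> \<Longrightarrow> prefix s t \<Longrightarrow> r t \<le> r s"
  using node_rank_less[OF wf_tree, of s t] by (cases "s = t") (auto simp: strict_prefix_def)

lemma rank_sequence_children:
  assumes "s \<in> \<Lambda>" "\<not> leaf \<Lambda> s"
  shows "rank_sequence (\<lambda>n. r (s @ [n])) (r s)"
  unfolding rank_sequence_def
proof (intro conjI allI impI)
  show "(\<exists>c. \<forall>n. r (s @ [n]) = c) \<or> strict_mono (\<lambda>n. r (s @ [n]))"
    using rank assms by (auto simp: nonleaves_def)
  show "r (s @ [n]) < r s" for n
    using assms child_in by (intro node_rank_less wf_tree) (auto simp: strict_prefix_def)
  show "\<exists>n. x \<le> r (s @ [n])" if x: "x < r s" for x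
  proof -
    obtain t where t: "t \<in> \<Lambda>" "strict_prefix s t" "x \<le> r t"
      using less_node_rank[OF wf_tree assms(1) x] by blast
    then obtain n where "prefix (s @ [n]) t" unfolding strict_prefix_child by blast
    with t rank_le[OF prefix_in[OF this t(1)] t(1) this] show ?thesis
      by (blast intro: order_trans)
  qed
qed


subsection \<open>A tree as an interval of ordinals\<close>

text \<open>The nodes of the subtree at \<open>s\<close> occupy the interval from \<open>start b s\<close> (exclusive) to
  \<open>place b s\<close> (inclusive), of length \<open>\<omega>\<close> to the rank of \<open>s\<close>: first the subtrees at the children one
  after the other, then \<open>s\<close> itself. The whole tree starts at \<open>b\<close>. In the recursion, \<open>u\<close> is the
  node reached so far and \<open>b\<close> its start.\<close>

fun start_from :: "node \<Rightarrow> cord \<Rightarrow> node \<Rightarrow> cord" where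
  "start_from u b [] = b"
| "start_from u b (n # t) = start_from (u @ [n]) (b + power_sum (\<lambda>k. r (u @ [k])) n) t"

definition start :: "cord \<Rightarrow> node \<Rightarrow> cord" where
  "start b s = start_from [] b s"

definition place :: "cord \<Rightarrow> node \<Rightarrow> cord" where
  "place b s = start b s + cpow omega (r s)"

lemma start_Nil [simp]: "start b [] = b"
  by (simp add: start_def)

lemma start_snoc: "start b (s @ [n]) = start b s + power_sum (\<lambda>k. r (s @ [k])) n"
proof -
  have "start_from u b (s @ [n]) = start_from u b s + power_sum (\<lambda>k. r (u @ s @ [k])) n" for u
    by (induction s arbitrary: u b) simp_all
  then show ?thesis by (simp add: start_def)
qed

lemma start_0 [simp]: "start b (s @ [0]) = start b s"
  by (simp add: start_snoc cord_add_0)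

lemma place_child: "place b (s @ [n]) = start b (s @ [Suc n])"
  by (simp add: place_def start_snoc cord_add_assoc)

lemma start_less_place: "start b s < place b s"
  unfolding place_def using cord_add_less[OF cpow_omega_pos, of "start b s"] by (simp add: cord_add_0)

lemma start_child_mono: "k \<le> n \<Longrightarrow> start b (s @ [k]) \<le> start b (s @ [n])"
proof (induction n)
  case (Suc n)
  have "start b (s @ [n]) \<le> start b (s @ [Suc n])"
    using start_less_place[of b "s @ [n]"] by (simp add: place_child)
  with Suc show ?case by (metis le_Suc_eq order.refl order_trans)
qed simp

lemma start_child_less:
  assumes "s \<in> \<Lambda>" "\<not> leaf \<Lambda> s"
  shows "start b (s @ [n]) < place b s"
  unfolding place_def start_snoc
  by (rule cord_add_less[OF power_sum_less[OF rank_sequence_children[OF assms]]])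

lemma start_child_cofinal:
  assumes "s \<in> \<Lambda>" "\<not> leaf \<Lambda> s" "y < place b s"
  shows "\<exists>n. y < start b (s @ [n])"
proof -
  have "cpow omega (r s) \<noteq> 0" using cpow_omega_pos[of "r s"] by (simp add: cord_pos_iff)
  from less_add_cord[OF this assms(3)[unfolded place_def]] obtain x where
    x: "x < cpow omega (r s)" "y \<le> start b s + x" by blast
  from power_sum_cofinal[OF rank_sequence_children[OF assms(1,2)] x(1)] obtain n where
    "x < power_sum (\<lambda>k. r (s @ [k])) n" by blast
  from cord_add_less[OF this, of "start b s"] x(2) show ?thesis
    unfolding start_snoc by (meson le_less_trans)
qed

lemma place_leaf: "leaf \<Lambda> s \<Longrightarrow> place b s = csucc (start b s)"
  by (simp add: place_def leaf_rank cpow_0 cord_add_1)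

lemma interval_subset:
  assumes "t \<in> \<Lambda>" "prefix s t"
  shows "start b s \<le> start b t \<and> place b t \<le> place b s"
  using assms
proof (induction t rule: rev_induct)
  case (snoc n t)
  show ?case
  proof (cases "s = t @ [n]")
    case False
    with snoc.prems have "prefix s t" "t \<in> \<Lambda>" using prefix_in[of t "t @ [n]"] by auto
    moreover have "strict_prefix t (t @ [n])" by (simp add: strict_prefix_def)
    then have "\<not> leaf \<Lambda> t"
      using snoc.prems(1) unfolding leaf_def by blast
    ultimately show ?thesis
      using snoc.IH start_child_less[of t b "Suc n"] start_child_mono[of 0 n b t]
      by (auto simp: place_child intro: order_trans)
  qed simp
qed simp

lemma not_leaf_if_child:
  assumes "t \<in> \<Lambda>" "prefix (s @ [k]) t"
  shows "s \<in> \<Lambda> \<and> \<not> leaf \<Lambda> s"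
proof
  show "s \<in> \<Lambda>" by (rule prefix_in[OF append_prefixD[OF assms(2)] assms(1)])
  have "strict_prefix s t" unfolding strict_prefix_child using assms(2) by blast
  with assms(1) show "\<not> leaf \<Lambda> s" unfolding leaf_def by blast
qed

lemma place_below_child:
  assumes "t \<in> \<Lambda>" "prefix (s @ [k]) t"
  shows "start b (s @ [k]) < place b t" "place b t \<le> start b (s @ [Suc k])" "place b t < place b s"
proof -
  show "start b (s @ [k]) < place b t"
    using interval_subset[OF assms, of b] start_less_place[of b t] by (auto intro: le_less_trans)
  show le: "place b t \<le> start b (s @ [Suc k])"
    using interval_subset[OF assms, of b] by (simp add: place_child)
  show "place b t < place b s"
    using le start_child_less not_leaf_if_child[OF assms] by (meson le_less_trans)
qed

text \<open>A proper descendant lies below its ancestor, and subtrees at different children of a node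
  occupy disjoint intervals.\<close>

lemma place_inj:
  assumes "s \<in> \<Lambda>" "t \<in> \<Lambda>" "place b s = place b t"
  shows "s = t"
proof (rule ccontr)
  assume "s \<noteq> t"
  have split: False if "s \<in> \<Lambda>" "t \<in> \<Lambda>" "place b s = place b t" "i < j"
      "prefix (u @ [i]) s" "prefix (u @ [j]) t" for s t u i j
  proof -
    have "place b s \<le> start b (u @ [j])"
      using place_below_child(2)[OF that(1,5), of b] start_child_mono[of "Suc i" j b u] that(4) by simp
    then show False
      using place_below_child(1)[OF that(2,6), of b] that(3) by simp
  qed
  consider "strict_prefix s t" | "strict_prefix t s" | "s \<parallel> t"
    using \<open>s \<noteq> t\<close> by (auto simp: strict_prefix_def parallel_def)
  then show False
  proof cases
    case 1
    then show False
      using place_below_child(3)[OF assms(2), of s _ b] assms(3) by (auto simp: strict_prefix_child)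
  next
    case 2
    then show False
      using place_below_child(3)[OF assms(1), of t _ b] assms(3) by (auto simp: strict_prefix_child)
  next
    case 3
    then obtain u i s' j t' where u: "i \<noteq> j" "s = u @ i # s'" "t = u @ j # t'"
      using parallel_decomp by blast
    have p: "prefix (u @ [i]) s" "prefix (u @ [j]) t" using u by auto
    show False
      using split[OF assms _ p] split[OF assms(2,1) assms(3)[symmetric] _ p(2,1)] u(1)
      by (meson linorder_neqE_nat)
  qed
qed

text \<open>The starts of the children of \<open>s\<close> are cofinal in the interval at \<open>s\<close>, so an ordinal in it is
  the end of the interval or lies in the interval of a child.\<close>

lemma place_surj:
  assumes "s \<in> \<Lambda>" "start b s < y" "y \<le> place b s"
  shows "\<exists>t\<in>\<Lambda>. prefix s t \<and> place b t = y"
  using wf_tree[THEN no_infinite_branch_wf] assms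
proof (induction s rule: wf_induct_rule)
  case (less s)
  show ?case
  proof (cases "y = place b s")
    case True
    then show ?thesis using less.prems(1) by blast
  next
    case False
    then have y: "y < place b s" using less.prems(3) by simp
    have nl: "\<not> leaf \<Lambda> s"
      using y less.prems(2) by (auto simp: place_leaf less_csucc_iff)
    define n where "n = (LEAST n. y \<le> start b (s @ [n]))"
    obtain n' where "y \<le> start b (s @ [n'])"
      using start_child_cofinal[OF less.prems(1) nl y] by (blast intro: less_imp_le)
    then have n: "y \<le> start b (s @ [n])" unfolding n_def by (rule LeastI)
    moreover have "n \<noteq> 0" using n less.prems(2) by (metis not_le start_0)
    then obtain k where k: "n = Suc k" by (cases n) auto
    have "\<not> y \<le> start b (s @ [k])"
      using not_less_Least[of k "\<lambda>n. y \<le> start b (s @ [n])"] k n_def by simp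
    ultimately have "start b (s @ [k]) < y" "y \<le> place b (s @ [k])"
      by (simp_all add: k place_child)
    moreover have "s @ [k] \<in> \<Lambda>" by (rule child_in[OF less.prems(1) nl])
    ultimately obtain t where "t \<in> \<Lambda>" "prefix (s @ [k]) t" "place b t = y"
      using less.IH[of "s @ [k]"] less.prems(1) by (auto simp: strict_prefix_def)
    then show ?thesis using append_prefixD by blast
  qed
qed

lemma place_neighbourhood:
  assumes "s \<in> \<Lambda>" "start b (s @ [n]) < y" "y \<le> place b s"
  shows "\<exists>t\<in>\<Lambda>. place b t = y \<and> (t = s \<or> (\<exists>k\<ge>n. prefix (s @ [k]) t))"
proof -
  have "start b s < y"
    using start_child_mono[of 0 n b s] assms(2) by simp
  from place_surj[OF assms(1) this assms(3)] obtain t where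
    t: "t \<in> \<Lambda>" "prefix s t" "place b t = y" by blast
  have "n \<le> k" if "prefix (s @ [k]) t" for k
  proof (rule ccontr)
    assume "\<not> n \<le> k"
    then have "place b t \<le> start b (s @ [n])"
      using place_below_child(2)[OF t(1) that, of b] start_child_mono[of "Suc k" n b s] by simp
    with t(3) assms(2) show False by simp
  qed
  moreover have "t = s \<or> (\<exists>k. prefix (s @ [k]) t)"
    using t(2) by (auto simp: strict_prefix_child[symmetric] strict_prefix_def)
  ultimately show ?thesis using t by blast
qed

end


section \<open>Existence of trees of given rank\<close>

text \<open>If trees are joined below a new root, no node gains or loses proper descendants, on which its
  rank and whether it is a leaf depend.\<close>

lemma descendants_join:
  assumes "\<Lambda> = insert [] {n # t | n t. t \<in> L n}"
  shows "{u \<in> \<Lambda>. strict_prefix (n # t) u} = (\<lambda>u. n # u) ` {u \<in> L n. strict_prefix t u}"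
proof (rule set_eqI)
  fix u
  show "u \<in> {u \<in> \<Lambda>. strict_prefix (n # t) u} \<longleftrightarrow>
      u \<in> (\<lambda>u. n # u) ` {u \<in> L n. strict_prefix t u}"
    by (cases u) (auto simp: assms)
qed

lemma leaf_join:
  assumes "\<Lambda> = insert [] {n # t | n t. t \<in> L n}"
  shows "leaf \<Lambda> (n # t) \<longleftrightarrow> leaf (L n) t"
proof -
  have "leaf \<Lambda> (n # t) \<longleftrightarrow> n # t \<in> \<Lambda> \<and> {u \<in> \<Lambda>. strict_prefix (n # t) u} = {}"
    unfolding leaf_def by blast
  also have "\<dots> \<longleftrightarrow> t \<in> L n \<and> {u \<in> L n. strict_prefix t u} = {}"
    unfolding descendants_join[OF assms] by (simp add: assms)
  also have "\<dots> \<longleftrightarrow> leaf (L n) t"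
    unfolding leaf_def by blast
  finally show ?thesis .
qed

lemma node_rank_join:
  assumes L: "\<And>n. no_infinite_branch (L n)" and \<Lambda>: "\<Lambda> = insert [] {n # t | n t. t \<in> L n}"
    and wf: "no_infinite_branch \<Lambda>" and "t \<in> L n"
  shows "node_rank \<Lambda> (n # t) = node_rank (L n) t"
  using no_infinite_branch_wf[OF L, of n] assms(4)
proof (induction t rule: wf_induct_rule)
  case (less t)
  have "n # t \<in> \<Lambda>" using less.prems by (simp add: \<Lambda>)
  have "(SUP u\<in>{u \<in> \<Lambda>. strict_prefix (n # t) u}. node_rank \<Lambda> u + 1) =
      (SUP u\<in>{u \<in> L n. strict_prefix t u}. node_rank (L n) u + 1)"
    unfolding descendants_join[OF \<Lambda>] image_image using less by (intro SUP_cong) auto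
  then show ?case
    unfolding node_rank[OF wf \<open>n # t \<in> \<Lambda>\<close>] node_rank[OF L less.prems] leaf_join[OF \<Lambda>] by simp
qed

lemma ex_tree_of_rank: "\<exists>\<Lambda>. tree_of_rank (Rank (\<alpha> + 1)) \<Lambda>"
proof (induction \<alpha> rule: less_induct)
  case (less \<alpha>)
  show ?case
  proof (cases "\<alpha> = 0")
    case True
    have leaf: "leaf {[]} []" by (simp add: leaf_def)
    have wf: "no_infinite_branch {[]}"
      unfolding no_infinite_branch_def by (metis prefix_order.less_irrefl singletonD)
    have "node_rank {[]} [] = 0" using node_rank[OF wf, of "[]"] leaf by simp
    with leaf wf True have "tree_of_rank (Rank (\<alpha> + 1)) {[]}"
      by (simp add: hereditary_def nonleaves_def)
    then show ?thesis by blast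
  next
    case False
    then obtain r where r: "rank_sequence r \<alpha>" using ex_rank_sequence by blast
    then have r_less: "r n < \<alpha>" for n unfolding rank_sequence_def by blast
    then have "\<forall>n. \<exists>L. tree_of_rank (Rank (r n + 1)) L" using less by blast
    then obtain L where L: "\<And>n. tree_of_rank (Rank (r n + 1)) (L n)" by metis
    interpret L: ranked_tree "L n" "r n" for n using L by unfold_locales
    define \<Lambda> where "\<Lambda> = insert [] {n # t | n t. t \<in> L n}"
    have Cons_in: "n # t \<in> \<Lambda> \<longleftrightarrow> t \<in> L n" for n t by (simp add: \<Lambda>_def)
    have Nil_in: "[] \<in> \<Lambda>" by (simp add: \<Lambda>_def)
    have her: "hereditary \<Lambda>"
      unfolding hereditary_def
    proof (intro allI impI, elim conjE)
      fix s t assume "prefix s t" "t \<in> \<Lambda>"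
      then show "s \<in> \<Lambda>"
        using L.prefix_in Nil_in Cons_in by (cases s; cases t) auto
    qed
    have wf: "no_infinite_branch \<Lambda>"
      unfolding no_infinite_branch_def
    proof
      assume "\<exists>b. \<forall>n. b n \<in> \<Lambda> \<and> strict_prefix (b n) (b (Suc n))"
      then obtain b where b: "\<And>n. b n \<in> \<Lambda>" "\<And>n. strict_prefix (b n) (b (Suc n))" by blast
      obtain j v where 1: "b 1 = j # v" using b(2)[of 0] by (cases "b 1") auto
      have "\<exists>u. b (Suc n) = j # u" for n
      proof (induction n)
        case (Suc n)
        then show ?case using b(2)[of "Suc n"] by (auto simp: strict_prefix_def prefix_def)
      qed (use 1 in simp)
      then obtain u where u: "\<And>n. b (Suc n) = j # u n" by metis
      have "u n \<in> L j \<and> strict_prefix (u n) (u (Suc n))" for n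
        using b(1)[of "Suc n"] b(2)[of "Suc n"] by (simp add: u Cons_in)
      with L.wf_tree[of j] show False unfolding no_infinite_branch_def by blast
    qed
    have rk: "node_rank \<Lambda> (n # t) = node_rank (L n) t" if "t \<in> L n" for n t
      by (rule node_rank_join[OF L.wf_tree \<Lambda>_def wf that])
    have leaf: "leaf \<Lambda> (n # t) \<longleftrightarrow> leaf (L n) t" for n t
      by (rule leaf_join[OF \<Lambda>_def])
    have rk1: "node_rank \<Lambda> [n] = r n" for n
      using rk[OF L.Nil] L.root_rank by simp
    have root: "node_rank \<Lambda> [] = \<alpha>"
    proof (rule antisym; rule ccontr)
      assume "\<not> node_rank \<Lambda> [] \<le> \<alpha>"
      then have "\<alpha> < node_rank \<Lambda> []" by simp
      from less_node_rank[OF wf Nil_in this] obtain t where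
        t: "t \<in> \<Lambda>" "strict_prefix [] t" "\<alpha> \<le> node_rank \<Lambda> t" by blast
      then obtain n u where "t = n # u" "u \<in> L n" by (auto simp: \<Lambda>_def)
      then have "node_rank \<Lambda> t \<le> r n"
        using rk L.rank_le[OF L.Nil, of u n] L.root_rank by simp
      with t(3) r_less[of n] show False by simp
    next
      assume "\<not> \<alpha> \<le> node_rank \<Lambda> []"
      then obtain n where "node_rank \<Lambda> [] \<le> r n"
        using r unfolding rank_sequence_def by (meson not_le)
      moreover have "node_rank \<Lambda> [n] < node_rank \<Lambda> []"
        by (rule node_rank_less[OF wf Nil_in]) (simp_all add: Cons_in L.Nil)
      ultimately show False by (simp add: rk1)
    qed
    have "tree_of_rank (Rank (\<alpha> + 1)) \<Lambda>"
      unfolding tree_of_rank.simps root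
    proof (intro conjI her Nil_in wf refl ballI)
      fix s assume s: "s \<in> \<Lambda>"
      show "leaf \<Lambda> s \<or> (\<forall>n. s @ [n] \<in> \<Lambda>)"
        using s L.child_in by (cases s) (auto simp: Cons_in leaf L.Nil)
    next
      fix s assume s: "s \<in> nonleaves \<Lambda>"
      show "(\<exists>c. \<forall>n. node_rank \<Lambda> (s @ [n]) = c) \<or> strict_mono (\<lambda>n. node_rank \<Lambda> (s @ [n]))"
      proof (cases s)
        case Nil
        then show ?thesis using r by (simp add: rk1 rank_sequence_def)
      next
        case (Cons n t)
        then have "t \<in> L n" "\<not> leaf (L n) t"
          using s by (auto simp: nonleaves_def Cons_in leaf)
        from L.rank_sequence_children[OF this] show ?thesis
          using rk[OF L.child_in[OF \<open>t \<in> L n\<close> \<open>\<not> leaf (L n) t\<close>]]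
          by (simp add: Cons rank_sequence_def)
      qed
    qed
    then show ?thesis by blast
  qed
qed


section \<open>Ordinal intervals as completions of trees\<close>

lemma open_left_interval: "open {a<..(c :: cord)}"
proof -
  have "{a<..c} = {a<..} \<inter> {..<csucc c}" by (auto simp: less_csucc_iff)
  then show ?thesis by (simp add: open_Int)
qed

context ranked_tree
begin

text \<open>The \<open>i\<close>-th copy of the tree occupies the \<open>i\<close>-th block of length \<open>\<omega>\<^sup>\<alpha>\<close>; the copies are
  numbered from 1.\<close>

definition copy_place :: "node \<times> nat \<Rightarrow> cord" where
  "copy_place x = place (cpow omega \<alpha> * cord_of_nat (snd x - 1)) (fst x)"

lemma place_root:
  "1 \<le> i \<Longrightarrow> place (cpow omega \<alpha> * cord_of_nat (i - 1)) [] = cpow omega \<alpha> * cord_of_nat i"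
  by (cases i) (simp_all add: place_def root_rank cord_mult_csucc)

lemma cord_of_nat_mono: "i \<le> j \<Longrightarrow> cord_of_nat i \<le> cord_of_nat j"
proof (induction j)
  case (Suc j)
  have "cord_of_nat j \<le> cord_of_nat (Suc j)" by (simp add: less_imp_le less_csucc)
  with Suc show ?case by (metis le_Suc_eq order.refl order_trans)
qed simp

lemma copy_place_bounds:
  assumes "s \<in> \<Lambda>" "1 \<le> i"
  shows "cpow omega \<alpha> * cord_of_nat (i - 1) < copy_place (s, i)"
    "copy_place (s, i) \<le> cpow omega \<alpha> * cord_of_nat i"
  using interval_subset[OF assms(1), of "[]" "cpow omega \<alpha> * cord_of_nat (i - 1)"]
    start_less_place[of "cpow omega \<alpha> * cord_of_nat (i - 1)" s] place_root[OF assms(2)]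
  by (auto simp: copy_place_def)

lemma copy_place_inj: "inj_on copy_place (Sigma_copies m \<Lambda>)"
proof (rule inj_onI)
  have less: "copy_place (s, i) < copy_place (t, j)"
    if "s \<in> \<Lambda>" "t \<in> \<Lambda>" "1 \<le> i" "i < j" for s t i j
  proof -
    have "copy_place (s, i) \<le> cpow omega \<alpha> * cord_of_nat i"
      using copy_place_bounds(2) that by blast
    also have "\<dots> \<le> cpow omega \<alpha> * cord_of_nat (j - 1)"
      using that by (intro cord_mult_le cord_of_nat_mono) simp
    also have "\<dots> < copy_place (t, j)"
      using copy_place_bounds(1) that by simp
    finally show ?thesis .
  qed
  fix x y assume xy: "x \<in> Sigma_copies m \<Lambda>" "y \<in> Sigma_copies m \<Lambda>" "copy_place x = copy_place y"
  obtain s i t j where eq: "x = (s, i)" "y = (t, j)" by fastforce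
  have mem: "s \<in> \<Lambda>" "t \<in> \<Lambda>" "1 \<le> i" "1 \<le> j" using xy by (auto simp: eq Sigma_copies_def)
  have "i = j"
    using less[OF mem(1,2,3), of j] less[OF mem(2,1,4), of i] xy(3) unfolding eq
    by (metis less_irrefl linorder_neqE_nat)
  then show "x = y"
    using place_inj[OF mem(1,2)] xy(3) by (simp add: eq copy_place_def)
qed

lemma copy_place_surj:
  assumes "y \<in> {1..cpow omega \<alpha> * cord_of_nat m}"
  shows "\<exists>x\<in>Sigma_copies m \<Lambda>. copy_place x = y"
proof -
  define i where "i = (LEAST i. y \<le> cpow omega \<alpha> * cord_of_nat i)"
  have i: "y \<le> cpow omega \<alpha> * cord_of_nat i" "i \<le> m"
    using assms LeastI[of "\<lambda>i. y \<le> cpow omega \<alpha> * cord_of_nat i" m]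
      Least_le[of "\<lambda>i. y \<le> cpow omega \<alpha> * cord_of_nat i" m] unfolding i_def by auto
  have "0 < y" using assms by (simp add: one_le_cord_iff)
  then have "i \<noteq> 0" using i(1) by (metis cord_mult_0 cord_of_nat_simps(1) not_le)
  then have "i - 1 < i" by simp
  then have "cpow omega \<alpha> * cord_of_nat (i - 1) < y"
    using not_less_Least[of "i - 1" "\<lambda>i. y \<le> cpow omega \<alpha> * cord_of_nat i"]
    unfolding i_def by (simp add: not_le)
  then obtain t where "t \<in> \<Lambda>" "place (cpow omega \<alpha> * cord_of_nat (i - 1)) t = y"
    using place_surj[OF Nil, of "cpow omega \<alpha> * cord_of_nat (i - 1)" y] i(1) place_root[of i] \<open>i \<noteq> 0\<close>
    by auto
  then show ?thesis
    using i(2) \<open>i \<noteq> 0\<close> by (intro bexI[of _ "(t, i)"]) (auto simp: copy_place_def Sigma_copies_def)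
qed

lemma copy_place_in:
  assumes "x \<in> Sigma_copies m \<Lambda>"
  shows "copy_place x \<in> {1..cpow omega \<alpha> * cord_of_nat m}"
proof -
  obtain s i where x: "x = (s, i)" "s \<in> \<Lambda>" "1 \<le> i" "i \<le> m"
    using assms by (auto simp: Sigma_copies_def)
  have "0 < copy_place x"
    using copy_place_bounds(1)[OF x(2,3)] unfolding x(1) by (meson le_less_trans zero_le_cord)
  moreover have "copy_place x \<le> cpow omega \<alpha> * cord_of_nat m"
    using copy_place_bounds(2)[OF x(2,3)] cord_mult_le[OF cord_of_nat_mono[OF x(4)]]
    unfolding x(1) by (rule order_trans)
  ultimately show ?thesis by (simp add: one_le_cord_iff)
qed

text \<open>The place of a node with children is the limit of the starts of its children, so continuity
  there is continuity at the node. Continuity along infinite branches is vacuous.\<close>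

lemma code_uniform_place:
  assumes F: "continuous_on K F" and K: "\<And>s. s \<in> \<Lambda> \<Longrightarrow> place b s \<in> K"
  shows "code_uniform \<Lambda> (\<lambda>s. F (place b s) :: real)"
proof (rule code_uniform_if_local[OF hereditary])
  fix s and e :: real assume s: "s \<in> \<Lambda>" and e: "0 < e"
  obtain U where U: "open U" "place b s \<in> U"
      "\<And>y. y \<in> K \<Longrightarrow> y \<in> U \<Longrightarrow> F y \<in> ball (F (place b s)) e"
    using F[unfolded continuous_on_topological, rule_format, OF K[OF s], of "ball (F (place b s)) e"] e
    by auto
  obtain c where c: "c < place b s" "{c<..place b s} \<subseteq> U"
    using open_left[OF U(1,2) start_less_place] by blast
  show "\<exists>n. \<forall>k\<ge>n. \<forall>t\<in>\<Lambda>. prefix (s @ [k]) t \<longrightarrow> \<bar>F (place b t) - F (place b s)\<bar> < e"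
  proof (cases "leaf \<Lambda> s")
    case True
    then show ?thesis using not_leaf_if_child by blast
  next
    case False
    then obtain n where n: "c < start b (s @ [n])"
      using start_child_cofinal[OF s _ c(1)] by blast
    have "\<bar>F (place b t) - F (place b s)\<bar> < e"
      if "n \<le> k" "t \<in> \<Lambda>" "prefix (s @ [k]) t" for k t
    proof -
      have "start b (s @ [n]) < place b t"
        using start_child_mono[OF that(1), of b s] place_below_child(1)[OF that(2,3), of b] by simp
      moreover have "place b t < place b s" by (rule place_below_child(3)[OF that(2,3)])
      ultimately have "place b t \<in> {c<..place b s}"
        using n by (auto intro: less_trans less_imp_le)
      then have "place b t \<in> U" using c(2) by blast
      from U(3)[OF K[OF that(2)] this] show ?thesis
        by (simp add: dist_real_def abs_minus_commute)
    qed
    then show ?thesis by blast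
  qed
next
  fix c :: "nat \<Rightarrow> node" and e :: real
  assume c: "\<And>n. \<exists>j. c (Suc n) = c n @ [j]"
  have "strict_prefix (c n) (c (Suc n))" for n
    using c[of n] by (auto simp: strict_prefix_def)
  then obtain n where "c n \<notin> \<Lambda>"
    using wf_tree unfolding no_infinite_branch_def by blast
  then have "\<forall>t\<in>\<Lambda>. prefix (c n) t \<longrightarrow> \<bar>F (place b t) - 0\<bar> < e" using prefix_in by blast
  then show "\<exists>n d. \<forall>t\<in>\<Lambda>. prefix (c n) t \<longrightarrow> \<bar>F (place b t) - d\<bar> < e" by blast
qed

text \<open>Conversely, the place of a leaf is isolated, and the interval between the start of a late child
  of a node and the place of that node contains only places of descendants of late children.\<close>

lemma continuous_if_code_uniform:
  assumes g: "copies_uniform m \<Lambda> g"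
    and F: "\<And>x. x \<in> Sigma_copies m \<Lambda> \<Longrightarrow> F (copy_place x) = g x"
  shows "continuous_on {1..cpow omega \<alpha> * cord_of_nat m} F"
  unfolding continuous_on_topological
proof (intro ballI allI impI)
  fix y and B :: "real set"
  assume y: "y \<in> {1..cpow omega \<alpha> * cord_of_nat m}" and B: "open B" "F y \<in> B"
  obtain e where e: "0 < e" "\<And>z. \<bar>z - F y\<bar> < e \<Longrightarrow> z \<in> B"
    using B unfolding open_dist dist_real_def by blast
  obtain s i where si: "(s, i) \<in> Sigma_copies m \<Lambda>" "y = copy_place (s, i)"
    using copy_place_surj[OF y] by auto
  then have s: "s \<in> \<Lambda>" and i: "i \<in> {1..m}" by (auto simp: Sigma_copies_def)
  define b where "b = cpow omega \<alpha> * cord_of_nat (i - 1)"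
  have y_eq: "y = place b s" by (simp add: si copy_place_def b_def)
  have Ft: "F (place b t) = g (t, i)" if "t \<in> \<Lambda>" for t
    using F[of "(t, i)"] that i by (simp add: copy_place_def b_def Sigma_copies_def)
  have "code_uniform \<Lambda> (\<lambda>s. g (s, i))" using g i unfolding copies_uniform_def by blast
  from code_uniform_node[OF this s e(1)] obtain n where
    n: "\<And>k t. n \<le> k \<Longrightarrow> t \<in> \<Lambda> \<Longrightarrow> prefix (s @ [k]) t \<Longrightarrow> \<bar>g (t, i) - g (s, i)\<bar> < e" by blast
  define a where "a = (if leaf \<Lambda> s then start b s else start b (s @ [n]))"
  have "a < place b s"
    unfolding a_def using start_less_place start_child_less[OF s] by simp
  moreover have "F z \<in> B" if z: "a < z" "z \<le> place b s" for z
  proof (cases "leaf \<Lambda> s")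
    case True
    then have "z = place b s"
      using z csucc_le_iff[of "start b s" z] by (simp add: a_def place_leaf)
    then show ?thesis using B(2) y_eq by simp
  next
    case False
    then have "start b (s @ [n]) < z" using z(1) by (simp add: a_def)
    from place_neighbourhood[OF s this z(2)] obtain t where
      t: "t \<in> \<Lambda>" "place b t = z" "t = s \<or> (\<exists>k\<ge>n. prefix (s @ [k]) t)" by blast
    then have "\<bar>g (t, i) - g (s, i)\<bar> < e" using n e(1) by auto
    then show ?thesis
      using e(2)[of "F z"] Ft[OF t(1)] Ft[OF s] t(2) y_eq by simp
  qed
  ultimately show "\<exists>A. open A \<and> y \<in> A \<and>
      (\<forall>z\<in>{1..cpow omega \<alpha> * cord_of_nat m}. z \<in> A \<longrightarrow> F z \<in> B)"
    by (intro exI[of _ "{a<..place b s}"]) (auto simp: open_left_interval y_eq)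
qed

lemma tree_completion_ordinal:
  assumes "1 \<le> m"
  shows "tree_completion {1..cpow omega \<alpha> * cord_of_nat m} m \<Lambda> copy_place"
proof
  let ?K = "{1..cpow omega \<alpha> * cord_of_nat m}"
  show "1 \<le> m" "hereditary \<Lambda>" "[] \<in> \<Lambda>" by (fact assms hereditary Nil)+
  show "x \<in> Sigma_copies m \<Lambda> \<Longrightarrow> copy_place x \<in> ?K" for x by (rule copy_place_in)
  show "\<bar>F y\<bar> \<le> C" if "\<And>x. x \<in> Sigma_copies m \<Lambda> \<Longrightarrow> \<bar>F (copy_place x)\<bar> \<le> C" "y \<in> ?K"
    for F :: "cord \<Rightarrow> real" and C y
    using copy_place_surj[OF that(2)] that(1) by blast
  show "copies_uniform m \<Lambda> (\<lambda>x. F (copy_place x))" if "F \<in> cspace ?K" for F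
    unfolding copies_uniform_def copy_place_def fst_conv snd_conv
  proof
    fix i assume "i \<in> {1..m}"
    then show "code_uniform \<Lambda> (\<lambda>s. F (place (cpow omega \<alpha> * cord_of_nat (i - 1)) s))"
      using that copy_place_in[of "(_, i)" m]
      by (intro code_uniform_place[of ?K]) (auto simp: cspace_def copy_place_def Sigma_copies_def)
  qed
  show "\<exists>F\<in>cspace ?K. \<forall>x\<in>Sigma_copies m \<Lambda>. F (copy_place x) = g x"
    if g: "copies_uniform m \<Lambda> g" for g
  proof -
    define F where "F y = (if y \<in> ?K then g (inv_into (Sigma_copies m \<Lambda>) copy_place y) else 0)" for y
    have F: "F (copy_place x) = g x" if "x \<in> Sigma_copies m \<Lambda>" for x
      using copy_place_in[OF that] inv_into_f_f[OF copy_place_inj that] by (simp add: F_def)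
    have "F \<in> cspace ?K"
      using continuous_if_code_uniform[OF g F] by (simp add: cspace_def F_def)
    with F show ?thesis by blast
  qed
qed

end


section \<open>Projectional trees and spaces of continuous functions\<close>

lemma ordinal_completion:
  assumes "1 \<le> m" "tree_of_rank (Rank (\<alpha> + 1)) \<Lambda>"
  shows "\<exists>\<iota>. tree_completion {1..cpow omega \<alpha> * cord_of_nat m} m \<Lambda> \<iota>"
  using ranked_tree.tree_completion_ordinal[OF ranked_tree.intro] assms by blast

theorem theorem4p10:
  shows
    "(\<forall>(\<alpha> :: cord) (m :: nat). 1 \<le> m \<longrightarrow>
      ((\<exists>Y :: 'e::banach set. complemented Y \<and> C_isomorphic {1..cpow omega \<alpha> * cord_of_nat m} Y) \<longleftrightarrow>
        (\<exists>\<Lambda> (T :: _ \<Rightarrow> 'e) \<rho>. projectional_tree (Rank (\<alpha> + 1)) m \<Lambda> T \<rho>)) \<and>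
      ((\<exists>Y :: 'e::banach set. complemented Y \<and> C_isometric {1..cpow omega \<alpha> * cord_of_nat m} Y) \<longleftrightarrow>
        (\<exists>\<Lambda> (T :: _ \<Rightarrow> 'e) \<rho>. isometric_projectional_tree (Rank (\<alpha> + 1)) m \<Lambda> T \<rho>)) \<and>
      ((\<exists>\<Lambda> (T :: _ \<Rightarrow> 'e) \<rho>. isometric_projectional_tree (Rank (\<alpha> + 1)) m \<Lambda> T \<rho> \<and>
           projectional_tree_norm m \<Lambda> \<rho> = 1) \<longrightarrow>
        (\<exists>(Y :: 'e set) P. complemented Y \<and> C_isometric {1..cpow omega \<alpha> * cord_of_nat m} Y \<and> projection_onto Y P \<and> norm P = 1)) \<and>
      (\<forall>inf le less sup. banach_lattice inf le less (sup :: 'e \<Rightarrow> 'e \<Rightarrow> 'e) \<longrightarrow>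
        ((\<exists>\<Lambda> (T :: _ \<Rightarrow> 'e) \<rho>. positive_projectional_tree le (Rank (\<alpha> + 1)) m \<Lambda> T \<rho>) \<longrightarrow>
          (\<exists>(Y :: 'e set) P. complemented Y \<and> C_isomorphic {1..cpow omega \<alpha> * cord_of_nat m} Y \<and> projection_onto Y P \<and>
             positive_operator le P)) \<and>
        ((\<exists>\<Lambda> (T :: _ \<Rightarrow> 'e) \<rho>. positive_projectional_tree le (Rank (\<alpha> + 1)) m \<Lambda> T \<rho> \<and>
             isometric_projectional_tree (Rank (\<alpha> + 1)) m \<Lambda> T \<rho>) \<longrightarrow>
          (\<exists>(Y :: 'e set) P. complemented Y \<and> C_isometric {1..cpow omega \<alpha> * cord_of_nat m} Y \<and> projection_onto Y P \<and>
             positive_operator le P)))) \<and>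
     (((\<exists>Y :: 'e::banach set. complemented Y \<and> C_isomorphic (UNIV :: (nat \<Rightarrow> bool) set) Y) \<longleftrightarrow>
        (\<exists>\<Lambda> (T :: _ \<Rightarrow> 'e) \<rho>. projectional_tree Infinite_Rank 1 \<Lambda> T \<rho>)) \<and>
      ((\<exists>Y :: 'e::banach set. complemented Y \<and> C_isometric (UNIV :: (nat \<Rightarrow> bool) set) Y) \<longleftrightarrow>
        (\<exists>\<Lambda> (T :: _ \<Rightarrow> 'e) \<rho>. isometric_projectional_tree Infinite_Rank 1 \<Lambda> T \<rho>)) \<and>
      ((\<exists>\<Lambda> (T :: _ \<Rightarrow> 'e) \<rho>. isometric_projectional_tree Infinite_Rank 1 \<Lambda> T \<rho> \<and>
           projectional_tree_norm 1 \<Lambda> \<rho> = 1) \<longrightarrow>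
        (\<exists>(Y :: 'e set) P. complemented Y \<and> C_isometric (UNIV :: (nat \<Rightarrow> bool) set) Y \<and> projection_onto Y P \<and> norm P = 1)) \<and>
      (\<forall>inf le less sup. banach_lattice inf le less (sup :: 'e \<Rightarrow> 'e \<Rightarrow> 'e) \<longrightarrow>
        ((\<exists>\<Lambda> (T :: _ \<Rightarrow> 'e) \<rho>. positive_projectional_tree le Infinite_Rank 1 \<Lambda> T \<rho>) \<longrightarrow>
          (\<exists>(Y :: 'e set) P. complemented Y \<and> C_isomorphic (UNIV :: (nat \<Rightarrow> bool) set) Y \<and> projection_onto Y P \<and>
             positive_operator le P)) \<and>
        ((\<exists>\<Lambda> (T :: _ \<Rightarrow> 'e) \<rho>. positive_projectional_tree le Infinite_Rank 1 \<Lambda> T \<rho> \<and>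
             isometric_projectional_tree Infinite_Rank 1 \<Lambda> T \<rho>) \<longrightarrow>
          (\<exists>(Y :: 'e set) P. complemented Y \<and> C_isometric (UNIV :: (nat \<Rightarrow> bool) set) Y \<and> projection_onto Y P \<and>
             positive_operator le P))))"
  (is "(\<forall>\<alpha> m. 1 \<le> m \<longrightarrow> ?ordinal \<alpha> m) \<and> ?cantor")
proof (rule conjI, rule allI, rule allI, rule impI)
  fix \<alpha> :: cord and m :: nat
  assume m: "1 \<le> m"
  obtain \<Lambda>\<^sub>0 where tree: "tree_of_rank (Rank (\<alpha> + 1)) \<Lambda>\<^sub>0"
    using ex_tree_of_rank by blast
  show "?ordinal \<alpha> m"
    by (rule complemented_iff_projectional_tree[OF tree ordinal_completion[OF m]])
next
  have tree: "tree_of_rank Infinite_Rank UNIV" by simp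
  show ?cantor
  proof (rule complemented_iff_projectional_tree[OF tree])
    fix \<Lambda> assume "tree_of_rank Infinite_Rank \<Lambda>"
    then show "\<exists>\<iota>. tree_completion (UNIV :: (nat \<Rightarrow> bool) set) 1 \<Lambda> \<iota>"
      using tree_completion_cantor by auto
  qed
qed

end
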